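(* The space $C^{\infty}_{W,V}(\mathbb{T})$, with the topology given by the Sobolev norms $\|\cdot\|_{k,W,V}$, $k\ge0$, is a nuclear space.
   Context: $W,V:\mathbb{R}\to\mathbb{R}$ are strictly increasing, $W$ càdlàg, $V$ càglàd, $W(x+1)-W(x)=W(1)-W(0)$ and $V(x+1)-V(x)=V(1)-V(0)$ for all $x$, both are continuous at $0$ and $W(0)=V(0)=0$. $\mathbb{T}=\mathbb{R}/\mathbb{Z}$; $dW((a,b])=W(b)-W(a)$, $dV([a,b))=V(b)-V(a)$; $L^2_V(\mathbb{T}),L^2_W(\mathbb{T})$ are the $L^2$ spaces with norms $\|\cdot\|_V,\|\cdot\|_W$. Strong one-sided derivatives: $D^{-}_{W}f(x)=\lim_{h\to0^-}\frac{f(x+h)-f(x)}{W(x+h)-W(x)}$, $D^{+}_{V}g(x)=\lim_{h\to0^+}\frac{g(x+h)-g(x)}{V(x+h)-V(x)}$. $D^{(n)}_{W,V}$ is the alternating composition of $n$ derivatives with $D^-_W$ applied first ($D^-_W$, $D^+_VD^-_W$, $D^-_WD^+_VD^-_W$, ...), $D^{(0)}_{W,V}=\mathrm{id}$. $C_0(\mathbb{T})$: càdlàg $f:\mathbb{T}\to\mathbb{R}$ with $\int f\,dV=0$; $C_1(\mathbb{T})$: càglàd $f:\mathbb{T}\to\mathbb{R}$ with $\int f\,dW=0$. $C^\infty_{W,V}(\mathbb{T})$ is the direct sum of the constants and the set of $f\in C_0(\mathbb{T})$ such that for all $n\ge1$ $D^{(n)}_{W,V}f$ exists everywhere and lies in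 $C_1(\mathbb{T})$ ($n$ odd) or $C_0(\mathbb{T})$ ($n$ even). $C^\infty_{V,W}(\mathbb{T})$ is defined analogously with the roles exchanged: constants plus $g\in C_1(\mathbb{T})$ whose alternating derivatives $D^+_Vg\in C_0(\mathbb{T})$, $D^-_WD^+_Vg\in C_1(\mathbb{T})$, ... all exist. Weak derivatives: $f\in L^2_V(\mathbb{T})$ has weak derivative $D^-_Wf=F\in L^2_W(\mathbb{T})$ if $\int_{\mathbb{T}}f\,D^+_Vg\,dV=-\int_{\mathbb{T}}Fg\,dW$ for all $g\in C^\infty_{V,W}(\mathbb{T})$; $h\in L^2_W(\mathbb{T})$ has weak derivative $D^+_Vh=H\in L^2_V(\mathbb{T})$ if $\int_{\mathbb{T}}h\,D^-_Wg\,dW=-\int_{\mathbb{T}}Hg\,dV$ for all $g\in C^\infty_{W,V}(\mathbb{T})$. $H^k_{W,V}(\mathbb{T})$ is the set of $f\in L^2_V(\mathbb{T})$ for which the weak $D^{(n)}_{W,V}f$ exists in $L^2_{\kappa(n)}(\mathbb{T})$ for $n=1,\dots,k$, with $\kappa(n)=W$ for $n$ odd and $V$ for $n$ even, and norm $\|f\|_{k,W,V}=\big(\|f\|_V^2+\sum_{i=1}^k\|D^{(i)}_{W,V}f\|^2_{\kappa(i)}\big)^{1/2}$; $H^0_{W,V}(\mathbb{T})=L^2_V(\mathbb{T})$. As sets (identifying functions with their $V$-a.e. classes), $C^\infty_{W,V}(\mathbb{T})=\bigcap_{k\ge1}H^k_{W,V}(\mathbb{T})$. Nuclear: if $X$ carries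 an increasing sequence of Hilbert norms $\|\cdot\|_n$, $X_n$ is the completion of $X$ for $\|\cdot\|_n$, and $X_\infty=\bigcap_nX_n$ has the Fréchet topology of all these norms, then $X_\infty$ is nuclear if for each $n\ge0$ there is $m>n$ such that the inclusion $X_m\to X_n$ is Hilbert–Schmidt. Here $X_n=H^n_{W,V}(\mathbb{T})$. *)

theory Defs
  imports "HOL-Analysis.Analysis"
begin

section \<open>Functions and measures on the circle\<close>

text \<open>Functions on \<open>\<real>/\<int>\<close> are represented by 1-periodic functions on \<open>\<real>\<close>.\<close>

definition periodic :: "(real \<Rightarrow> real) \<Rightarrow> bool" where
  "periodic f \<longleftrightarrow> (\<forall>x. f (x + 1) = f x)"

definition periodic_increments :: "(real \<Rightarrow> real) \<Rightarrow> bool" where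
  "periodic_increments F \<longleftrightarrow> (\<forall>x. F (x + 1) - F x = F 1 - F 0)"

definition cadlag :: "(real \<Rightarrow> real) \<Rightarrow> bool" where
  "cadlag f \<longleftrightarrow> (\<forall>x. continuous (at_right x) f \<and> (\<exists>l. (f \<longlongrightarrow> l) (at_left x)))"

definition caglad :: "(real \<Rightarrow> real) \<Rightarrow> bool" where
  "caglad f \<longleftrightarrow> (\<forall>x. continuous (at_left x) f \<and> (\<exists>l. (f \<longlongrightarrow> l) (at_right x)))"

text \<open>\<open>interval_measure W\<close> gives \<open>{a<..b}\<close> the mass \<open>W b - W a\<close> for right-continuous \<open>W\<close>.
  For left-continuous \<open>V\<close> the measure with mass \<open>V b - V a\<close> on \<open>{a..<b}\<close> is obtained by
  reflecting at the origin; see \<open>emeasure_interval_measure_left\<close> below.\<close>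

definition interval_measure_left :: "(real \<Rightarrow> real) \<Rightarrow> real measure" where
  "interval_measure_left V = distr (interval_measure (\<lambda>x. - V (- x))) borel uminus"

lemma emeasure_interval_measure_left:
  assumes "mono V" and "\<And>x. continuous (at_left x) V" and "a \<le> b"
  shows "emeasure (interval_measure_left V) {a..<b} = ennreal (V b - V a)"
proof -
  have rc: "continuous (at_right x) (\<lambda>x. - V (- x))" for x
  proof -
    have "(V \<longlongrightarrow> V (- x)) (at_left (- x))"
      using assms(2)[of "- x"] by (simp add: continuous_within)
    then have "((\<lambda>y. V (- y)) \<longlongrightarrow> V (- x)) (at_right x)"
      by (subst (asm) filterlim_at_left_to_right) simp
    then show ?thesis
      unfolding continuous_within by (rule tendsto_minus)
  qed
  have vim: "uminus -` {a..<b} = {- b<..- a}"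
    by auto
  have "emeasure (interval_measure_left V) {a..<b}
      = emeasure (interval_measure (\<lambda>x. - V (- x))) {- b<..- a}"
    unfolding interval_measure_left_def by (subst emeasure_distr) (auto simp: vim)
  also have "\<dots> = ennreal (- V (- (- a)) - - V (- (- b)))"
  proof (rule emeasure_interval_measure_Ioc)
    show "- b \<le> - a"
      using assms(3) by simp
    show "- V (- x) \<le> - V (- y)" if "x \<le> y" for x y
      using monoD[OF assms(1), of "- y" "- x"] that by simp
  qed (rule rc)
  finally show ?thesis
    by simp
qed

text \<open>The measures \<open>dW\<close> and \<open>dV\<close> on the circle, on the fundamental domain \<open>[0, 1)\<close>. Since \<open>W\<close> and
  \<open>V\<close> will be continuous at 0 there is no atom at 0, so \<open>(0, 1]\<close> would give the same integrals.\<close>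

definition dW :: "(real \<Rightarrow> real) \<Rightarrow> real measure" where
  "dW W = restrict_space (interval_measure W) {0..<1}"

definition dV :: "(real \<Rightarrow> real) \<Rightarrow> real measure" where
  "dV V = restrict_space (interval_measure_left V) {0..<1}"

definition L2 :: "real measure \<Rightarrow> (real \<Rightarrow> real) set" where
  "L2 \<mu> = {f. f \<in> borel_measurable borel \<and> periodic f \<and> integrable \<mu> (\<lambda>x. (f x)\<^sup>2)}"


section \<open>Strong derivatives and smooth functions\<close>

definition strong_DW :: "(real \<Rightarrow> real) \<Rightarrow> (real \<Rightarrow> real) \<Rightarrow> (real \<Rightarrow> real) \<Rightarrow> bool" where
  "strong_DW W f F \<longleftrightarrow>
    (\<forall>x. ((\<lambda>h. (f (x + h) - f x) / (W (x + h) - W x)) \<longlongrightarrow> F x) (at_left 0))"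

definition strong_DV :: "(real \<Rightarrow> real) \<Rightarrow> (real \<Rightarrow> real) \<Rightarrow> (real \<Rightarrow> real) \<Rightarrow> bool" where
  "strong_DV V g G \<longleftrightarrow>
    (\<forall>x. ((\<lambda>h. (g (x + h) - g x) / (V (x + h) - V x)) \<longlongrightarrow> G x) (at_right 0))"

text \<open>Alternating composition of \<open>n\<close> derivatives, given as relations, with \<open>D\<^sub>1\<close> applied first:
  \<open>alt_deriv D\<^sub>1 D\<^sub>2 n f F\<close> says that the \<open>n\<close>-fold derivative of \<open>f\<close> exists and equals \<open>F\<close>.\<close>

primrec alt_deriv :: "('a \<Rightarrow> 'a \<Rightarrow> bool) \<Rightarrow> ('a \<Rightarrow> 'a \<Rightarrow> bool) \<Rightarrow> nat \<Rightarrow> 'a \<Rightarrow> 'a \<Rightarrow> bool" where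
  "alt_deriv D\<^sub>1 D\<^sub>2 0 f F \<longleftrightarrow> F = f"
| "alt_deriv D\<^sub>1 D\<^sub>2 (Suc n) f F \<longleftrightarrow>
    (\<exists>G. alt_deriv D\<^sub>1 D\<^sub>2 n f G \<and> (if even n then D\<^sub>1 G F else D\<^sub>2 G F))"

definition C0 :: "(real \<Rightarrow> real) \<Rightarrow> (real \<Rightarrow> real) set" where
  "C0 V = {f. periodic f \<and> cadlag f \<and> (\<integral>x. f x \<partial>dV V) = 0}"

definition C1 :: "(real \<Rightarrow> real) \<Rightarrow> (real \<Rightarrow> real) set" where
  "C1 W = {f. periodic f \<and> caglad f \<and> (\<integral>x. f x \<partial>dW W) = 0}"

definition smooth_functions ::
  "(real \<Rightarrow> real) set \<Rightarrow> (real \<Rightarrow> real) set \<Rightarrow>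
   ((real \<Rightarrow> real) \<Rightarrow> (real \<Rightarrow> real) \<Rightarrow> bool) \<Rightarrow> ((real \<Rightarrow> real) \<Rightarrow> (real \<Rightarrow> real) \<Rightarrow> bool) \<Rightarrow>
   (real \<Rightarrow> real) set" where
  "smooth_functions A B D\<^sub>1 D\<^sub>2 = {f. \<exists>c f\<^sub>0. f = (\<lambda>x. c + f\<^sub>0 x) \<and> f\<^sub>0 \<in> A \<and>
    (\<forall>n\<ge>1. \<exists>F. alt_deriv D\<^sub>1 D\<^sub>2 n f\<^sub>0 F \<and> F \<in> (if odd n then B else A))}"

definition Cinf_WV :: "(real \<Rightarrow> real) \<Rightarrow> (real \<Rightarrow> real) \<Rightarrow> (real \<Rightarrow> real) set" where
  "Cinf_WV W V = smooth_functions (C0 V) (C1 W) (strong_DW W) (strong_DV V)"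

definition Cinf_VW :: "(real \<Rightarrow> real) \<Rightarrow> (real \<Rightarrow> real) \<Rightarrow> (real \<Rightarrow> real) set" where
  "Cinf_VW W V = smooth_functions (C1 W) (C0 V) (strong_DV V) (strong_DW W)"


section \<open>Weak derivatives and Sobolev spaces\<close>

definition weak_DW ::
  "(real \<Rightarrow> real) \<Rightarrow> (real \<Rightarrow> real) \<Rightarrow> (real \<Rightarrow> real) \<Rightarrow> (real \<Rightarrow> real) \<Rightarrow> bool" where
  "weak_DW W V f F \<longleftrightarrow> f \<in> L2 (dV V) \<and> F \<in> L2 (dW W) \<and>
    (\<forall>g\<in>Cinf_VW W V. \<forall>G. strong_DV V g G \<longrightarrow>
      (\<integral>x. f x * G x \<partial>dV V) = - (\<integral>x. F x * g x \<partial>dW W))"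

definition weak_DV ::
  "(real \<Rightarrow> real) \<Rightarrow> (real \<Rightarrow> real) \<Rightarrow> (real \<Rightarrow> real) \<Rightarrow> (real \<Rightarrow> real) \<Rightarrow> bool" where
  "weak_DV W V h H \<longleftrightarrow> h \<in> L2 (dW W) \<and> H \<in> L2 (dV V) \<and>
    (\<forall>g\<in>Cinf_WV W V. \<forall>G. strong_DW W g G \<longrightarrow>
      (\<integral>x. h x * G x \<partial>dW W) = - (\<integral>x. H x * g x \<partial>dV V))"

definition sobolev_space :: "(real \<Rightarrow> real) \<Rightarrow> (real \<Rightarrow> real) \<Rightarrow> nat \<Rightarrow> (real \<Rightarrow> real) set" where
  "sobolev_space W V k =
    {f \<in> L2 (dV V). \<forall>n\<in>{1..k}. \<exists>F. alt_deriv (weak_DW W V) (weak_DV W V) n f F}"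

text \<open>A representative of the weak derivative, which is determined only almost everywhere.\<close>

definition weak_deriv ::
  "(real \<Rightarrow> real) \<Rightarrow> (real \<Rightarrow> real) \<Rightarrow> nat \<Rightarrow> (real \<Rightarrow> real) \<Rightarrow> real \<Rightarrow> real" where
  "weak_deriv W V n f = (SOME F. alt_deriv (weak_DW W V) (weak_DV W V) n f F)"

definition \<kappa> :: "(real \<Rightarrow> real) \<Rightarrow> (real \<Rightarrow> real) \<Rightarrow> nat \<Rightarrow> real measure" where
  "\<kappa> W V n = (if odd n then dW W else dV V)"

definition sobolev_inner ::
  "(real \<Rightarrow> real) \<Rightarrow> (real \<Rightarrow> real) \<Rightarrow> nat \<Rightarrow> (real \<Rightarrow> real) \<Rightarrow> (real \<Rightarrow> real) \<Rightarrow> real" where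
  "sobolev_inner W V k f g = (\<integral>x. f x * g x \<partial>dV V) +
    (\<Sum>i=1..k. \<integral>x. weak_deriv W V i f x * weak_deriv W V i g x \<partial>\<kappa> W V i)"


section \<open>Hilbert spaces of functions and nuclearity\<close>

text \<open>Hilbert spaces of (almost everywhere) classes are represented by sets of functions with a
  positive semidefinite form; functions at distance 0 are identified.\<close>

type_synonym 'a form = "('a \<Rightarrow> real) \<Rightarrow> ('a \<Rightarrow> real) \<Rightarrow> real"

definition form_norm :: "'a form \<Rightarrow> ('a \<Rightarrow> real) \<Rightarrow> real" where
  "form_norm ip f = sqrt (ip f f)"

lemma form_norm_sobolev_inner:
  "form_norm (sobolev_inner W V k) f =
    sqrt ((\<integral>x. (f x)\<^sup>2 \<partial>dV V) + (\<Sum>i=1..k. \<integral>x. (weak_deriv W V i f x)\<^sup>2 \<partial>\<kappa> W V i))"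
  by (simp add: form_norm_def sobolev_inner_def power2_eq_square)

definition form_dist :: "'a form \<Rightarrow> ('a \<Rightarrow> real) \<Rightarrow> ('a \<Rightarrow> real) \<Rightarrow> real" where
  "form_dist ip f g = form_norm ip (\<lambda>x. f x - g x)"

definition function_subspace :: "('a \<Rightarrow> real) set \<Rightarrow> bool" where
  "function_subspace H \<longleftrightarrow> (\<lambda>x. 0) \<in> H \<and>
    (\<forall>f\<in>H. \<forall>g\<in>H. (\<lambda>x. f x + g x) \<in> H) \<and> (\<forall>c. \<forall>f\<in>H. (\<lambda>x. c * f x) \<in> H)"

definition semi_inner_product :: "('a \<Rightarrow> real) set \<Rightarrow> 'a form \<Rightarrow> bool" where
  "semi_inner_product H ip \<longleftrightarrow>
    (\<forall>f\<in>H. \<forall>g\<in>H. ip f g = ip g f) \<and>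
    (\<forall>f\<in>H. \<forall>g\<in>H. \<forall>h\<in>H. ip (\<lambda>x. f x + g x) h = ip f h + ip g h) \<and>
    (\<forall>c. \<forall>f\<in>H. \<forall>g\<in>H. ip (\<lambda>x. c * f x) g = c * ip f g) \<and>
    (\<forall>f\<in>H. 0 \<le> ip f f)"

definition hilbert_space :: "('a \<Rightarrow> real) set \<Rightarrow> 'a form \<Rightarrow> bool" where
  "hilbert_space H ip \<longleftrightarrow> function_subspace H \<and> semi_inner_product H ip \<and>
    (\<forall>s. range s \<subseteq> H \<and> (\<forall>\<epsilon>>0. \<exists>N. \<forall>i\<ge>N. \<forall>j\<ge>N. form_dist ip (s i) (s j) < \<epsilon>) \<longrightarrow>
      (\<exists>f\<in>H. (\<lambda>i. form_dist ip (s i) f) \<longlonglongrightarrow> 0))"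

definition dense_in :: "'a form \<Rightarrow> ('a \<Rightarrow> real) set \<Rightarrow> ('a \<Rightarrow> real) set \<Rightarrow> bool" where
  "dense_in ip X H \<longleftrightarrow> X \<subseteq> H \<and> (\<forall>f\<in>H. \<forall>\<epsilon>>0. \<exists>g\<in>X. form_dist ip f g < \<epsilon>)"

definition lin_span :: "('a \<Rightarrow> real) set \<Rightarrow> ('a \<Rightarrow> real) set" where
  "lin_span E = {f. \<exists>A c. finite A \<and> A \<subseteq> E \<and> f = (\<lambda>x. \<Sum>e\<in>A. c e * e x)}"

definition orthonormal_basis :: "('a \<Rightarrow> real) set \<Rightarrow> 'a form \<Rightarrow> ('a \<Rightarrow> real) set \<Rightarrow> bool" where
  "orthonormal_basis H ip E \<longleftrightarrow> E \<subseteq> H \<and>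
    (\<forall>e\<in>E. \<forall>e'\<in>E. ip e e' = (if e = e' then 1 else 0)) \<and> dense_in ip (lin_span E) H"

definition hilbert_schmidt ::
  "('a \<Rightarrow> real) set \<Rightarrow> 'a form \<Rightarrow> ('b \<Rightarrow> real) set \<Rightarrow> 'b form \<Rightarrow>
   (('a \<Rightarrow> real) \<Rightarrow> ('b \<Rightarrow> real)) \<Rightarrow> bool" where
  "hilbert_schmidt H ip K ip' T \<longleftrightarrow>
    T ` H \<subseteq> K \<and>
    (\<forall>f\<in>H. \<forall>g\<in>H. T (\<lambda>x. f x + g x) = (\<lambda>x. T f x + T g x)) \<and>
    (\<forall>c. \<forall>f\<in>H. T (\<lambda>x. c * f x) = (\<lambda>x. c * T f x)) \<and>
    (\<exists>C. \<forall>f\<in>H. form_norm ip' (T f) \<le> C * form_norm ip f) \<and>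
    (\<exists>E. orthonormal_basis H ip E \<and> (\<lambda>e. (form_norm ip' (T e))\<^sup>2) summable_on E)"

text \<open>\<open>X\<close> carries increasing Hilbert norms given by the forms \<open>ip n\<close>, the Hilbert space \<open>Y n\<close> is
  the completion of \<open>X\<close> for the \<open>n\<close>-th norm, and \<open>X\<close> is the intersection of the \<open>Y n\<close>. The
  intersection is understood up to the identification of functions at \<open>ip 0\<close>-distance 0, and all
  the norms have to induce this same identification.\<close>

definition countably_hilbert ::
  "('a \<Rightarrow> real) set \<Rightarrow> (nat \<Rightarrow> ('a \<Rightarrow> real) set) \<Rightarrow> (nat \<Rightarrow> 'a form) \<Rightarrow> bool" where
  "countably_hilbert X Y ip \<longleftrightarrow>
    function_subspace X \<and>
    (\<forall>n. hilbert_space (Y n) (ip n) \<and> dense_in (ip n) X (Y n)) \<and>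
    (\<forall>n. Y (Suc n) \<subseteq> Y n \<and> (\<forall>f\<in>Y (Suc n). form_norm (ip n) f \<le> form_norm (ip (Suc n)) f)) \<and>
    (\<forall>n. \<forall>f\<in>Y n. form_norm (ip n) f = 0 \<longleftrightarrow> form_norm (ip 0) f = 0) \<and>
    (\<forall>f. f \<in> (\<Inter>n. Y n) \<longleftrightarrow> f \<in> Y 0 \<and> (\<exists>g\<in>X. form_dist (ip 0) f g = 0))"

definition nuclear_space ::
  "('a \<Rightarrow> real) set \<Rightarrow> (nat \<Rightarrow> ('a \<Rightarrow> real) set) \<Rightarrow> (nat \<Rightarrow> 'a form) \<Rightarrow> bool" where
  "nuclear_space X Y ip \<longleftrightarrow> countably_hilbert X Y ip \<and>
    (\<forall>n. \<exists>m>n. hilbert_schmidt (Y m) (ip m) (Y n) (ip n) (\<lambda>f. f))"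

end

theory Submission
  imports Defs
begin

text \<open>
  Why the space is nuclear. Everything rests on a pair of operators. For \<open>F\<close> of mean zero, let \<open>J p F\<close> be
  its primitive with respect to \<open>dW\<close> (for \<open>p = False\<close>) or \<open>dV\<close> (for \<open>p = True\<close>), normalised to
  mean zero for the measure of the other kind. The two operators \<open>J False\<close> and \<open>J True\<close> go back and
  forth between the spaces \<open>L0 p\<close> of square-integrable functions of mean zero, and they have four
  properties. They are bounded even into the supremum norm (\<open>abs_J_le\<close>). They are negative adjoints
  of each other (\<open>J_parts\<close>); since the primitives for \<open>dW\<close> are right-continuous and those for \<open>dV\<close>
  left-continuous, common jumps of \<open>W\<close> and \<open>V\<close> contribute no extra terms. They are injective
  (\<open>J_const_imp_AE_zero\<close>), because strictly increasing \<open>W\<close> and \<open>V\<close> give measures of full support.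
  And on regular functions of mean zero they invert the one-sided derivatives (\<open>D_J\<close>, \<open>D_imp_eq_J\<close>).

  Hence the smooth functions of mean zero are exactly those that are infinitely often a primitive.
  They are dense in \<open>L0 p\<close> (\<open>S0_dense\<close>): the range of each \<open>J p\<close> is dense, because its
  orthogonal complement is the kernel of \<open>J (\<not> p)\<close>, and a Mittag-Leffler argument passes from the
  ranges of finite compositions to the functions that are infinitely often a primitive. By density
  of the test functions, \<open>f\<close> has the weak derivative \<open>F\<close> if and only if \<open>f = c + J p F\<close> almost
  everywhere for some constant \<open>c\<close> (\<open>weak_iff\<close>), so the \<open>k\<close>-th Sobolev space consists of the
  constants plus the \<open>k\<close>-fold primitives (\<open>sob_iff\<close>). Completeness, density of the smooth functions
  in each of these spaces and the identification of their intersection follow from this description.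

  For the inclusion of the \<open>n + 1\<close>-st Sobolev space into the \<open>n\<close>-th, the supremum bound on \<open>J p\<close>
  says that evaluating the \<open>i\<close>-th derivative at a point, for \<open>i \<le> n\<close>, is a functional on the larger
  space whose norm has a bound \<open>rep_bound\<close> independent of the point. By Bessel's inequality the squares
  of its values on an orthonormal family sum to at most \<open>rep_bound\<^sup>2\<close>, and integrating over the
  circle bounds the Hilbert--Schmidt sum (\<open>sum_nrm_d_sq_le\<close>, \<open>hilbert_schmidt_inclusion\<close>).
\<close>

section \<open>Function spaces with a positive semidefinite form\<close>

locale semi_inner_space =
  fixes H :: "('a \<Rightarrow> real) set" and ip :: "'a form"
  assumes subspace: "function_subspace H"
    and semi_inner: "semi_inner_product H ip"
begin

lemma zero_mem: "(\<lambda>x. 0) \<in> H"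
  and add_mem: "f \<in> H \<Longrightarrow> g \<in> H \<Longrightarrow> (\<lambda>x. f x + g x) \<in> H"
  and scale_mem: "f \<in> H \<Longrightarrow> (\<lambda>x. c * f x) \<in> H"
  using subspace by (auto simp: function_subspace_def)

lemma diff_mem: "f \<in> H \<Longrightarrow> g \<in> H \<Longrightarrow> (\<lambda>x. f x - g x) \<in> H"
  using add_mem[of f "\<lambda>x. - 1 * g x"] scale_mem[of g "- 1"] by simp

lemma sum_mem: "(\<And>i. i \<in> A \<Longrightarrow> f i \<in> H) \<Longrightarrow> (\<lambda>x. \<Sum>i\<in>A. f i x) \<in> H"
proof (induction A rule: infinite_finite_induct)
  case (insert a A)
  then show ?case
    using add_mem[of "f a" "\<lambda>x. \<Sum>i\<in>A. f i x"] by simp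
qed (auto simp: zero_mem)

lemma ip_commute: "f \<in> H \<Longrightarrow> g \<in> H \<Longrightarrow> ip f g = ip g f"
  and ip_add_left: "f \<in> H \<Longrightarrow> g \<in> H \<Longrightarrow> h \<in> H \<Longrightarrow> ip (\<lambda>x. f x + g x) h = ip f h + ip g h"
  and ip_scale_left: "f \<in> H \<Longrightarrow> g \<in> H \<Longrightarrow> ip (\<lambda>x. c * f x) g = c * ip f g"
  and ip_nonneg: "f \<in> H \<Longrightarrow> 0 \<le> ip f f"
  using semi_inner by (auto simp: semi_inner_product_def)

lemma ip_diff_left: "f \<in> H \<Longrightarrow> g \<in> H \<Longrightarrow> h \<in> H \<Longrightarrow> ip (\<lambda>x. f x - g x) h = ip f h - ip g h"
  using ip_add_left[of f "\<lambda>x. - 1 * g x" h] ip_scale_left[of g h "- 1"] scale_mem[of g "- 1"]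
  by simp

lemma ip_scale_right: "f \<in> H \<Longrightarrow> g \<in> H \<Longrightarrow> ip f (\<lambda>x. c * g x) = c * ip f g"
  using ip_commute ip_scale_left scale_mem by metis

lemma ip_add_right:
  "f \<in> H \<Longrightarrow> g \<in> H \<Longrightarrow> h \<in> H \<Longrightarrow> ip f (\<lambda>x. g x + h x) = ip f g + ip f h"
  using ip_commute ip_add_left[of g h f] add_mem by (metis (no_types, lifting))

lemma ip_diff_right:
  "f \<in> H \<Longrightarrow> g \<in> H \<Longrightarrow> h \<in> H \<Longrightarrow> ip f (\<lambda>x. g x - h x) = ip f g - ip f h"
  using ip_commute ip_diff_left[of g h f] diff_mem by (metis (no_types, lifting))

lemma ip_zero_left: "f \<in> H \<Longrightarrow> ip (\<lambda>x. 0) f = 0"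
  using ip_scale_left[of f f 0] by simp

lemma ip_sum_left:
  assumes "\<And>i. i \<in> A \<Longrightarrow> f i \<in> H" and "g \<in> H"
  shows "ip (\<lambda>x. \<Sum>i\<in>A. f i x) g = (\<Sum>i\<in>A. ip (f i) g)"
  using assms
proof (induction A rule: infinite_finite_induct)
  case (insert a A)
  then show ?case
    using ip_add_left[of "f a" "\<lambda>x. \<Sum>i\<in>A. f i x" g] sum_mem[of A f] by simp
qed (auto simp: ip_zero_left)

lemma form_norm_nonneg: "f \<in> H \<Longrightarrow> 0 \<le> form_norm ip f"
  by (simp add: form_norm_def ip_nonneg)

lemma form_norm_sq: "f \<in> H \<Longrightarrow> (form_norm ip f)\<^sup>2 = ip f f"
  by (simp add: form_norm_def ip_nonneg)

lemma form_norm_scale: "f \<in> H \<Longrightarrow> form_norm ip (\<lambda>x. c * f x) = \<bar>c\<bar> * form_norm ip f"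
  using ip_scale_left[of f "\<lambda>x. c * f x" c] ip_scale_right[of f f c] scale_mem[of f c]
  by (simp add: form_norm_def real_sqrt_mult flip: mult.assoc)

lemma ip_diff_scale_self:
  assumes "f \<in> H" "g \<in> H"
  shows "ip (\<lambda>x. f x - c * g x) (\<lambda>x. f x - c * g x) = ip f f - 2 * c * ip f g + c\<^sup>2 * ip g g"
  using assms ip_commute[of f g] scale_mem[of g c]
  by (simp add: ip_diff_left ip_diff_right diff_mem ip_scale_left ip_scale_right power2_eq_square
      algebra_simps)

lemma Cauchy_Schwarz_sq:
  assumes "f \<in> H" "g \<in> H"
  shows "(ip f g)\<^sup>2 \<le> ip f f * ip g g"
proof -
  have q: "0 \<le> ip f f - 2 * c * ip f g + c\<^sup>2 * ip g g" for c
    using ip_nonneg[OF diff_mem[OF assms(1) scale_mem[OF assms(2)]], of c]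
    unfolding ip_diff_scale_self[OF assms] .
  show ?thesis
  proof (cases "ip g g = 0")
    case True
    have "ip f g = 0"
    proof (rule ccontr)
      assume "ip f g \<noteq> 0"
      then show False
        \<comment> \<open>this multiple of \<open>g\<close> makes the quadratic form equal to \<open>-1\<close>\<close>
        using q[of "(ip f f + 1) / (2 * ip f g)"] True by simp
    qed
    then show ?thesis using True by simp
  next
    case False
    then have p: "ip g g > 0" using ip_nonneg[OF assms(2)] by simp
    have "0 \<le> (ip f f - 2 * (ip f g / ip g g) * ip f g + (ip f g / ip g g)\<^sup>2 * ip g g) * ip g g"
      using q[of "ip f g / ip g g"] p by simp
    also have "\<dots> = ip f f * ip g g - (ip f g)\<^sup>2"
      using p by (simp add: field_simps power2_eq_square)
    finally show ?thesis by simp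
  qed
qed

lemma Cauchy_Schwarz:
  assumes "f \<in> H" "g \<in> H"
  shows "\<bar>ip f g\<bar> \<le> form_norm ip f * form_norm ip g"
  using real_sqrt_le_mono[OF Cauchy_Schwarz_sq[OF assms]]
  by (simp add: form_norm_def real_sqrt_mult)

lemma triangle:
  assumes "f \<in> H" "g \<in> H"
  shows "form_norm ip (\<lambda>x. f x + g x) \<le> form_norm ip f + form_norm ip g"
proof (rule power2_le_imp_le)
  have "ip (\<lambda>x. f x + g x) (\<lambda>x. f x + g x) = ip f f + 2 * ip f g + ip g g"
    using assms ip_commute[of f g] by (simp add: ip_add_left ip_add_right add_mem)
  also have "\<dots> \<le> ip f f + 2 * (form_norm ip f * form_norm ip g) + ip g g"
    using Cauchy_Schwarz[OF assms] by simp
  finally show "(form_norm ip (\<lambda>x. f x + g x))\<^sup>2 \<le> (form_norm ip f + form_norm ip g)\<^sup>2"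
    using assms by (simp add: form_norm_sq add_mem power2_sum)
qed (use assms form_norm_nonneg in simp)

lemma form_dist_triangle:
  assumes "f \<in> H" "g \<in> H" "h \<in> H"
  shows "form_dist ip f h \<le> form_dist ip f g + form_dist ip g h"
  using triangle[OF diff_mem[OF assms(1,2)] diff_mem[OF assms(2,3)]] by (simp add: form_dist_def)

lemma form_dist_commute: "f \<in> H \<Longrightarrow> g \<in> H \<Longrightarrow> form_dist ip f g = form_dist ip g f"
  using form_norm_scale[OF diff_mem[of f g], of "- 1"] by (simp add: form_dist_def)

lemma form_dist_nonneg: "f \<in> H \<Longrightarrow> g \<in> H \<Longrightarrow> 0 \<le> form_dist ip f g"
  by (simp add: form_dist_def form_norm_nonneg diff_mem)

lemma parallelogram_midpoint:
  assumes "f \<in> H" "g \<in> H" "h \<in> H"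
  shows "ip (\<lambda>x. g x - h x) (\<lambda>x. g x - h x) =
    2 * ip (\<lambda>x. f x - g x) (\<lambda>x. f x - g x) + 2 * ip (\<lambda>x. f x - h x) (\<lambda>x. f x - h x) -
    4 * ip (\<lambda>x. f x - 1/2 * (g x + h x)) (\<lambda>x. f x - 1/2 * (g x + h x))"
proof -
  have "ip (\<lambda>x. f x - 1/2 * (g x + h x)) (\<lambda>x. f x - 1/2 * (g x + h x)) =
    ip f f - 2 * (1/2) * ip f (\<lambda>x. g x + h x) + (1/2)\<^sup>2 * ip (\<lambda>x. g x + h x) (\<lambda>x. g x + h x)"
    by (rule ip_diff_scale_self) (use assms add_mem in auto)
  then show ?thesis
    using assms ip_commute[of f g] ip_commute[of f h] ip_commute[of g h]
    by (simp add: ip_diff_left ip_diff_right diff_mem ip_add_left ip_add_right add_mem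
        power2_eq_square field_simps)
qed

end

text \<open>The orthogonal projection onto the closure of \<open>M\<close> is a limit of elements of \<open>M\<close> whose
  distance to \<open>f\<close> tends to the infimum; the normalised residual is the vector \<open>u\<close>.\<close>

lemma exists_unit_orthogonal:
  assumes hs: "hilbert_space H ip" and M: "function_subspace M" "M \<subseteq> H"
    and f: "f \<in> H" and far: "\<epsilon> > 0" "\<And>g. g \<in> M \<Longrightarrow> \<epsilon> \<le> form_dist ip f g"
  shows "\<exists>u\<in>H. ip u u = 1 \<and> (\<forall>g\<in>M. ip u g = 0)"
proof -
  interpret semi_inner_space H ip
    using hs by unfold_locales (auto simp: hilbert_space_def)
  define q where "q g = ip (\<lambda>x. f x - g x) (\<lambda>x. f x - g x)" for g
  have M0: "(\<lambda>x. 0) \<in> M" and Ma: "\<And>g h. g \<in> M \<Longrightarrow> h \<in> M \<Longrightarrow> (\<lambda>x. g x + h x) \<in> M"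
    and Ms: "\<And>g c. g \<in> M \<Longrightarrow> (\<lambda>x. c * g x) \<in> M"
    using M(1) by (auto simp: function_subspace_def)
  have MH: "g \<in> H" if "g \<in> M" for g
    using that M(2) by auto
  have q_nonneg: "q g \<ge> 0" if "g \<in> M" for g
    unfolding q_def by (intro ip_nonneg diff_mem f MH that)
  have bdd: "bdd_below (q ` M)"
    using q_nonneg by (auto intro!: bdd_belowI)
  define d where "d = Inf (q ` M)"
  have d_le: "d \<le> q g" if "g \<in> M" for g
    unfolding d_def by (rule cINF_lower[OF bdd that])
  have "\<exists>g\<in>M. q g < d + 1 / real (Suc n)" for n
  proof -
    have "Inf (q ` M) < d + 1 / real (Suc n)"
      by (simp add: d_def)
    then show ?thesis
      using cInf_lessD[of "q ` M"] M0 by blast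
  qed
  then obtain s where s: "\<And>n. s n \<in> M" and qs: "\<And>n. q (s n) < d + 1 / real (Suc n)"
    by metis
  have sH: "s n \<in> H" for n
    using s MH by auto
  have cauchy: "\<forall>e>0. \<exists>N. \<forall>i\<ge>N. \<forall>j\<ge>N. form_dist ip (s i) (s j) < e"
  proof (intro allI impI)
    fix e :: real assume e: "e > 0"
    obtain N :: nat where N: "4 / e\<^sup>2 < real N"
      using reals_Archimedean2 by blast
    have "form_dist ip (s i) (s j) < e" if "i \<ge> N" "j \<ge> N" for i j
    proof (rule power2_less_imp_less)
      have mid: "(\<lambda>x. 1/2 * (s i x + s j x)) \<in> M"
        using Ms[OF Ma[OF s[of i] s[of j]], of "1/2"] by simp
      have "(form_dist ip (s i) (s j))\<^sup>2 = ip (\<lambda>x. s i x - s j x) (\<lambda>x. s i x - s j x)"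
        unfolding form_dist_def by (intro form_norm_sq diff_mem sH)
      also have "\<dots> = 2 * q (s i) + 2 * q (s j) - 4 * q (\<lambda>x. 1/2 * (s i x + s j x))"
        unfolding q_def by (rule parallelogram_midpoint[OF f sH sH])
      also have "\<dots> < 2 / real (Suc i) + 2 / real (Suc j)"
        using qs[of i] qs[of j] d_le[OF mid] by simp
      also have "\<dots> \<le> 2 / real (Suc N) + 2 / real (Suc N)"
        by (intro add_mono divide_left_mono) (use that in auto)
      also have "\<dots> \<le> e\<^sup>2"
      proof -
        have "4 / e\<^sup>2 \<le> real (Suc N)" using N by simp
        then have "4 \<le> real (Suc N) * e\<^sup>2" using e by (simp only: pos_divide_le_eq zero_less_power)
        then have "4 / real (Suc N) \<le> e\<^sup>2" by (simp add: pos_divide_le_eq mult.commute)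
        then show ?thesis by simp
      qed
      finally show "(form_dist ip (s i) (s j))\<^sup>2 < e\<^sup>2" .
    qed (use e in simp)
    then show "\<exists>N. \<forall>i\<ge>N. \<forall>j\<ge>N. form_dist ip (s i) (s j) < e" by blast
  qed
  obtain p where p: "p \<in> H" and lim: "(\<lambda>i. form_dist ip (s i) p) \<longlonglongrightarrow> 0"
    using hs cauchy sH unfolding hilbert_space_def by blast
  define w where "w = (\<lambda>x. f x - p x)"
  have w: "w \<in> H"
    unfolding w_def by (rule diff_mem[OF f p])
  have orth: "ip w g = 0" if g: "g \<in> M" for g
  proof -
    \<comment> \<open>perturbing \<open>s n\<close> along \<open>g\<close> cannot beat the infimum, so the residual is nearly orthogonal\<close>
    have near: "\<bar>ip (\<lambda>x. f x - s n x) g\<bar> \<le> sqrt (1 / real (Suc n)) * sqrt (ip g g + 1)" for n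
    proof -
      define a where "a = ip (\<lambda>x. f x - s n x) g"
      define G where "G = ip g g + 1"
      have G: "G > 0" using ip_nonneg[OF MH[OF g]] by (simp add: G_def)
      have "d \<le> q (\<lambda>x. s n x + (a / G) * g x)"
        by (rule d_le[OF Ma[OF s Ms[OF g]]])
      also have "\<dots> = ip (\<lambda>x. (f x - s n x) - (a / G) * g x) (\<lambda>x. (f x - s n x) - (a / G) * g x)"
        unfolding q_def by (simp add: algebra_simps)
      also have "\<dots> = q (s n) - 2 * (a / G) * a + (a / G)\<^sup>2 * ip g g"
        unfolding a_def q_def by (rule ip_diff_scale_self[OF diff_mem[OF f sH] MH[OF g]])
      also have "\<dots> \<le> q (s n) - 2 * (a / G) * a + (a / G)\<^sup>2 * G"
        by (simp add: G_def distrib_left)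
      also have "\<dots> = q (s n) - a\<^sup>2 / G"
        using G by (simp add: power2_eq_square field_simps)
      finally have "a\<^sup>2 / G \<le> 1 / real (Suc n)"
        using qs[of n] by simp
      then have "a\<^sup>2 \<le> 1 / real (Suc n) * G"
        using G by (simp only: pos_divide_le_eq)
      then have "sqrt (a\<^sup>2) \<le> sqrt (1 / real (Suc n) * G)"
        by (rule real_sqrt_le_mono)
      then show ?thesis
        by (simp only: real_sqrt_mult real_sqrt_abs a_def G_def)
    qed
    have bound: "\<bar>ip w g\<bar> \<le> sqrt (1 / real (Suc n)) * sqrt (ip g g + 1) +
        form_dist ip (s n) p * form_norm ip g" for n
    proof -
      have "ip w g = ip (\<lambda>x. f x - s n x) g + ip (\<lambda>x. s n x - p x) g"
        using f p sH[of n] MH[OF g] by (simp add: w_def ip_diff_left)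
      then show ?thesis
        using near[of n] Cauchy_Schwarz[OF diff_mem[OF sH[of n] p] MH[OF g]]
        by (simp add: form_dist_def)
    qed
    have "(\<lambda>n. sqrt (1 / real (Suc n)) * sqrt (ip g g + 1) +
        form_dist ip (s n) p * form_norm ip g) \<longlonglongrightarrow> sqrt 0 * sqrt (ip g g + 1) + 0 * form_norm ip g"
      by (intro tendsto_intros lim) (use LIMSEQ_inverse_real_of_nat in \<open>simp add: inverse_eq_divide\<close>)
    then have "\<bar>ip w g\<bar> \<le> sqrt 0 * sqrt (ip g g + 1) + 0 * form_norm ip g"
      using bound by (intro LIMSEQ_le_const) auto
    then show ?thesis by simp
  qed
  have "\<epsilon> \<le> form_norm ip w"
  proof -
    have "\<epsilon> - form_dist ip (s n) p \<le> form_norm ip w" for n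
      using far(2)[OF s[of n]] form_dist_triangle[OF f p sH[of n]] form_dist_commute[OF p sH[of n]]
      by (simp add: form_dist_def w_def)
    moreover have "(\<lambda>n. \<epsilon> - form_dist ip (s n) p) \<longlonglongrightarrow> \<epsilon> - 0"
      by (intro tendsto_intros lim)
    ultimately show ?thesis
      using LIMSEQ_le_const2[of _ \<epsilon> "form_norm ip w"] by auto
  qed
  then have wpos: "ip w w > 0"
    using far(1) by (simp add: form_norm_def)
       (metis less_le_trans real_sqrt_gt_0_iff)
  define u where "u = (\<lambda>x. inverse (sqrt (ip w w)) * w x)"
  have "u \<in> H" unfolding u_def by (rule scale_mem[OF w])
  moreover have "ip u u = inverse (sqrt (ip w w)) * (inverse (sqrt (ip w w)) * ip w w)"
    unfolding u_def by (simp only: ip_scale_left ip_scale_right w scale_mem)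
  then have "ip u u = 1"
    using wpos by (simp flip: real_sqrt_inverse mult.assoc power2_eq_square add: field_simps)
  moreover have "\<forall>g\<in>M. ip u g = 0"
    unfolding u_def using w MH orth by (simp add: ip_scale_left)
  ultimately show ?thesis by blast
qed

lemma function_subspace_lin_span: "function_subspace (lin_span E)"
proof -
  have 0: "(\<lambda>x. 0) \<in> lin_span E"
    unfolding lin_span_def by (intro CollectI exI[of _ "{}"]) auto
  have a: "(\<lambda>x. f x + g x) \<in> lin_span E" if "f \<in> lin_span E" "g \<in> lin_span E" for f g
  proof -
    obtain A c where A: "finite A" "A \<subseteq> E" "f = (\<lambda>x. \<Sum>e\<in>A. c e * e x)"
      using \<open>f \<in> _\<close> unfolding lin_span_def by auto
    obtain B d where B: "finite B" "B \<subseteq> E" "g = (\<lambda>x. \<Sum>e\<in>B. d e * e x)"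
      using \<open>g \<in> _\<close> unfolding lin_span_def by auto
    define k where "k e = (if e \<in> A then c e else 0) + (if e \<in> B then d e else 0)" for e
    have "(\<lambda>x. f x + g x) = (\<lambda>x. \<Sum>e\<in>A \<union> B. k e * e x)"
    proof
      fix x
      have "(\<Sum>e\<in>A \<union> B. k e * e x) =
          (\<Sum>e\<in>A \<union> B. (if e \<in> A then c e * e x else 0)) + (\<Sum>e\<in>A \<union> B. (if e \<in> B then d e * e x else 0))"
        unfolding sum.distrib[symmetric] by (rule sum.cong) (auto simp: k_def distrib_right)
      also have "\<dots> = f x + g x"
        using A B by (simp add: sum.If_cases Int_absorb1)
      finally show "f x + g x = (\<Sum>e\<in>A \<union> B. k e * e x)" by simp
    qed
    then show ?thesis
      unfolding lin_span_def using A B by (intro CollectI exI[of _ "A \<union> B"] exI[of _ k]) auto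
  qed
  have s: "(\<lambda>x. t * f x) \<in> lin_span E" if f: "f \<in> lin_span E" for f t
  proof -
    obtain A c where A: "finite A" "A \<subseteq> E" "f = (\<lambda>x. \<Sum>e\<in>A. c e * e x)"
      using f unfolding lin_span_def by auto
    then show ?thesis
      unfolding lin_span_def
      by (intro CollectI exI[of _ A] exI[of _ "\<lambda>e. t * c e"]) (auto simp: sum_distrib_left mult.assoc)
  qed
  show ?thesis
    unfolding function_subspace_def using 0 a s by blast
qed

lemma lin_span_base: "E \<subseteq> lin_span E"
proof
  fix e assume "e \<in> E"
  then show "e \<in> lin_span E"
    unfolding lin_span_def by (intro CollectI exI[of _ "{e}"] exI[of _ "\<lambda>_. 1"]) auto
qed

text \<open>A maximal orthonormal set is a basis: a point at positive distance from its span would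
  give a further unit vector orthogonal to it.\<close>

lemma exists_orthonormal_basis:
  assumes hs: "hilbert_space H ip"
  shows "\<exists>E. orthonormal_basis H ip E"
proof -
  interpret semi_inner_space H ip
    using hs by unfold_locales (auto simp: hilbert_space_def)
  define ON where "ON = {E. E \<subseteq> H \<and> (\<forall>e\<in>E. \<forall>e'\<in>E. ip e e' = (if e = e' then 1 else 0))}"
  have "\<exists>E\<in>ON. \<forall>X\<in>ON. E \<subseteq> X \<longrightarrow> X = E"
  proof (rule Zorn_Lemma, rule ballI)
    fix \<C> assume "\<C> \<in> chains ON"
    then have sub: "\<C> \<subseteq> ON" and ch: "\<And>X Y. X \<in> \<C> \<Longrightarrow> Y \<in> \<C> \<Longrightarrow> X \<subseteq> Y \<or> Y \<subseteq> X"
      by (auto simp: chains_def chain_subset_def)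
    have "ip e e' = (if e = e' then 1 else 0)" if ee: "e \<in> \<Union>\<C>" "e' \<in> \<Union>\<C>" for e e'
    proof -
      obtain X Y where "X \<in> \<C>" "e \<in> X" "Y \<in> \<C>" "e' \<in> Y"
        using ee by blast
      then obtain X where "X \<in> \<C>" "e \<in> X" "e' \<in> X"
        using ch[of X Y] by blast
      then show ?thesis using sub unfolding ON_def by blast
    qed
    moreover have "\<Union>\<C> \<subseteq> H" using sub unfolding ON_def by blast
    ultimately show "\<Union>\<C> \<in> ON" unfolding ON_def by blast
  qed
  then obtain E where E: "E \<in> ON" and maxi: "\<And>X. X \<in> ON \<Longrightarrow> E \<subseteq> X \<Longrightarrow> X = E"
    by blast
  have EH: "E \<subseteq> H" and on: "\<And>e e'. e \<in> E \<Longrightarrow> e' \<in> E \<Longrightarrow> ip e e' = (if e = e' then 1 else 0)"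
    using E unfolding ON_def by auto
  have span: "lin_span E \<subseteq> H"
    unfolding lin_span_def using EH by (auto intro!: sum_mem scale_mem)
  have "\<exists>g\<in>lin_span E. form_dist ip f g < \<epsilon>" if f: "f \<in> H" and \<epsilon>: "\<epsilon> > 0" for f \<epsilon>
  proof (rule ccontr)
    assume "\<not> (\<exists>g\<in>lin_span E. form_dist ip f g < \<epsilon>)"
    then obtain u where u: "u \<in> H" "ip u u = 1" "\<And>g. g \<in> lin_span E \<Longrightarrow> ip u g = 0"
      using exists_unit_orthogonal[OF hs function_subspace_lin_span span f \<epsilon>] by force
    have u0: "ip u e = 0" "ip e u = 0" if "e \<in> E" for e
      using u(3)[OF subsetD[OF lin_span_base that]] ip_commute[of u e] u(1) EH that by auto
    have "u \<notin> E" using u(2) u0(1)[of u] by auto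
    moreover have "insert u E \<in> ON"
      unfolding ON_def using EH u(1,2) u0 on \<open>u \<notin> E\<close> by auto
    ultimately show False using maxi[of "insert u E"] by auto
  qed
  then have "orthonormal_basis H ip E"
    unfolding orthonormal_basis_def dense_in_def using EH on span by auto
  then show ?thesis ..
qed

text \<open>Bessel's inequality for a family of evaluations: applying the bound on \<open>r\<close> to
  \<open>\<Sum>e\<in>A. r e * e\<close> gives \<open>S \<le> C * sqrt S\<close> for the sum \<open>S\<close> of the squares.\<close>

lemma (in semi_inner_space) sum_functional_sq_le:
  assumes A: "finite A" "A \<subseteq> H" "\<And>e e'. e \<in> A \<Longrightarrow> e' \<in> A \<Longrightarrow> ip e e' = (if e = e' then 1 else 0)"
    and add: "\<And>f g. f \<in> H \<Longrightarrow> g \<in> H \<Longrightarrow> r (\<lambda>x. f x + g x) = r f + r g"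
    and scale: "\<And>c f. f \<in> H \<Longrightarrow> r (\<lambda>x. c * f x) = c * r f"
    and bound: "\<And>f. f \<in> H \<Longrightarrow> \<bar>r f\<bar> \<le> C * form_norm ip f"
  shows "(\<Sum>e\<in>A. (r e)\<^sup>2) \<le> C\<^sup>2"
proof -
  define S where "S = (\<Sum>e\<in>A. (r e)\<^sup>2)"
  have r0: "r (\<lambda>x. 0) = 0"
    using scale[OF zero_mem, of 0] by simp
  have r_sum: "r (\<lambda>x. \<Sum>e\<in>B. c e * e x) = (\<Sum>e\<in>B. c e * r e)" if "finite B" "B \<subseteq> H" for B c
    using that
  proof (induction B rule: finite_induct)
    case (insert b B)
    have "r (\<lambda>x. \<Sum>e\<in>insert b B. c e * e x) = r (\<lambda>x. c b * b x + (\<Sum>e\<in>B. c e * e x))"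
      using insert.hyps by simp
    also have "\<dots> = c b * r b + r (\<lambda>x. \<Sum>e\<in>B. c e * e x)"
      using insert.prems add[of "\<lambda>x. c b * b x" "\<lambda>x. \<Sum>e\<in>B. c e * e x"] scale[of b "c b"]
        scale_mem[of b "c b"] sum_mem[of B "\<lambda>e x. c e * e x"] scale_mem
      by (simp add: subset_iff)
    finally show ?case using insert by simp
  qed (simp add: r0)
  let ?f = "\<lambda>x. \<Sum>e\<in>A. r e * e x"
  have mem: "(\<lambda>x. r e * e x) \<in> H" if "e \<in> A" for e
    using that A(2) by (auto intro: scale_mem)
  have fH: "?f \<in> H" by (intro sum_mem mem)
  have inner: "ip e ?f = r e" if e: "e \<in> A" for e
  proof -
    have "ip e ?f = ip ?f e" using e A(2) fH by (intro ip_commute) auto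
    also have "\<dots> = (\<Sum>e'\<in>A. ip (\<lambda>x. r e' * e' x) e)"
      using e A(2) mem by (intro ip_sum_left) auto
    also have "\<dots> = (\<Sum>e'\<in>A. r e' * ip e' e)"
      by (rule sum.cong) (use e A(2) in \<open>auto simp: ip_scale_left subset_iff\<close>)
    also have "\<dots> = (\<Sum>e'\<in>A. if e' = e then r e' else 0)"
      by (rule sum.cong) (use e A(3) in auto)
    finally show ?thesis using e A(1) by simp
  qed
  have "ip ?f ?f = (\<Sum>e\<in>A. ip (\<lambda>x. r e * e x) ?f)"
    using mem fH by (intro ip_sum_left) auto
  also have "\<dots> = (\<Sum>e\<in>A. r e * ip e ?f)"
    by (rule sum.cong) (use A(2) fH in \<open>auto simp: ip_scale_left subset_iff\<close>)
  also have "\<dots> = S"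
    unfolding S_def by (rule sum.cong) (auto simp: inner power2_eq_square)
  finally have nf: "form_norm ip ?f = sqrt S"
    by (simp add: form_norm_def)
  have S0: "S \<ge> 0" by (simp add: S_def sum_nonneg)
  have "r ?f = S"
    using r_sum[OF A(1,2), of r] by (simp add: S_def power2_eq_square)
  then have "S \<le> C * sqrt S"
    using bound[OF fH] nf S0 by simp
  then have "S\<^sup>2 \<le> C\<^sup>2 * S"
    using power_mono[of S "C * sqrt S" 2] S0 by (simp add: power_mult_distrib)
  then show ?thesis
    using S0 unfolding S_def[symmetric] by (cases "S = 0") (auto simp: power2_eq_square)
qed

text \<open>This sums the errors of the successive approximations in the Mittag-Leffler argument below.\<close>

lemma hilbert_space_geometric_limit:
  assumes hs: "hilbert_space H ip" and b: "\<And>n. b n \<in> H"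
    and gap: "\<And>n. form_dist ip (b n) (b (Suc n)) \<le> c * (1/2) ^ n"
  obtains g where "g \<in> H" "(\<lambda>n. form_dist ip (b n) g) \<longlonglongrightarrow> 0" "form_dist ip (b 0) g \<le> 2 * c"
proof -
  interpret semi_inner_space H ip
    using hs by unfold_locales (auto simp: hilbert_space_def)
  have c: "c \<ge> 0"
    using gap[of 0] form_dist_nonneg[OF b b, of 0 "Suc 0"] by simp
  have step: "form_dist ip (b i) (b (i + m)) \<le> 2 * c * (1/2) ^ i * (1 - (1/2) ^ m)" for i m
  proof (induction m)
    case 0
    show ?case by (simp add: form_dist_def form_norm_def ip_zero_left[OF zero_mem])
  next
    case (Suc m)
    have "form_dist ip (b i) (b (i + Suc m)) \<le>
        form_dist ip (b i) (b (i + m)) + form_dist ip (b (i + m)) (b (Suc (i + m)))"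
      using form_dist_triangle[OF b b b] by simp
    also have "\<dots> \<le> 2 * c * (1/2) ^ i * (1 - (1/2) ^ m) + c * (1/2) ^ (i + m)"
      by (intro add_mono Suc.IH gap)
    also have "\<dots> = 2 * c * (1/2) ^ i * (1 - (1/2) ^ Suc m)"
      by (simp add: power_add algebra_simps)
    finally show ?case .
  qed
  have tail: "form_dist ip (b i) (b j) \<le> 2 * c * (1/2) ^ i" if "i \<le> j" for i j
  proof -
    have "2 * c * (1/2) ^ i * (1 - (1/2) ^ (j - i)) \<le> 2 * c * (1/2) ^ i * 1"
      using c by (intro mult_left_mono) auto
    then show ?thesis using step[of i "j - i"] that by simp
  qed
  have "\<forall>e>0. \<exists>N. \<forall>i\<ge>N. \<forall>j\<ge>N. form_dist ip (b i) (b j) < e"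
  proof (intro allI impI)
    fix e :: real assume e: "e > 0"
    obtain N where N: "(1/2 :: real) ^ N < e / (2 * c + 1)"
      using real_arch_pow_inv[of "e / (2 * c + 1)" "1/2"] e c by auto
    have small: "2 * c * (1/2) ^ N < e"
    proof -
      have "2 * c * (1/2) ^ N \<le> (2 * c + 1) * (1/2) ^ N" by (simp add: distrib_right)
      also have "\<dots> < e" using N c by (simp add: pos_less_divide_eq mult.commute)
      finally show ?thesis .
    qed
    have "form_dist ip (b i) (b j) < e" if "i \<ge> N" "j \<ge> N" for i j
    proof -
      have *: "form_dist ip (b i) (b j) < e" if "N \<le> i" "i \<le> j" for i j
      proof -
        have "2 * c * (1/2) ^ i \<le> 2 * c * (1/2) ^ N"
          using c that by (intro mult_left_mono power_decreasing) auto
        then show ?thesis using tail[OF that(2)] small by simp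
      qed
      show ?thesis
        using *[of i j] *[of j i] that form_dist_commute[OF b[of i] b[of j]]
        by (cases "i \<le> j") simp_all
    qed
    then show "\<exists>N. \<forall>i\<ge>N. \<forall>j\<ge>N. form_dist ip (b i) (b j) < e" by blast
  qed
  then obtain g where g: "g \<in> H" and lim: "(\<lambda>n. form_dist ip (b n) g) \<longlonglongrightarrow> 0"
    using hs b unfolding hilbert_space_def by blast
  have "form_dist ip (b 0) g \<le> 2 * c + form_dist ip (b n) g" for n
    using form_dist_triangle[OF b b g, of 0 n] tail[of 0 n] by simp
  moreover have "(\<lambda>n. 2 * c + form_dist ip (b n) g) \<longlonglongrightarrow> 2 * c + 0"
    by (intro tendsto_add tendsto_const lim)
  ultimately have "form_dist ip (b 0) g \<le> 2 * c + 0"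
    by (intro LIMSEQ_le_const) auto
  then show ?thesis using that[OF g lim] by simp
qed

section \<open>Square-integrable functions on the circle\<close>

abbreviation l2 :: "real measure \<Rightarrow> real form" where
  "l2 \<mu> \<equiv> \<lambda>f g. \<integral>x. f x * g x \<partial>\<mu>"

text \<open>The elements of \<open>L2 \<mu>\<close> are periodic and measurable on the whole line, while only their
  restrictions to the fundamental domain \<open>[0, 1)\<close> enter the integrals.\<close>

locale circle_measure = finite_measure \<mu> for \<mu> :: "real measure" +
  assumes sets_circle: "sets \<mu> = sets (restrict_space borel {0..<1})"
begin

lemma space_circle: "space \<mu> = {0..<1}"
  using sets_eq_imp_space_eq[OF sets_circle] by (simp add: space_restrict_space)

lemma measurable_circle:
  "f \<in> borel_measurable borel \<Longrightarrow> f \<in> borel_measurable \<mu>"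
  by (subst measurable_cong_sets[OF sets_circle refl]) (rule measurable_restrict_space1)

lemma L2D:
  assumes "f \<in> L2 \<mu>"
  shows "f \<in> borel_measurable borel" "periodic f" "integrable \<mu> (\<lambda>x. (f x)\<^sup>2)"
  using assms by (auto simp: L2_def)

lemma L2_integrable_mult:
  assumes f: "f \<in> L2 \<mu>" and g: "g \<in> L2 \<mu>"
  shows "integrable \<mu> (\<lambda>x. f x * g x)"
proof (rule Bochner_Integration.integrable_bound)
  show "integrable \<mu> (\<lambda>x. (f x)\<^sup>2 + (g x)\<^sup>2)"
    by (rule Bochner_Integration.integrable_add[OF L2D(3)[OF f] L2D(3)[OF g]])
  show "(\<lambda>x. f x * g x) \<in> borel_measurable \<mu>"
    by (rule borel_measurable_times[OF measurable_circle[OF L2D(1)[OF f]] measurable_circle[OF L2D(1)[OF g]]])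
  have "\<bar>f x * g x\<bar> \<le> (f x)\<^sup>2 + (g x)\<^sup>2" for x
  proof -
    have "0 \<le> (\<bar>f x\<bar> - \<bar>g x\<bar>)\<^sup>2" by simp
    then have "2 * (\<bar>f x\<bar> * \<bar>g x\<bar>) \<le> (f x)\<^sup>2 + (g x)\<^sup>2" by (simp add: power2_diff)
    moreover have "0 \<le> \<bar>f x\<bar> * \<bar>g x\<bar>" by simp
    ultimately show ?thesis unfolding abs_mult by linarith
  qed
  then show "AE x in \<mu>. norm (f x * g x) \<le> norm ((f x)\<^sup>2 + (g x)\<^sup>2)"
    by simp
qed

lemma L2_bounded:
  assumes "f \<in> borel_measurable borel" "periodic f" "\<And>x. x \<in> {0..<1} \<Longrightarrow> \<bar>f x\<bar> \<le> B"
  shows "f \<in> L2 \<mu>"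
proof -
  have sq: "(f x)\<^sup>2 \<le> B\<^sup>2" if "x \<in> {0..<1}" for x
    using power_mono[OF assms(3)[OF that], of 2] by simp
  have "integrable \<mu> (\<lambda>x. (f x)\<^sup>2)"
  proof (rule integrable_const_bound[where B = "B\<^sup>2"])
    show "AE x in \<mu>. norm ((f x)\<^sup>2) \<le> B\<^sup>2"
      by (rule AE_I2) (use sq space_circle in simp)
    show "(\<lambda>x. (f x)\<^sup>2) \<in> borel_measurable \<mu>"
      using measurable_circle[OF assms(1)] by (rule borel_measurable_power)
  qed
  then show ?thesis using assms by (simp add: L2_def)
qed

lemma L2_const: "(\<lambda>x. c) \<in> L2 \<mu>"
  by (rule L2_bounded[where B = "\<bar>c\<bar>"]) (auto simp: periodic_def)

lemma L2_integrable: "f \<in> L2 \<mu> \<Longrightarrow> integrable \<mu> f"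
  using L2_integrable_mult[OF _ L2_const[of 1]] by simp

lemma function_subspace_L2: "function_subspace (L2 \<mu>)"
proof -
  have "(\<lambda>x. f x + g x) \<in> L2 \<mu>" if f: "f \<in> L2 \<mu>" and g: "g \<in> L2 \<mu>" for f g
  proof -
    have "integrable \<mu> (\<lambda>x. (f x)\<^sup>2 + 2 * (f x * g x) + (g x)\<^sup>2)"
      using L2_integrable_mult[OF f g] L2D(3)[OF f] L2D(3)[OF g] by auto
    then have "integrable \<mu> (\<lambda>x. (f x + g x)\<^sup>2)"
      by (simp add: power2_sum algebra_simps)
    then show ?thesis
      using L2D(1,2)[OF f] L2D(1,2)[OF g] by (simp add: L2_def periodic_def)
  qed
  moreover have "(\<lambda>x. c * f x) \<in> L2 \<mu>" if "f \<in> L2 \<mu>" for c f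
    using L2D[OF that] by (simp add: L2_def periodic_def power_mult_distrib)
  ultimately show ?thesis
    using L2_const[of 0] by (simp add: function_subspace_def)
qed

lemma semi_inner_product_L2: "semi_inner_product (L2 \<mu>) (l2 \<mu>)"
proof -
  have "l2 \<mu> f g = l2 \<mu> g f" for f g
    by (simp add: mult.commute)
  moreover have "l2 \<mu> (\<lambda>x. f x + g x) h = l2 \<mu> f h + l2 \<mu> g h"
    if "f \<in> L2 \<mu>" "g \<in> L2 \<mu>" "h \<in> L2 \<mu>" for f g h
    unfolding distrib_right
    by (intro Bochner_Integration.integral_add L2_integrable_mult that)
  moreover have "l2 \<mu> (\<lambda>x. c * f x) g = c * l2 \<mu> f g" for c f g
    unfolding mult.assoc by (rule integral_mult_right_zero)
  moreover have "0 \<le> l2 \<mu> f f" for f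
    by (rule Bochner_Integration.integral_nonneg) simp
  ultimately show ?thesis
    unfolding semi_inner_product_def by blast
qed

sublocale L2: semi_inner_space "L2 \<mu>" "l2 \<mu>"
  by unfold_locales (fact function_subspace_L2, fact semi_inner_product_L2)

lemma form_norm_l2: "form_norm (l2 \<mu>) f = sqrt (\<integral>x. (f x)\<^sup>2 \<partial>\<mu>)"
  by (simp add: form_norm_def power2_eq_square)

lemma l2_cong_AE:
  assumes "f \<in> L2 \<mu>" "f' \<in> L2 \<mu>" "g \<in> L2 \<mu>" "g' \<in> L2 \<mu>"
    and "AE x in \<mu>. f x = f' x" "AE x in \<mu>. g x = g' x"
  shows "l2 \<mu> f g = l2 \<mu> f' g'"
proof (rule integral_cong_AE)
  show "AE x in \<mu>. f x * g x = f' x * g' x"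
    using assms(5,6) by eventually_elim simp
  show "(\<lambda>x. f x * g x) \<in> borel_measurable \<mu>" "(\<lambda>x. f' x * g' x) \<in> borel_measurable \<mu>"
    by (rule borel_measurable_integrable[OF L2_integrable_mult[OF assms(1,3)]],
        rule borel_measurable_integrable[OF L2_integrable_mult[OF assms(2,4)]])
qed

lemma integral_cong_AE_L2:
  assumes "f \<in> L2 \<mu>" "g \<in> L2 \<mu>" "AE x in \<mu>. f x = g x"
  shows "(\<integral>x. f x \<partial>\<mu>) = (\<integral>x. g x \<partial>\<mu>)"
  using l2_cong_AE[OF assms(1,2) L2_const[of 1] L2_const[of 1] assms(3)] by simp

lemma form_norm_cong_AE:
  assumes "f \<in> L2 \<mu>" "g \<in> L2 \<mu>" "AE x in \<mu>. f x = g x"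
  shows "form_norm (l2 \<mu>) f = form_norm (l2 \<mu>) g"
  unfolding form_norm_def by (simp add: l2_cong_AE[OF assms(1,2,1,2,3,3)])

lemma form_norm_eq_0_iff:
  assumes "f \<in> L2 \<mu>"
  shows "form_norm (l2 \<mu>) f = 0 \<longleftrightarrow> (AE x in \<mu>. f x = 0)"
  using integral_nonneg_eq_0_iff_AE[OF L2D(3)[OF assms]] by (simp add: form_norm_l2)

lemma integral_abs_le_norm:
  assumes f: "f \<in> L2 \<mu>"
  shows "(\<integral>x. \<bar>f x\<bar> \<partial>\<mu>) \<le> sqrt (measure \<mu> (space \<mu>)) * form_norm (l2 \<mu>) f"
proof -
  have "(\<lambda>x. \<bar>f x\<bar>) \<in> L2 \<mu>"
    using L2D[OF f] by (simp add: L2_def periodic_def)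
  from L2.Cauchy_Schwarz[OF this L2_const[of 1]]
  show ?thesis by (simp add: form_norm_l2 mult.commute)
qed

lemma abs_integral_le_norm:
  "f \<in> L2 \<mu> \<Longrightarrow> \<bar>\<integral>x. f x \<partial>\<mu>\<bar> \<le> sqrt (measure \<mu> (space \<mu>)) * form_norm (l2 \<mu>) f"
  by (rule order_trans[OF integral_abs_bound integral_abs_le_norm])

lemma form_norm_le_bound:
  assumes "f \<in> borel_measurable borel" "\<And>x. \<bar>f x\<bar> \<le> B"
  shows "form_norm (l2 \<mu>) f \<le> sqrt (measure \<mu> (space \<mu>)) * B"
proof -
  have B: "B \<ge> 0" using assms(2)[of 0] by linarith
  have sq: "(f x)\<^sup>2 \<le> B\<^sup>2" for x
    using power_mono[OF assms(2)[of x], of 2] by simp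
  have "integrable \<mu> (\<lambda>x. (f x)\<^sup>2)"
    by (rule integrable_const_bound[where B = "B\<^sup>2"])
       (use measurable_circle[OF assms(1)] sq in \<open>auto intro!: borel_measurable_power\<close>)
  then have "(\<integral>x. (f x)\<^sup>2 \<partial>\<mu>) \<le> (\<integral>x. B\<^sup>2 \<partial>\<mu>)"
    by (intro integral_mono) (use sq in auto)
  then have "sqrt (\<integral>x. (f x)\<^sup>2 \<partial>\<mu>) \<le> sqrt (measure \<mu> (space \<mu>) * B\<^sup>2)"
    by simp
  then show ?thesis using B by (simp add: form_norm_l2 real_sqrt_mult)
qed

text \<open>Riesz--Fischer: a subsequence with geometrically decreasing gaps converges almost
  everywhere, since the gaps are summable in \<open>L\<^sup>1\<close>, and Fatou's lemma identifies the pointwise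
  limit as the limit in norm.\<close>

lemma hilbert_space_L2: "hilbert_space (L2 \<mu>) (l2 \<mu>)"
proof -
  let ?d = "form_dist (l2 \<mu>)"
  have "\<exists>f\<in>L2 \<mu>. (\<lambda>i. ?d (s i) f) \<longlonglongrightarrow> 0"
    if s: "range s \<subseteq> L2 \<mu>" and cau: "\<forall>\<epsilon>>0. \<exists>N. \<forall>i\<ge>N. \<forall>j\<ge>N. ?d (s i) (s j) < \<epsilon>" for s
  proof -
    have "\<forall>k. \<exists>N. \<forall>i\<ge>N. \<forall>j\<ge>N. ?d (s i) (s j) < (1/2) ^ k"
      using cau by simp
    then obtain N where N: "\<And>k i j. N k \<le> i \<Longrightarrow> N k \<le> j \<Longrightarrow> ?d (s i) (s j) < (1/2) ^ k"
      by metis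
    define r where "r k = (\<Sum>i\<le>k. N i)" for k
    have r_ge: "N k \<le> r j" if "k \<le> j" for k j
      unfolding r_def using that by (intro member_le_sum) auto
    define t where "t k = s (r k)" for k
    have tL: "t k \<in> L2 \<mu>" and sL: "s k \<in> L2 \<mu>" for k
      using s by (auto simp: t_def)
    have t_meas: "t k \<in> borel_measurable \<mu>" for k
      using measurable_circle[OF L2D(1)[OF tL]] .
    have gap: "?d (t j) (t k) < (1/2) ^ k" if "k \<le> j" for j k
      unfolding t_def using that r_ge by (intro N) auto
    define u where "u k = (\<lambda>x. t (Suc k) x - t k x)" for k
    have uL: "u k \<in> L2 \<mu>" for k
      unfolding u_def by (rule L2.diff_mem[OF tL tL])
    have u_meas [measurable]: "u k \<in> borel_measurable \<mu>" for k
      using measurable_circle[OF L2D(1)[OF uL]] .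
    let ?m = "sqrt (measure \<mu> (space \<mu>))"
    have "(\<integral>\<^sup>+x. (\<Sum>k. ennreal \<bar>u k x\<bar>) \<partial>\<mu>) = (\<Sum>k. \<integral>\<^sup>+x. ennreal \<bar>u k x\<bar> \<partial>\<mu>)"
      by (rule nn_integral_suminf) measurable
    also have "\<dots> \<le> (\<Sum>k. ennreal (?m * (1/2) ^ k))"
    proof (rule suminf_le)
      fix k
      have "(\<integral>\<^sup>+x. ennreal \<bar>u k x\<bar> \<partial>\<mu>) = ennreal (\<integral>x. \<bar>u k x\<bar> \<partial>\<mu>)"
        using L2_integrable[OF uL] by (intro nn_integral_eq_integral) auto
      also have "\<dots> \<le> ennreal (?m * (1/2) ^ k)"
      proof (rule ennreal_leI)
        have "form_norm (l2 \<mu>) (u k) \<le> (1/2) ^ k"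
          using gap[of k "Suc k"] by (simp add: u_def form_dist_def)
        then have "?m * form_norm (l2 \<mu>) (u k) \<le> ?m * (1/2) ^ k"
          by (rule mult_left_mono) simp
        then show "(\<integral>x. \<bar>u k x\<bar> \<partial>\<mu>) \<le> ?m * (1/2) ^ k"
          using integral_abs_le_norm[OF uL, of k] by simp
      qed
      finally show "(\<integral>\<^sup>+x. ennreal \<bar>u k x\<bar> \<partial>\<mu>) \<le> ennreal (?m * (1/2) ^ k)" .
    qed auto
    also have "\<dots> = ennreal (\<Sum>k. ?m * (1/2) ^ k)"
      by (rule suminf_ennreal2) (auto intro: summable_mult summable_geometric)
    also have "\<dots> < \<infinity>" by simp
    finally have "AE x in \<mu>. (\<Sum>k. ennreal \<bar>u k x\<bar>) \<noteq> \<infinity>"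
      by (intro nn_integral_noteq_infinite) auto
    then have conv: "AE x in \<mu>. (\<lambda>k. t k x) \<longlonglongrightarrow> lim (\<lambda>k. t k x)"
    proof eventually_elim
      fix x assume "(\<Sum>k. ennreal \<bar>u k x\<bar>) \<noteq> \<infinity>"
      then have "summable (\<lambda>k. \<bar>u k x\<bar>)"
        by (intro summable_suminf_not_top) auto
      then have "summable (\<lambda>k. t (Suc k) x - t k x)"
        by (simp add: summable_rabs_cancel u_def)
      then have "convergent (\<lambda>n. \<Sum>k<n. t (Suc k) x - t k x)"
        by (simp add: summable_iff_convergent)
      then have "convergent (\<lambda>n. t n x - t 0 x)"
        by (simp only: sum_lessThan_telescope[of "\<lambda>k. t k x"])
      then have "convergent (\<lambda>n. (t n x - t 0 x) + t 0 x)"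
        by (intro convergent_add convergent_const)
      then show "(\<lambda>k. t k x) \<longlonglongrightarrow> lim (\<lambda>k. t k x)"
        by (simp add: convergent_LIMSEQ_iff)
    qed
    define f where "f = (\<lambda>x. lim (\<lambda>k. t k x))"
    have f_borel: "f \<in> borel_measurable borel"
      unfolding f_def by (rule borel_measurable_lim_metric) (rule L2D(1)[OF tL])
    have f_per: "periodic f"
      using L2D(2)[OF tL] by (simp add: f_def periodic_def)
    have fatou: "(\<lambda>x. f x - t k x) \<in> L2 \<mu> \<and> ?d f (t k) \<le> (1/2) ^ k" for k
    proof -
      have "(\<integral>\<^sup>+x. ennreal ((f x - t k x)\<^sup>2) \<partial>\<mu>) = (\<integral>\<^sup>+x. liminf (\<lambda>j. ennreal ((t j x - t k x)\<^sup>2)) \<partial>\<mu>)"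
      proof (rule nn_integral_cong_AE, use conv in eventually_elim)
        fix x assume "(\<lambda>k. t k x) \<longlonglongrightarrow> lim (\<lambda>k. t k x)"
        then have "(\<lambda>j. ennreal ((t j x - t k x)\<^sup>2)) \<longlonglongrightarrow> ennreal ((f x - t k x)\<^sup>2)"
          unfolding f_def by (intro tendsto_intros)
        then show "ennreal ((f x - t k x)\<^sup>2) = liminf (\<lambda>j. ennreal ((t j x - t k x)\<^sup>2))"
          by (intro lim_imp_Liminf[symmetric]) auto
      qed
      also have "\<dots> \<le> liminf (\<lambda>j. \<integral>\<^sup>+x. ennreal ((t j x - t k x)\<^sup>2) \<partial>\<mu>)"
        by (rule nn_integral_liminf) (use t_meas in measurable)
      also have "\<dots> \<le> liminf (\<lambda>j. ennreal (((1/2) ^ k)\<^sup>2))"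
      proof (rule Liminf_mono, rule eventually_sequentiallyI)
        fix j assume "k \<le> j"
        have L: "(\<lambda>x. t j x - t k x) \<in> L2 \<mu>" by (rule L2.diff_mem[OF tL tL])
        have "(\<integral>\<^sup>+x. ennreal ((t j x - t k x)\<^sup>2) \<partial>\<mu>) = ennreal (\<integral>x. (t j x - t k x)\<^sup>2 \<partial>\<mu>)"
          using L2D(3)[OF L] by (intro nn_integral_eq_integral) auto
        also have "(\<integral>x. (t j x - t k x)\<^sup>2 \<partial>\<mu>) = (?d (t j) (t k))\<^sup>2"
          by (simp add: form_dist_def form_norm_l2)
        also have "ennreal \<dots> \<le> ennreal (((1/2) ^ k)\<^sup>2)"
          using gap[OF \<open>k \<le> j\<close>] L2.form_dist_nonneg[OF tL tL]
          by (intro ennreal_leI power_mono) (auto intro: less_imp_le)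
        finally show "(\<integral>\<^sup>+x. ennreal ((t j x - t k x)\<^sup>2) \<partial>\<mu>) \<le> ennreal (((1/2) ^ k)\<^sup>2)" .
      qed
      finally have le: "(\<integral>\<^sup>+x. ennreal ((f x - t k x)\<^sup>2) \<partial>\<mu>) \<le> ennreal (((1/2) ^ k)\<^sup>2)"
        by (simp add: Liminf_const)
      have [measurable]: "f \<in> borel_measurable \<mu>" "t k \<in> borel_measurable \<mu>"
        using measurable_circle[OF f_borel] t_meas by auto
      have int: "integrable \<mu> (\<lambda>x. (f x - t k x)\<^sup>2)"
      proof (rule integrableI_bounded)
        show "(\<integral>\<^sup>+x. ennreal (norm ((f x - t k x)\<^sup>2)) \<partial>\<mu>) < \<infinity>"
          using le_less_trans[OF le] by simp
      qed simp
      have "ennreal (\<integral>x. (f x - t k x)\<^sup>2 \<partial>\<mu>) \<le> ennreal (((1/2) ^ k)\<^sup>2)"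
        using le nn_integral_eq_integral[OF int] by simp
      then have "(\<integral>x. (f x - t k x)\<^sup>2 \<partial>\<mu>) \<le> ((1/2) ^ k)\<^sup>2"
        by (subst (asm) ennreal_le_iff) auto
      then have "sqrt (\<integral>x. (f x - t k x)\<^sup>2 \<partial>\<mu>) \<le> sqrt (((1/2) ^ k)\<^sup>2)"
        by (rule real_sqrt_le_mono)
      moreover have "(\<lambda>x. f x - t k x) \<in> L2 \<mu>"
        using int f_borel f_per L2D(1,2)[OF tL[of k]] by (simp add: L2_def periodic_def)
      ultimately show ?thesis
        by (simp add: form_dist_def form_norm_l2)
    qed
    have fL: "f \<in> L2 \<mu>"
      using L2.add_mem[OF conjunct1[OF fatou[of 0]] tL[of 0]] by simp
    have "(\<lambda>i. ?d (s i) f) \<longlonglongrightarrow> 0"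
    proof (rule LIMSEQ_I)
      fix e :: real assume "0 < e"
      then obtain k where k: "(1/2) ^ k < e / 2"
        using real_arch_pow_inv[of "e/2" "1/2"] by auto
      have "norm (?d (s i) f - 0) < e" if "i \<ge> r k" for i
      proof -
        have "?d (s i) (t k) < (1/2) ^ k"
          unfolding t_def using that r_ge[of k k] by (intro N) auto
        moreover have "?d (t k) f \<le> (1/2) ^ k"
          using fatou[of k] L2.form_dist_commute[OF tL fL] by simp
        ultimately show ?thesis
          using L2.form_dist_triangle[OF sL tL fL, of i k] L2.form_dist_nonneg[OF sL fL, of i] k
          by simp
      qed
      then show "\<exists>no. \<forall>i\<ge>no. norm (?d (s i) f - 0) < e" by blast
    qed
    then show ?thesis using fL by blast
  qed
  then show ?thesis
    unfolding hilbert_space_def using function_subspace_L2 semi_inner_product_L2 by blast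
qed

end

section \<open>One-sided continuity and one-sided derivatives\<close>

text \<open>The whole development is symmetric under exchanging \<open>W\<close> with \<open>V\<close> and right with left. A
  Boolean \<open>p\<close> selects one of the two levels: \<open>False\<close> stands for the right-continuous functions,
  which are differentiated from the left with respect to \<open>W\<close> and integrated against \<open>dV\<close>, and
  \<open>True\<close> for the left-continuous ones. Thus \<open>side p\<close> is the side from which functions of level \<open>p\<close>
  are continuous, and their derivative is taken from the opposite side.\<close>

definition side :: "bool \<Rightarrow> real \<Rightarrow> real filter" where
  "side p x = (if p then at_left x else at_right x)"

definition regular :: "bool \<Rightarrow> (real \<Rightarrow> real) \<Rightarrow> bool" where
  "regular p f \<longleftrightarrow> (\<forall>x. (f \<longlongrightarrow> f x) (side p x) \<and> (\<exists>l. (f \<longlongrightarrow> l) (side (\<not> p) x)))"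

definition one_sided_deriv :: "bool \<Rightarrow> (real \<Rightarrow> real) \<Rightarrow> (real \<Rightarrow> real) \<Rightarrow> (real \<Rightarrow> real) \<Rightarrow> bool" where
  "one_sided_deriv p Z f F \<longleftrightarrow>
    (\<forall>x. ((\<lambda>h. (f (x + h) - f x) / (Z (x + h) - Z x)) \<longlongrightarrow> F x) (side (\<not> p) 0))"

lemma cadlag_eq_regular: "cadlag = regular False"
  and caglad_eq_regular: "caglad = regular True"
  unfolding fun_eq_iff cadlag_def caglad_def regular_def side_def continuous_within by simp_all

lemma strong_DW_eq: "strong_DW = one_sided_deriv False"
  and strong_DV_eq: "strong_DV = one_sided_deriv True"
  unfolding fun_eq_iff strong_DW_def strong_DV_def one_sided_deriv_def side_def by simp_all

lemma side_neq_bot [simp]: "side p x \<noteq> bot"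
  by (simp add: side_def)

lemma filterlim_side_uminus: "filterlim f F (side p x) \<longleftrightarrow> filterlim (\<lambda>y. f (- y)) F (side (\<not> p) (- x))"
proof (cases p)
  case True
  then show ?thesis
    using filterlim_at_left_to_right[of f F x] by (simp add: side_def)
next
  case False
  then show ?thesis
    using filterlim_at_left_to_right[of "\<lambda>y. f (- y)" F "- x"] by (simp add: side_def)
qed

lemma side_eq_shift: "side p x = filtermap (\<lambda>h. x + h) (side p 0)"
proof -
  have r: "at_right y = filtermap (\<lambda>h. y + h) (at_right 0)" for y :: real
    using at_right_to_0[of y] by (simp add: add.commute)
  have "at_left x = filtermap (\<lambda>h. x + h) (at_left 0)"
    unfolding at_left_minus[of x] at_left_minus[of 0] r[of "- x"] filtermap_filtermap by simp
  with r[of x] show ?thesis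
    unfolding side_def by (cases p) simp_all
qed

lemma eventually_side_iff:
  "eventually P (side p x) \<longleftrightarrow> (\<exists>d>0. \<forall>y. 0 < (if p then x - y else y - x) \<and> \<bar>y - x\<bar> < d \<longrightarrow> P y)"
proof (cases p)
  case True
  then show ?thesis by (auto simp: side_def eventually_at dist_real_def)
next
  case False
  then show ?thesis by (auto simp: side_def eventually_at dist_real_def)
qed

lemma regular_uminus: "regular p f \<Longrightarrow> regular (\<not> p) (\<lambda>x. f (- x))"
  unfolding regular_def
proof (intro allI)
  fix x assume a: "\<forall>x. (f \<longlongrightarrow> f x) (side p x) \<and> (\<exists>l. (f \<longlongrightarrow> l) (side (\<not> p) x))"
  show "((\<lambda>x. f (- x)) \<longlongrightarrow> f (- x)) (side (\<not> p) x) \<and>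
      (\<exists>l. ((\<lambda>x. f (- x)) \<longlongrightarrow> l) (side (\<not> \<not> p) x))"
    using a[THEN spec, of "- x"] filterlim_side_uminus[of f _ p "- x"]
      filterlim_side_uminus[of f _ "\<not> p" "- x"] by auto
qed

lemma regular_add: "regular p f \<Longrightarrow> regular p g \<Longrightarrow> regular p (\<lambda>x. f x + g x)"
  and regular_scale: "regular p f \<Longrightarrow> regular p (\<lambda>x. c * f x)"
  and regular_const: "regular p (\<lambda>x. c)"
proof -
  show "regular p (\<lambda>x. f x + g x)" if "regular p f" "regular p g"
    unfolding regular_def
  proof (intro allI conjI)
    fix x
    obtain l m where "(f \<longlongrightarrow> l) (side (\<not> p) x)" "(g \<longlongrightarrow> m) (side (\<not> p) x)"
      using \<open>regular p f\<close> \<open>regular p g\<close> unfolding regular_def by blast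
    from tendsto_add[OF this]
    show "\<exists>l. ((\<lambda>x. f x + g x) \<longlongrightarrow> l) (side (\<not> p) x)" by blast
    show "((\<lambda>x. f x + g x) \<longlongrightarrow> f x + g x) (side p x)"
      using \<open>regular p f\<close> \<open>regular p g\<close> unfolding regular_def by (intro tendsto_add) blast+
  qed
  show "regular p (\<lambda>x. c * f x)" if "regular p f"
    unfolding regular_def
  proof (intro allI conjI)
    fix x
    obtain l where "(f \<longlongrightarrow> l) (side (\<not> p) x)"
      using \<open>regular p f\<close> unfolding regular_def by blast
    from tendsto_mult_left[OF this]
    show "\<exists>l. ((\<lambda>x. c * f x) \<longlongrightarrow> l) (side (\<not> p) x)" by blast
    show "((\<lambda>x. c * f x) \<longlongrightarrow> c * f x) (side p x)"
      using \<open>regular p f\<close> unfolding regular_def by (intro tendsto_mult_left) blast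
  qed
  show "regular p (\<lambda>x. c)"
    unfolding regular_def using tendsto_const by blast
qed

text \<open>A right-continuous function is the pointwise limit of its values at the next larger multiple
  of \<open>1 / (k + 1)\<close>; the left-continuous case follows by reflection.\<close>

lemma regular_imp_borel:
  assumes "regular p f"
  shows "f \<in> borel_measurable borel"
proof -
  have right: "f \<in> borel_measurable borel" if rc: "regular False f" for f
  proof (rule borel_measurable_LIMSEQ_real)
    fix x :: real
    define a where "a k = (real_of_int \<lfloor>real (Suc k) * x\<rfloor> + 1) / real (Suc k)" for k
    have gt: "x < a k" and le: "a k \<le> x + inverse (real (Suc k))" for k
    proof -
      have "real (Suc k) * x < real_of_int \<lfloor>real (Suc k) * x\<rfloor> + 1"
        by linarith
      then show "x < a k"
        unfolding a_def by (simp add: pos_less_divide_eq mult.commute del: of_nat_Suc)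
      have "real_of_int \<lfloor>real (Suc k) * x\<rfloor> + 1 \<le> (x + inverse (real (Suc k))) * real (Suc k)"
      proof -
        have "inverse (real (Suc k)) * real (Suc k) = 1" by simp
        then show ?thesis
          using of_int_floor_le[of "real (Suc k) * x"] unfolding distrib_right
          by (simp only: mult.commute[of x])
      qed
      then show "a k \<le> x + inverse (real (Suc k))"
        unfolding a_def by (simp add: pos_divide_le_eq del: of_nat_Suc)
    qed
    have "a \<longlonglongrightarrow> x"
    proof (rule tendsto_sandwich[of "\<lambda>_. x" a _ "\<lambda>k. x + inverse (real (Suc k))"])
      show "(\<lambda>k. x + inverse (real (Suc k))) \<longlonglongrightarrow> x"
        using tendsto_add[OF tendsto_const LIMSEQ_inverse_real_of_nat, of x] by simp
      show "eventually (\<lambda>k. x \<le> a k) sequentially"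
        and "eventually (\<lambda>k. a k \<le> x + inverse (real (Suc k))) sequentially"
        using gt le by (auto intro!: always_eventually less_imp_le simp del: of_nat_Suc)
    qed simp
    moreover have "eventually (\<lambda>k. a k \<in> {x<..} \<and> a k \<noteq> x) sequentially"
      using gt by (intro always_eventually allI) (simp add: less_imp_neq[symmetric])
    ultimately have lim: "filterlim a (at_right x) sequentially"
      by (simp add: filterlim_at)
    have "(f \<longlongrightarrow> f x) (at_right x)"
      using rc by (simp add: regular_def side_def)
    from filterlim_compose[OF this lim]
    show "(\<lambda>k. f ((real_of_int \<lfloor>real (Suc k) * x\<rfloor> + 1) / real (Suc k))) \<longlonglongrightarrow> f x"
      by (simp add: a_def)
  next
    fix k
    have [measurable]: "(\<lambda>i. f ((real_of_int i + 1) / real (Suc k))) \<in> measurable (count_space UNIV) borel"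
      by simp
    show "(\<lambda>x. f ((real_of_int \<lfloor>real (Suc k) * x\<rfloor> + 1) / real (Suc k))) \<in> borel_measurable borel"
      by measurable
  qed
  show ?thesis
  proof (cases p)
    case True
    then have "(\<lambda>x. f (- x)) \<in> borel_measurable borel"
      using right regular_uminus[OF assms] by simp
    then have "(\<lambda>x. f (- (- x))) \<in> borel_measurable borel"
      by (rule measurable_compose[rotated]) simp
    then show ?thesis by simp
  qed (use right assms in simp)
qed

text \<open>The two one-sided limits bound \<open>f\<close> near every point, and Bolzano's lemma passes from small
  intervals to \<open>[0, 1]\<close>.\<close>

lemma regular_bounded:
  assumes "regular p f"
  shows "\<exists>B. \<forall>x\<in>{0..1}. \<bar>f x\<bar> \<le> B"
proof -
  have "\<exists>B. \<forall>y\<in>{a..b}. \<bar>f y\<bar> \<le> B" if "a \<le> b" for a b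
    using that
  proof (induction rule: Bolzano)
    case (trans a b c)
    then obtain B C where "\<forall>y\<in>{a..b}. \<bar>f y\<bar> \<le> B" "\<forall>y\<in>{b..c}. \<bar>f y\<bar> \<le> C"
      by blast
    then have "\<bar>f y\<bar> \<le> max B C" if "y \<in> {a..c}" for y
      using that by (cases "y \<le> b") (fastforce simp: le_max_iff_disj)+
    then show ?case by blast
  next
    case (local x)
    have near: "\<exists>B d. d > 0 \<and> (\<forall>y. 0 < (if q then x - y else y - x) \<and> \<bar>y - x\<bar> < d \<longrightarrow> \<bar>f y\<bar> \<le> B)" for q
    proof -
      obtain l where "(f \<longlongrightarrow> l) (side q x)"
        using assms unfolding regular_def by (cases "q = p") auto
      then have "eventually (\<lambda>y. \<bar>f y - l\<bar> < 1) (side q x)"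
        using tendstoD[of f l "side q x" 1] by (simp add: dist_real_def)
      then have "eventually (\<lambda>y. \<bar>f y\<bar> \<le> \<bar>l\<bar> + 1) (side q x)"
        by eventually_elim linarith
      then show ?thesis unfolding eventually_side_iff by blast
    qed
    obtain B d where 1: "d > 0" "\<And>y. y < x \<Longrightarrow> \<bar>y - x\<bar> < d \<Longrightarrow> \<bar>f y\<bar> \<le> B"
      using near[of True] by (metis diff_gt_0_iff_gt)
    obtain C e where 2: "e > 0" "\<And>y. x < y \<Longrightarrow> \<bar>y - x\<bar> < e \<Longrightarrow> \<bar>f y\<bar> \<le> C"
      using near[of False] by (metis diff_gt_0_iff_gt)
    have near: "\<bar>f y\<bar> \<le> \<bar>B\<bar> + \<bar>C\<bar> + \<bar>f x\<bar>" if "\<bar>y - x\<bar> < min d e" for y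
      using 1(2)[of y] 2(2)[of y] that by (cases y x rule: linorder_cases) auto
    have "\<forall>y\<in>{a..b}. \<bar>f y\<bar> \<le> \<bar>B\<bar> + \<bar>C\<bar> + \<bar>f x\<bar>"
      if "a \<le> x \<and> x \<le> b \<and> b - a < min d e" for a b
      using that by (intro ballI near) auto
    then show ?case
      using 1(1) 2(1) by (intro exI[of _ "min d e"]) auto
  qed
  from this[of 0 1] show ?thesis by simp
qed

lemma one_sided_deriv_const: "one_sided_deriv p Z (\<lambda>x. c) (\<lambda>x. 0)"
  by (simp add: one_sided_deriv_def)

lemma one_sided_deriv_add_const:
  "one_sided_deriv p Z (\<lambda>x. c + f x) F \<longleftrightarrow> one_sided_deriv p Z f F"
  by (simp add: one_sided_deriv_def)

lemma one_sided_deriv_add: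
  assumes "one_sided_deriv p Z f F" "one_sided_deriv p Z g G"
  shows "one_sided_deriv p Z (\<lambda>x. f x + g x) (\<lambda>x. F x + G x)"
  unfolding one_sided_deriv_def
proof
  fix x
  have "((\<lambda>h. (f (x + h) - f x) / (Z (x + h) - Z x) + (g (x + h) - g x) / (Z (x + h) - Z x))
      \<longlongrightarrow> F x + G x) (side (\<not> p) 0)"
    using assms unfolding one_sided_deriv_def by (intro tendsto_add) auto
  then show "((\<lambda>h. (f (x + h) + g (x + h) - (f x + g x)) / (Z (x + h) - Z x)) \<longlongrightarrow> F x + G x)
      (side (\<not> p) 0)"
    by (simp add: add_diff_add add_divide_distrib)
qed

lemma one_sided_deriv_scale:
  assumes "one_sided_deriv p Z f F"
  shows "one_sided_deriv p Z (\<lambda>x. c * f x) (\<lambda>x. c * F x)"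
  unfolding one_sided_deriv_def
proof
  fix x
  have "((\<lambda>h. c * ((f (x + h) - f x) / (Z (x + h) - Z x))) \<longlongrightarrow> c * F x) (side (\<not> p) 0)"
    using assms unfolding one_sided_deriv_def by (intro tendsto_mult_left) auto
  then show "((\<lambda>h. (c * f (x + h) - c * f x) / (Z (x + h) - Z x)) \<longlongrightarrow> c * F x) (side (\<not> p) 0)"
    by (simp only: times_divide_eq_right right_diff_distrib)
qed

lemma one_sided_deriv_unique:
  assumes "one_sided_deriv p Z f F" "one_sided_deriv p Z f G"
  shows "F = G"
proof
  fix x
  show "F x = G x"
    using tendsto_unique[OF side_neq_bot assms(1)[unfolded one_sided_deriv_def, rule_format, of x]
        assms(2)[unfolded one_sided_deriv_def, rule_format, of x]] .
qed

lemma one_sided_deriv_at: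
  "one_sided_deriv p Z f F \<longleftrightarrow> (\<forall>x. ((\<lambda>y. (f y - f x) / (Z y - Z x)) \<longlongrightarrow> F x) (side (\<not> p) x))"
proof -
  have shift: "filterlim k \<F> (side q x) \<longleftrightarrow> filterlim (\<lambda>h. k (x + h)) \<F> (side q 0)"
    for k :: "real \<Rightarrow> real" and \<F> q x
    unfolding filterlim_def side_eq_shift[of q x] filtermap_filtermap ..
  show ?thesis
    unfolding one_sided_deriv_def
  proof (rule all_cong1)
    fix x
    show "((\<lambda>h. (f (x + h) - f x) / (Z (x + h) - Z x)) \<longlongrightarrow> F x) (side (\<not> p) 0) \<longleftrightarrow>
        ((\<lambda>y. (f y - f x) / (Z y - Z x)) \<longlongrightarrow> F x) (side (\<not> p) x)"
      unfolding shift[where k = "\<lambda>y. (f y - f x) / (Z y - Z x)" and x = x] ..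
  qed
qed

text \<open>The mean value theorem for one-sided derivatives: the estimate propagates from \<open>b\<close> to
  the left, past every point by the left increment there, and to the limit point of this process
  by right-continuity.\<close>

lemma increment_le_of_left_increments:
  fixes g W :: "real \<Rightarrow> real"
  assumes g: "\<And>x. (g \<longlongrightarrow> g x) (at_right x)" and W: "\<And>x. (W \<longlongrightarrow> W x) (at_right x)"
    and left: "\<And>x. eventually (\<lambda>y. \<bar>g x - g y\<bar> \<le> W x - W y) (at_left x)"
    and ab: "a \<le> b"
  shows "\<bar>g b - g a\<bar> \<le> W b - W a"
proof -
  define P where "P z \<longleftrightarrow> \<bar>g b - g z\<bar> \<le> W b - W z" for z
  define S where "S = {y \<in> {a..b}. \<forall>z\<in>{y..b}. P z}"
  have bS: "b \<in> S" using ab by (auto simp: S_def P_def)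
  have bdd: "bdd_below S" by (intro bdd_belowI[of _ a]) (simp add: S_def)
  define s where "s = Inf S"
  have sb: "s \<le> b" unfolding s_def using bS bdd by (rule cInf_lower)
  have as: "a \<le> s" unfolding s_def using bS by (intro cInf_greatest) (auto simp: S_def)
  have above: "P z" if "s < z" "z \<le> b" for z
  proof -
    obtain y where "y \<in> S" "y < z"
      using cInf_lessD[of S z] bS \<open>s < z\<close> unfolding s_def by blast
    then show ?thesis using that by (auto simp: S_def)
  qed
  have Ps: "P s"
  proof (cases "s = b")
    case False
    then have "s < b" using sb by simp
    have lims: "((\<lambda>z. \<bar>g b - g z\<bar>) \<longlongrightarrow> \<bar>g b - g s\<bar>) (at_right s)"
      "((\<lambda>z. W b - W z) \<longlongrightarrow> W b - W s) (at_right s)"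
      by (intro tendsto_intros g W)+
    have "eventually (\<lambda>z. \<bar>g b - g z\<bar> \<le> W b - W z) (at_right s)"
      unfolding eventually_at_right[OF \<open>s < b\<close>]
      using above[unfolded P_def] \<open>s < b\<close> by (intro exI[of _ b]) simp
    then show ?thesis
      unfolding P_def by (rule tendsto_le[OF trivial_limit_at_right_real lims(2,1)])
  qed (simp add: P_def)
  have "s = a"
  proof (rule ccontr)
    assume "s \<noteq> a"
    then have "a < s" using as by simp
    then obtain c where c: "c < s" "\<And>y. c < y \<Longrightarrow> y < s \<Longrightarrow> \<bar>g s - g y\<bar> \<le> W s - W y"
      using left[of s] unfolding eventually_at_left[OF \<open>a < s\<close>] by blast
    define y where "y = max a ((c + s) / 2)"
    have y: "c < y" "a \<le> y" "y < s" using c(1) \<open>a < s\<close> by (auto simp: y_def less_max_iff_disj)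
    have "P z" if "z \<in> {y..b}" for z
    proof (cases "s < z")
      case False
      then have "\<bar>g s - g z\<bar> \<le> W s - W z"
        using c(2)[of z] y that by (cases "z = s") auto
      then show ?thesis using Ps unfolding P_def by linarith
    qed (use above that in auto)
    then have "y \<in> S" using y sb by (auto simp: S_def)
    then have "s \<le> y" unfolding s_def using bdd by (intro cInf_lower)
    then show False using y by simp
  qed
  then show ?thesis using Ps by (simp add: P_def)
qed

text \<open>The increments of \<open>g\<close> are dominated by those of \<open>e * Z\<close> for every \<open>e > 0\<close>. Derivatives from
  the right are turned into derivatives from the left by reflecting the line at the origin.\<close>

lemma one_sided_deriv_zero_imp_const:
  assumes "one_sided_deriv p Z g (\<lambda>x. 0)" "regular p g" "regular p Z" "strict_mono Z"
  shows "g x = g y"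
proof -
  have left: "g x = g y" if d: "one_sided_deriv False Z g (\<lambda>x. 0)" and g: "regular False g"
    and Z: "regular False Z" "strict_mono Z" for g Z :: "real \<Rightarrow> real" and x y
  proof -
    have le: "g a = g b" if ab: "a \<le> b" for a b
    proof -
      have inc: "\<bar>g b - g a\<bar> \<le> e * (Z b - Z a)" if e: "e > 0" for e
      proof -
        have "\<bar>g b - g a\<bar> \<le> e * Z b - e * Z a"
        proof (rule increment_le_of_left_increments[OF _ _ _ ab])
          fix x
          show "(g \<longlongrightarrow> g x) (at_right x)"
            using g by (simp add: regular_def side_def)
          show "((\<lambda>x. e * Z x) \<longlongrightarrow> e * Z x) (at_right x)"
            using Z(1) by (intro tendsto_mult_left) (simp add: regular_def side_def)
          have lim: "((\<lambda>y. (g y - g x) / (Z y - Z x)) \<longlongrightarrow> 0) (at_left x)"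
            using d by (simp add: one_sided_deriv_at side_def)
          have "eventually (\<lambda>y. \<bar>(g y - g x) / (Z y - Z x)\<bar> < e) (at_left x)"
            using tendstoD[OF lim e] by (simp add: dist_real_def)
          moreover have "eventually (\<lambda>y. y < x) (at_left x)"
            by (simp add: eventually_at_filter)
          ultimately show "eventually (\<lambda>y. \<bar>g x - g y\<bar> \<le> e * Z x - e * Z y) (at_left x)"
          proof eventually_elim
            case (elim y)
            have "Z y < Z x" using Z(2) elim(2) by (simp add: strict_mono_def)
            then have "\<bar>g y - g x\<bar> < e * (Z x - Z y)"
              using elim(1) by (simp add: abs_divide pos_divide_less_eq mult.commute)
            then show ?case by (simp add: abs_minus_commute right_diff_distrib)
          qed
        qed
        then show ?thesis by (simp add: right_diff_distrib)
      qed
      have "Z a \<le> Z b" using Z(2) ab by (simp add: strict_mono_less_eq)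
      have "\<bar>g b - g a\<bar> \<le> 0 + e" if "e > 0" for e
      proof -
        have "\<bar>g b - g a\<bar> \<le> e / (Z b - Z a + 1) * (Z b - Z a)"
          using \<open>Z a \<le> Z b\<close> that by (intro inc) simp
        also have "\<dots> \<le> e"
          using that \<open>Z a \<le> Z b\<close> by (simp add: pos_divide_le_eq distrib_left)
        finally show ?thesis by simp
      qed
      then have "\<bar>g b - g a\<bar> \<le> 0" by (rule field_le_epsilon)
      then show ?thesis by simp
    qed
    show ?thesis
      by (rule linorder_le_cases[of x y]) (erule le, rule sym, erule le)
  qed
  show ?thesis
  proof (cases p)
    case True
    define g' Z' where "g' = (\<lambda>x. g (- x))" and "Z' = (\<lambda>x. - Z (- x))"
    have "one_sided_deriv False Z' g' (\<lambda>x. 0)"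
      unfolding one_sided_deriv_at
    proof
      fix x
      have "((\<lambda>y. (g y - g (- x)) / (Z y - Z (- x))) \<longlongrightarrow> 0) (side False (- x))"
        using assms(1) True by (simp add: one_sided_deriv_at)
      then have "((\<lambda>y. (g (- y) - g (- x)) / (Z (- y) - Z (- x))) \<longlongrightarrow> 0) (side True x)"
        using filterlim_side_uminus[of "\<lambda>y. (g y - g (- x)) / (Z y - Z (- x))" _ False "- x"] by simp
      then have "((\<lambda>y. - ((g (- y) - g (- x)) / (Z (- y) - Z (- x)))) \<longlongrightarrow> - 0) (side True x)"
        by (rule tendsto_minus)
      then show "((\<lambda>y. (g' y - g' x) / (Z' y - Z' x)) \<longlongrightarrow> 0) (side (\<not> False) x)"
        by (simp add: g'_def Z'_def minus_divide_right)
    qed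
    moreover have "regular False g'" "regular False Z'"
      using regular_uminus[OF assms(2)] regular_scale[OF regular_uminus[OF assms(3)], of "- 1"] True
      by (simp_all add: g'_def Z'_def)
    moreover have "strict_mono Z'"
      using assms(4) by (simp add: strict_mono_def Z'_def)
    ultimately have "g' (- x) = g' (- y)" by (rule left)
    then show ?thesis by (simp add: g'_def)
  next
    case False
    show ?thesis
      by (rule left) (use assms False in simp_all)
  qed
qed

lemma periodic_int:
  assumes "periodic f"
  shows "f (x + of_int k) = f x"
proof (induction k rule: int_induct[where k = 0])
  case (step1 i)
  have "f (x + of_int i + 1) = f (x + of_int i)" using assms by (simp add: periodic_def)
  then show ?case using step1 by (simp add: add.assoc)
next
  case (step2 i)
  have "x + of_int (i - 1) + 1 = x + of_int i" by simp
  moreover have "f (x + of_int (i - 1) + 1) = f (x + of_int (i - 1))"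
    using assms unfolding periodic_def by blast
  ultimately show ?case using step2 by simp
qed simp

lemma tendsto_side_periodic:
  assumes "periodic f"
  shows "(f \<longlongrightarrow> l) (side q (x + of_int k)) \<longleftrightarrow> (f \<longlongrightarrow> l) (side q x)"
proof -
  have shift: "(f \<longlongrightarrow> l) (side q z) \<longleftrightarrow> ((\<lambda>h. f (z + h)) \<longlongrightarrow> l) (side q 0)" for z
    unfolding filterlim_def side_eq_shift[of q z] filtermap_filtermap ..
  have "f (x + of_int k + h) = f (x + h)" for h
    using periodic_int[OF assms, of "x + h" k] by (simp add: algebra_simps)
  then show ?thesis
    unfolding shift[of "x + of_int k"] shift[of x] by presburger
qed

text \<open>A fundamental domain every point of which can be approached from the side \<open>q\<close> within
  \<open>[0, 1]\<close>.\<close>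

definition base :: "bool \<Rightarrow> real set" where
  "base q = (if q then {0<..1} else {0..<1})"

lemma exists_translate_in_base: "\<exists>k. x + real_of_int k \<in> base q"
proof (cases q)
  case True
  have "x + real_of_int (1 - \<lceil>x\<rceil>) \<in> base q"
    using True ceiling_correct[of x] by (simp add: base_def; linarith)
  then show ?thesis ..
next
  case False
  have "x + real_of_int (- \<lfloor>x\<rfloor>) \<in> base q"
    using False by (simp add: base_def; linarith)
  then show ?thesis ..
qed

lemma base_subset: "x \<in> base q \<Longrightarrow> x \<in> {0..1}"
  by (auto simp: base_def split: if_splits)

lemma eventually_side_unit:
  assumes "x \<in> base q"
  shows "eventually (\<lambda>y. y \<in> {0..1} \<and> (if q then y < x else x < y)) (side q x)"
  unfolding eventually_side_iff
proof (cases q)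
  case True
  then show "\<exists>d>0. \<forall>y. 0 < (if q then x - y else y - x) \<and> \<bar>y - x\<bar> < d \<longrightarrow>
      y \<in> {0..1} \<and> (if q then y < x else x < y)"
    using assms by (intro exI[of _ x]) (auto simp: base_def)
next
  case False
  then show "\<exists>d>0. \<forall>y. 0 < (if q then x - y else y - x) \<and> \<bar>y - x\<bar> < d \<longrightarrow>
      y \<in> {0..1} \<and> (if q then y < x else x < y)"
    using assms by (intro exI[of _ "1 - x"]) (auto simp: base_def)
qed

lemma alt_deriv_unique:
  assumes "\<And>f F G. D1 f F \<Longrightarrow> D1 f G \<Longrightarrow> F = G" "\<And>f F G. D2 f F \<Longrightarrow> D2 f G \<Longrightarrow> F = G"
  shows "alt_deriv D1 D2 n f F \<Longrightarrow> alt_deriv D1 D2 n f G \<Longrightarrow> F = G"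
proof (induction n arbitrary: F G)
  case (Suc n)
  then obtain F' G' where "alt_deriv D1 D2 n f F'" "alt_deriv D1 D2 n f G'"
    and FG: "if even n then D1 F' F else D2 F' F" "if even n then D1 G' G else D2 G' G"
    by auto
  then have "F' = G'" using Suc.IH by blast
  then show ?case
    using FG assms by (cases "even n") auto
qed simp

section \<open>The measures \<open>dW\<close> and \<open>dV\<close>\<close>

text \<open>\<open>seg p x\<close> is the part of the line over which a function is integrated to obtain the value
  of its primitive at \<open>x\<close>; whether \<open>x\<close> belongs to it decides from which side the primitive is
  continuous.\<close>

definition seg :: "bool \<Rightarrow> real \<Rightarrow> real set" where
  "seg p x = (if p then {..<x} else {..x})"

lemma seg_borel [measurable]: "seg p x \<in> sets borel"
  by (simp add: seg_def)

lemma seg_mono: "y \<le> x \<Longrightarrow> seg p y \<subseteq> seg p x"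
  by (auto simp: seg_def)

lemma seg_not: "x \<in> seg (\<not> p) y \<longleftrightarrow> y \<notin> seg p x"
  by (auto simp: seg_def)

lemma emeasure_interval_measure_singleton:
  assumes "mono F" "\<And>x. continuous (at_right x) F" "isCont F x"
  shows "emeasure (interval_measure F) {x} = 0"
proof -
  let ?M = "interval_measure F"
  have le: "emeasure ?M {x} \<le> ennreal (F x - F (x - 1 / real (Suc n)))" for n
  proof -
    have "emeasure ?M {x} \<le> emeasure ?M {x - 1 / real (Suc n) <.. x}"
      by (rule emeasure_mono) auto
    also have "\<dots> = ennreal (F x - F (x - 1 / real (Suc n)))"
      by (rule emeasure_interval_measure_Ioc) (use assms monoD in auto)
    finally show ?thesis .
  qed
  have "(\<lambda>n. x - 1 / real (Suc n)) \<longlonglongrightarrow> x - 0"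
    by (intro tendsto_diff tendsto_const) (use LIMSEQ_inverse_real_of_nat in \<open>simp add: inverse_eq_divide\<close>)
  then have "(\<lambda>n. F (x - 1 / real (Suc n))) \<longlonglongrightarrow> F x"
    using isCont_tendsto_compose[OF assms(3)] by simp
  then have "(\<lambda>n. ennreal (F x - F (x - 1 / real (Suc n)))) \<longlonglongrightarrow> ennreal (F x - F x)"
    by (intro tendsto_intros)
  then have "emeasure ?M {x} \<le> ennreal (F x - F x)"
    using le by (intro LIMSEQ_le_const) auto
  then show ?thesis by simp
qed

text \<open>The initial segments are closed under intersection and generate the Borel sets, so the
  integrals over all Borel sets vanish as well.\<close>

lemma (in circle_measure) AE_zero_if_seg_integrals_zero:
  fixes f :: "real \<Rightarrow> real"
  assumes f: "integrable \<mu> f" and total: "(\<integral>x. f x \<partial>\<mu>) = 0"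
    and seg: "\<And>x. (\<integral>y. f y * indicator (seg p x) y \<partial>\<mu>) = 0"
  shows "AE x in \<mu>. f x = 0"
proof -
  have inter: "A \<inter> {0..<1} \<in> sets \<mu>" if "A \<in> sets borel" for A
    unfolding sets_circle using that by (auto simp: sets_restrict_space_iff)
  have f_set: "set_integrable \<mu> A f" if "A \<in> sets \<mu>" for A
    using integrable_mult_indicator[OF that f] by (simp add: set_integrable_def)
  have gen: "sigma_sets UNIV (range (seg p)) \<subseteq> sets borel"
    using sets.sigma_sets_subset[of "range (seg p)" borel] by (simp add: image_subset_iff)
  have "set_lebesgue_integral \<mu> (A \<inter> {0..<1}) f = 0" if A: "A \<in> sigma_sets UNIV (range (seg p))" for A
  proof (rule sigma_sets_induct_disjoint[OF _ _ A])
    show "Int_stable (range (seg p))"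
    proof (rule Int_stableI)
      fix a b assume "a \<in> range (seg p)" "b \<in> range (seg p)"
      then obtain x y where "a = seg p x" "b = seg p y" by blast
      then have "a \<inter> b = seg p (min x y)" by (auto simp: seg_def)
      then show "a \<inter> b \<in> range (seg p)" by blast
    qed
    show "set_lebesgue_integral \<mu> (B \<inter> {0..<1}) f = 0" if B: "B \<in> range (seg p)" for B
    proof -
      obtain x where x: "B = seg p x" using B by blast
      have "set_lebesgue_integral \<mu> (B \<inter> {0..<1}) f = (\<integral>y. f y * indicator (seg p x) y \<partial>\<mu>)"
        unfolding set_lebesgue_integral_def x
        by (rule Bochner_Integration.integral_cong) (auto simp: space_circle indicator_def)
      then show ?thesis using seg by simp
    qed
    show "set_lebesgue_integral \<mu> ((UNIV - B) \<inter> {0..<1}) f = 0"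
      if B: "B \<in> sigma_sets UNIV (range (seg p))" "set_lebesgue_integral \<mu> (B \<inter> {0..<1}) f = 0" for B
    proof -
      have "B \<in> sets borel"
        using B(1) gen by blast
      then have m: "B \<inter> {0..<1} \<in> sets \<mu>" "(UNIV - B) \<inter> {0..<1} \<in> sets \<mu>"
        by (auto intro: inter)
      have "set_lebesgue_integral \<mu> (B \<inter> {0..<1} \<union> (UNIV - B) \<inter> {0..<1}) f =
          set_lebesgue_integral \<mu> (B \<inter> {0..<1}) f + set_lebesgue_integral \<mu> ((UNIV - B) \<inter> {0..<1}) f"
        using m by (intro set_integral_Un f_set) auto
      moreover have "B \<inter> {0..<1} \<union> (UNIV - B) \<inter> {0..<1} = space \<mu>"
        by (auto simp: space_circle)
      moreover have "set_lebesgue_integral \<mu> (space \<mu>) f = 0"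
        using f total by (simp add: set_integral_space)
      ultimately show ?thesis using B(2) by simp
    qed
    show "set_lebesgue_integral \<mu> ((\<Union>i. B i) \<inter> {0..<1}) f = 0"
      if B: "disjoint_family B" "range B \<subseteq> sigma_sets UNIV (range (seg p))"
        "\<And>i. set_lebesgue_integral \<mu> (B i \<inter> {0..<1}) f = 0" for B :: "nat \<Rightarrow> real set"
    proof -
      have "B i \<in> sets borel" for i
        using B(2) gen by blast
      then have m: "B i \<inter> {0..<1} \<in> sets \<mu>" for i by (rule inter)
      have sum: "set_lebesgue_integral \<mu> (\<Union>i. B i \<inter> {0..<1}) f = (\<Sum>i. set_lebesgue_integral \<mu> (B i \<inter> {0..<1}) f)"
      proof (rule lebesgue_integral_countable_add[OF m])
        show "(B i \<inter> {0..<1}) \<inter> (B j \<inter> {0..<1}) = {}" if "i \<noteq> j" for i j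
          using B(1) that by (auto simp: disjoint_family_on_def)
        show "set_integrable \<mu> (\<Union>i. B i \<inter> {0..<1}) f"
          using m by (intro f_set sets.countable_UN) blast
      qed
      have eq: "(\<Union>i. B i) \<inter> {0..<1} = (\<Union>i. B i \<inter> {0..<1})" by blast
      show ?thesis unfolding eq sum B(3) by simp
    qed
  qed (auto simp: set_lebesgue_integral_def)
  moreover have "sets borel = sigma_sets UNIV (range (seg p))"
  proof (cases p)
    case True
    then have "seg p = lessThan" by (auto simp: seg_def fun_eq_iff)
    then show ?thesis by (subst borel_Iio) (simp add: sets_measure_of)
  next
    case False
    then have "seg p = atMost" by (auto simp: seg_def fun_eq_iff)
    then show ?thesis by (subst borel_eq_atMost) (simp add: sets_measure_of)
  qed
  ultimately have null: "set_lebesgue_integral \<mu> (A \<inter> {0..<1}) f = 0" if "A \<in> sets borel" for A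
    using that by simp
  show ?thesis
  proof (rule density_unique_real[OF f, of "\<lambda>x. 0"])
    fix A assume "A \<in> sets \<mu>"
    then have "A \<in> sets borel" "A \<inter> {0..<1} = A"
      unfolding sets_circle by (auto simp: sets_restrict_space_iff)
    then show "set_lebesgue_integral \<mu> A f = set_lebesgue_integral \<mu> A (\<lambda>x. 0)"
      using null[of A] by (simp add: set_lebesgue_integral_def)
  qed simp
qed

lemma (in circle_measure) L2_indicator_integrable:
  assumes f: "f \<in> L2 \<mu>" and A: "A \<in> sets borel"
  shows "integrable \<mu> (\<lambda>x. f x * indicator A x)"
proof (rule Bochner_Integration.integrable_bound[OF L2_integrable[OF f]])
  have "(\<lambda>x. f x * indicator A x) \<in> borel_measurable borel"
    using L2D(1)[OF f] A by measurable
  then show "(\<lambda>x. f x * indicator A x) \<in> borel_measurable \<mu>"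
    by (rule measurable_circle)
qed (auto simp: indicator_def)

locale increasing_pair =
  fixes W V :: "real \<Rightarrow> real"
  assumes W: "strict_mono W" "cadlag W" "periodic_increments W" "isCont W 0" "W 0 = 0"
    and V: "strict_mono V" "caglad V" "periodic_increments V" "isCont V 0" "V 0 = 0"
begin

text \<open>Functions of level \<open>p\<close> are integrated against \<open>\<mu> p\<close> and differentiated with respect to \<open>Z p\<close>,
  which is the distribution function of the measure \<open>\<mu> (\<not> p)\<close>: differentiation changes the
  level.\<close>

definition Z :: "bool \<Rightarrow> real \<Rightarrow> real" where
  "Z p = (if p then V else W)"

definition \<mu> :: "bool \<Rightarrow> real measure" where
  "\<mu> p = (if p then dW W else dV V)"

lemma strict_mono_Z: "strict_mono (Z p)"
  and regular_Z: "regular p (Z p)"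
  and isCont_Z: "isCont (Z p) 0"
  and Z_0: "Z p 0 = 0"
  and Z_add_1: "Z p (x + 1) = Z p x + Z p 1"
proof -
  show "strict_mono (Z p)" "isCont (Z p) 0" "Z p 0 = 0"
    using W V by (auto simp: Z_def)
  show "regular p (Z p)"
    using W(2) V(2) by (simp add: Z_def cadlag_eq_regular caglad_eq_regular)
  have "W (x + 1) - W x = W 1 - W 0" "V (x + 1) - V x = V 1 - V 0"
    using W(3) V(3) unfolding periodic_increments_def by blast+
  then show "Z p (x + 1) = Z p x + Z p 1"
    using W(5) V(5) by (simp add: Z_def)
qed

lemma Z_mono: "x \<le> y \<Longrightarrow> Z p x \<le> Z p y"
  using strict_mono_Z[of p] by (simp add: strict_mono_less_eq)

lemma Z_less: "x < y \<Longrightarrow> Z p x < Z p y"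
  using strict_mono_Z[of p] by (simp add: strict_mono_less)

lemma isCont_Z_1: "isCont (Z p) 1"
proof -
  have "isCont (\<lambda>x. Z p (x + - 1) + Z p 1) 1"
    by (intro continuous_add continuous_const isCont_o2[where f = "\<lambda>x. x + - 1" and g = "Z p"])
       (simp_all add: isCont_Z)
  moreover have "(\<lambda>x. Z p (x + - 1) + Z p 1) = Z p"
  proof
    fix x
    show "Z p (x + - 1) + Z p 1 = Z p x" using Z_add_1[of p "x - 1"] by simp
  qed
  ultimately show ?thesis by simp
qed

lemma sets_\<mu>: "sets (\<mu> p) = sets (restrict_space borel {0..<1})"
  by (auto simp: \<mu>_def dW_def dV_def interval_measure_left_def sets_restrict_space)

text \<open>For \<open>W\<close>, the set \<open>[0, 1) \<inter> {..x}\<close> differs from \<open>(0, x]\<close> at most in the points 0 and 1,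
  which carry no mass because \<open>W\<close> is continuous there.\<close>

lemma emeasure_seg:
  assumes "0 \<le> x" "x \<le> 1"
  shows "emeasure (\<mu> (\<not> p)) ({0..<1} \<inter> seg p x) = ennreal (Z p x)"
proof (cases p)
  case True
  let ?M = "interval_measure_left V"
  have "emeasure (\<mu> (\<not> p)) ({0..<1} \<inter> seg p x) = emeasure ?M ({0..<1} \<inter> seg p x)"
    using True unfolding \<mu>_def dV_def
    by (simp add: emeasure_restrict_space interval_measure_left_def)
  also have "\<dots> = emeasure ?M {0..<x}"
    using True assms by (intro arg_cong[where f = "emeasure ?M"]) (auto simp: seg_def)
  also have "emeasure ?M {0..<x} = ennreal (V x - V 0)"
    by (rule emeasure_interval_measure_left)
       (use V assms in \<open>auto simp: strict_mono_mono caglad_def\<close>)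
  finally show ?thesis using True V(5) by (simp add: Z_def)
next
  case False
  let ?M = "interval_measure W"
  have mono: "mono W" and rc: "\<And>x. continuous (at_right x) W"
    using W(1,2) by (auto simp: strict_mono_mono cadlag_def)
  have cont: "isCont W 0" "isCont W 1"
    using W(4) isCont_Z_1[of False] by (auto simp: Z_def)
  have null: "{0} \<in> null_sets ?M" "{1} \<in> null_sets ?M"
    using emeasure_interval_measure_singleton[OF mono rc cont(1)]
      emeasure_interval_measure_singleton[OF mono rc cont(2)] by (auto intro!: null_setsI)
  have "emeasure (\<mu> (\<not> p)) ({0..<1} \<inter> seg p x) = emeasure ?M ({0..<1} \<inter> seg p x)"
    using False unfolding \<mu>_def dW_def by (simp add: emeasure_restrict_space)
  also have "\<dots> = emeasure ?M (({0<..x} \<union> {0}) - {1})"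
    using False assms by (intro arg_cong[where f = "emeasure ?M"]) (auto simp: seg_def)
  also have "\<dots> = emeasure ?M ({0<..x} \<union> {0})"
    by (rule emeasure_Diff_null_set[OF null(2)]) auto
  also have "\<dots> = emeasure ?M {0<..x}"
    by (rule emeasure_Un_null_set[OF _ null(1)]) auto
  also have "\<dots> = ennreal (W x - W 0)"
    by (rule emeasure_interval_measure_Ioc) (use rc mono assms monoD in auto)
  finally show ?thesis using False W(5) by (simp add: Z_def)
qed

lemma circle_measure_\<mu>: "circle_measure (\<mu> p)"
proof (intro circle_measure.intro finite_measureI circle_measure_axioms.intro)
  show "sets (\<mu> p) = sets (restrict_space borel {0..<1})" by (rule sets_\<mu>)
  have "space (\<mu> p) = {0..<1} \<inter> seg (\<not> p) 1"
    using sets_eq_imp_space_eq[OF sets_\<mu>[of p]] by (auto simp: space_restrict_space seg_def)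
  then show "emeasure (\<mu> p) (space (\<mu> p)) \<noteq> \<infinity>"
    using emeasure_seg[of 1 "\<not> p"] by simp
qed

sublocale \<mu>: circle_measure "\<mu> p" for p
  by (rule circle_measure_\<mu>)

lemma measure_seg:
  "0 \<le> x \<Longrightarrow> x \<le> 1 \<Longrightarrow> measure (\<mu> (\<not> p)) ({0..<1} \<inter> seg p x) = Z p x"
  using emeasure_seg[of x p] Z_mono[of 0 x p] Z_0[of p] measure_eq_emeasure_eq_ennreal by metis

lemma circle_sets: "A \<in> sets borel \<Longrightarrow> {0..<1} \<inter> A \<in> sets (\<mu> p)"
  unfolding sets_\<mu> by (auto simp: sets_restrict_space)

lemma measure_seg_diff:
  assumes "0 \<le> y" "y \<le> x" "x \<le> 1"
  shows "measure (\<mu> (\<not> p)) ({0..<1} \<inter> (seg p x - seg p y)) = Z p x - Z p y"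
proof -
  have "{0..<1} \<inter> (seg p x - seg p y) = ({0..<1} \<inter> seg p x) - ({0..<1} \<inter> seg p y)"
    by auto
  then have "measure (\<mu> (\<not> p)) ({0..<1} \<inter> (seg p x - seg p y)) =
      measure (\<mu> (\<not> p)) ({0..<1} \<inter> seg p x) - measure (\<mu> (\<not> p)) ({0..<1} \<inter> seg p y)"
    using seg_mono[OF assms(2), of p]
    by (simp only:) (intro \<mu>.finite_measure_Diff circle_sets seg_borel Int_mono order_refl)
  then show ?thesis using assms by (simp add: measure_seg)
qed

definition mass :: "bool \<Rightarrow> real" where
  "mass p = measure (\<mu> p) (space (\<mu> p))"

lemma mass_pos: "mass p > 0"
proof -
  have "space (\<mu> p) = {0..<1} \<inter> seg (\<not> p) 1"
    by (auto simp: \<mu>.space_circle seg_def)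
  then have "mass p = Z (\<not> p) 1"
    using measure_seg[of 1 "\<not> p"] by (simp add: mass_def)
  then show ?thesis using Z_less[of 0 1 "\<not> p"] Z_0 by simp
qed

lemma Z_int: "Z p (x + of_int k) = Z p x + of_int k * Z p 1"
proof -
  have "periodic (\<lambda>x. Z p x - x * Z p 1)"
    by (simp add: periodic_def Z_add_1 algebra_simps)
  from periodic_int[OF this, of x k] show ?thesis by (simp add: algebra_simps)
qed


section \<open>Primitives\<close>

abbreviation nrm :: "bool \<Rightarrow> (real \<Rightarrow> real) \<Rightarrow> real" where
  "nrm p \<equiv> form_norm (l2 (\<mu> p))"

definition L0 :: "bool \<Rightarrow> (real \<Rightarrow> real) set" where
  "L0 p = {f \<in> L2 (\<mu> p). (\<integral>x. f x \<partial>\<mu> p) = 0}"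

definition C :: "bool \<Rightarrow> (real \<Rightarrow> real) set" where
  "C p = {f. periodic f \<and> regular p f \<and> (\<integral>x. f x \<partial>\<mu> p) = 0}"

text \<open>Taking the fractional part extends the primitive periodically; for \<open>F\<close> of mean zero the
  extension is continuous at the integers.\<close>

definition primitive :: "bool \<Rightarrow> (real \<Rightarrow> real) \<Rightarrow> real \<Rightarrow> real" where
  "primitive p F x = (\<integral>y. F y * indicator (seg p (frac x)) y \<partial>\<mu> (\<not> p))"

definition J :: "bool \<Rightarrow> (real \<Rightarrow> real) \<Rightarrow> real \<Rightarrow> real" where
  "J p F x = primitive p F x - (\<integral>x. primitive p F x \<partial>\<mu> p) / mass p"

lemma L0D: "f \<in> L0 p \<Longrightarrow> f \<in> L2 (\<mu> p)" "f \<in> L0 p \<Longrightarrow> (\<integral>x. f x \<partial>\<mu> p) = 0"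
  by (auto simp: L0_def)

lemma regular_L2: "periodic f \<Longrightarrow> regular q f \<Longrightarrow> f \<in> L2 (\<mu> p)"
  using regular_bounded[of q f] \<mu>.L2_bounded[OF regular_imp_borel] by fastforce

lemma C_subset_L0: "f \<in> C p \<Longrightarrow> f \<in> L0 p"
  by (auto simp: C_def L0_def intro: regular_L2)

lemma C_zero: "(\<lambda>x. 0) \<in> C p"
  and C_add: "f \<in> C p \<Longrightarrow> g \<in> C p \<Longrightarrow> (\<lambda>x. f x + g x) \<in> C p"
  and C_scale: "f \<in> C p \<Longrightarrow> (\<lambda>x. c * f x) \<in> C p"
proof -
  show "(\<lambda>x. 0) \<in> C p"
    by (simp add: C_def periodic_def regular_const)
  show "(\<lambda>x. f x + g x) \<in> C p" if f: "f \<in> C p" and g: "g \<in> C p"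
  proof -
    have "(\<integral>x. f x + g x \<partial>\<mu> p) = 0"
      using L0D[OF C_subset_L0[OF f]] L0D[OF C_subset_L0[OF g]]
      by (simp add: \<mu>.L2_integrable)
    then show ?thesis
      using f g by (simp add: C_def periodic_def regular_add)
  qed
  show "(\<lambda>x. c * f x) \<in> C p" if f: "f \<in> C p"
    using f by (simp add: C_def periodic_def regular_scale)
qed

text \<open>At \<open>x = 1\<close> the fractional part falls back to 0, but the two integrals agree: the one at 0
  vanishes because there is no mass at 0, the one at 1 because \<open>F\<close> has mean zero. All further
  computations can therefore be made on \<open>[0, 1]\<close> without reference to the fractional part.\<close>

lemma primitive_eq:
  assumes F: "F \<in> L0 (\<not> p)" and x: "0 \<le> x" "x \<le> 1"
  shows "primitive p F x = (\<integral>y. F y * indicator (seg p x) y \<partial>\<mu> (\<not> p))"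
proof (cases "x = 1")
  case True
  have "{0..<1} \<inter> seg p 0 \<in> null_sets (\<mu> (\<not> p))"
    using emeasure_seg[of 0 p] by (intro null_setsI circle_sets seg_borel) (simp add: Z_0)
  then have "AE y in \<mu> (\<not> p). y \<notin> {0..<1} \<inter> seg p 0"
    by (rule AE_not_in)
  then have "AE y in \<mu> (\<not> p). F y * indicator (seg p 0) y = 0"
    using AE_space by eventually_elim (auto simp: \<mu>.space_circle)
  then have "(\<integral>y. F y * indicator (seg p 0) y \<partial>\<mu> (\<not> p)) = 0"
    by (rule integral_eq_zero_AE)
  moreover have "(\<integral>y. F y * indicator (seg p 1) y \<partial>\<mu> (\<not> p)) = (\<integral>y. F y \<partial>\<mu> (\<not> p))"
    by (rule Bochner_Integration.integral_cong) (auto simp: \<mu>.space_circle seg_def)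
  ultimately show ?thesis
    using True L0D(2)[OF F] by (simp add: primitive_def)
next
  case False
  then show ?thesis using x by (simp add: primitive_def)
qed

lemma primitive_diff:
  assumes F: "F \<in> L0 (\<not> p)" and xy: "0 \<le> y" "y \<le> x" "x \<le> 1"
  shows "primitive p F x - primitive p F y =
    (\<integral>z. F z * indicator (seg p x - seg p y) z \<partial>\<mu> (\<not> p))"
proof -
  have "primitive p F x - primitive p F y =
      (\<integral>z. F z * indicator (seg p x) z - F z * indicator (seg p y) z \<partial>\<mu> (\<not> p))"
    using primitive_eq[OF F, of x] primitive_eq[OF F, of y] xy L0D(1)[OF F]
    by (simp add: \<mu>.L2_indicator_integrable)
  also have "\<dots> = (\<integral>z. F z * indicator (seg p x - seg p y) z \<partial>\<mu> (\<not> p))"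
    using seg_mono[OF xy(2), of p]
    by (intro Bochner_Integration.integral_cong) (auto simp: indicator_def)
  finally show ?thesis .
qed

lemma integral_seg_diff:
  assumes "0 \<le> y" "y \<le> x" "x \<le> 1"
  shows "(\<integral>z. c * indicator (seg p x - seg p y) z \<partial>\<mu> (\<not> p)) = c * (Z p x - Z p y)"
proof -
  have "(seg p x - seg p y) \<inter> space (\<mu> (\<not> p)) = {0..<1} \<inter> (seg p x - seg p y)"
    by (auto simp: \<mu>.space_circle)
  then show ?thesis
    using measure_seg_diff[OF assms, of p] by simp
qed

lemma primitive_increment:
  assumes F: "F \<in> L0 (\<not> p)" and xy: "0 \<le> y" "y \<le> x" "x \<le> 1"
    and near: "\<And>z. z \<in> seg p x - seg p y \<Longrightarrow> \<bar>F z - c\<bar> \<le> e"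
  shows "\<bar>primitive p F x - primitive p F y - c * (Z p x - Z p y)\<bar> \<le> e * (Z p x - Z p y)"
proof -
  let ?A = "seg p x - seg p y"
  have A: "?A \<in> sets borel" by (intro sets.Diff seg_borel)
  have ind: "integrable (\<mu> (\<not> p)) (\<lambda>z. c * indicator ?A z)" for c :: real
    using \<mu>.L2_indicator_integrable[OF \<mu>.L2_const A] by simp
  have Fi: "integrable (\<mu> (\<not> p)) (\<lambda>z. F z * indicator ?A z)"
    by (rule \<mu>.L2_indicator_integrable[OF L0D(1)[OF F] A])
  have eq: "primitive p F x - primitive p F y - c * (Z p x - Z p y) =
      (\<integral>z. F z * indicator ?A z - c * indicator ?A z \<partial>\<mu> (\<not> p))"
    unfolding primitive_diff[OF F xy] integral_seg_diff[OF xy, symmetric]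
    by (rule Bochner_Integration.integral_diff[symmetric, OF Fi ind])
  have "\<bar>primitive p F x - primitive p F y - c * (Z p x - Z p y)\<bar> \<le>
      (\<integral>z. \<bar>F z * indicator ?A z - c * indicator ?A z\<bar> \<partial>\<mu> (\<not> p))"
    unfolding eq by (rule integral_abs_bound)
  also have "\<dots> \<le> (\<integral>z. e * indicator ?A z \<partial>\<mu> (\<not> p))"
  proof (rule integral_mono)
    show "integrable (\<mu> (\<not> p)) (\<lambda>z. \<bar>F z * indicator ?A z - c * indicator ?A z\<bar>)"
      by (intro integrable_abs Bochner_Integration.integrable_diff Fi ind)
    show "\<bar>F z * indicator ?A z - c * indicator ?A z\<bar> \<le> e * indicator ?A z" for z
      using near[of z] by (cases "z \<in> ?A") (auto simp: indicator_def)
  qed (rule ind)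
  also have "\<dots> = e * (Z p x - Z p y)"
    by (rule integral_seg_diff[OF xy])
  finally show ?thesis .
qed

text \<open>The Cauchy--Schwarz inequality, applied to \<open>F\<close> and the indicator of the segment between the
  two points. It makes primitives inherit the one-sided continuity and the one-sided limits of
  \<open>Z p\<close>.\<close>

lemma primitive_Hoelder:
  assumes F: "F \<in> L0 (\<not> p)" and xy: "x \<in> {0..1}" "y \<in> {0..1}"
  shows "\<bar>primitive p F x - primitive p F y\<bar> \<le> nrm (\<not> p) F * sqrt \<bar>Z p x - Z p y\<bar>"
proof -
  have *: "\<bar>primitive p F x - primitive p F y\<bar> \<le> nrm (\<not> p) F * sqrt \<bar>Z p x - Z p y\<bar>"
    if yx: "0 \<le> y" "y \<le> x" "x \<le> 1" for x y
  proof -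
    let ?A = "seg p x - seg p y"
    \<comment> \<open>the indicator has to be made periodic to be an element of \<open>L2\<close>\<close>
    define g where "g z = (indicator ?A (frac z) :: real)" for z
    have g: "g z = indicator ?A z" if "z \<in> space (\<mu> (\<not> p))" for z
      using that by (simp add: g_def \<mu>.space_circle)
    have frac_borel: "frac \<in> borel_measurable (borel :: real measure)"
      unfolding frac_def[abs_def] by measurable
    have gL: "g \<in> L2 (\<mu> (\<not> p))"
    proof (rule \<mu>.L2_bounded[where B = 1])
      show "g \<in> borel_measurable borel"
        unfolding g_def[abs_def] using frac_borel by measurable
    qed (auto simp: g_def periodic_def frac_1_eq indicator_def)
    have "(\<integral>z. g z * g z \<partial>\<mu> (\<not> p)) = (\<integral>z. 1 * indicator ?A z \<partial>\<mu> (\<not> p))"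
      by (rule Bochner_Integration.integral_cong) (auto simp: g indicator_def)
    then have ng: "nrm (\<not> p) g = sqrt \<bar>Z p x - Z p y\<bar>"
      using integral_seg_diff[OF yx, where p = p and c = 1] Z_mono[OF yx(2), of p] by (simp add: form_norm_def)
    have "primitive p F x - primitive p F y = l2 (\<mu> (\<not> p)) F g"
      unfolding primitive_diff[OF F yx] by (rule Bochner_Integration.integral_cong) (auto simp: g)
    then show ?thesis
      using \<mu>.L2.Cauchy_Schwarz[OF L0D(1)[OF F] gL] ng by simp
  qed
  show ?thesis
    using *[of y x] *[of x y] xy by (cases "y \<le> x") (auto simp: abs_minus_commute)
qed

lemma periodic_primitive: "periodic (primitive p F)"
  by (simp add: periodic_def primitive_def frac_1_eq)

lemma regular_primitive:
  assumes F: "F \<in> L0 (\<not> p)"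
  shows "regular p (primitive p F)"
  unfolding regular_def
proof (intro allI conjI)
  fix x
  let ?I = "primitive p F" and ?N = "nrm (\<not> p) F"
  have N: "?N \<ge> 0" by (rule \<mu>.L2.form_norm_nonneg[OF L0D(1)[OF F]])
  show "(?I \<longlongrightarrow> ?I x) (side p x)"
  proof -
    obtain k where k: "x + real_of_int k \<in> base p" using exists_translate_in_base by blast
    define z where "z = x + real_of_int k"
    have z: "z \<in> base p" using k by (simp add: z_def)
    have "((\<lambda>y. ?N * sqrt \<bar>Z p y - Z p z\<bar>) \<longlongrightarrow> ?N * sqrt \<bar>Z p z - Z p z\<bar>) (side p z)"
      using regular_Z[of p] unfolding regular_def by (intro tendsto_intros) blast
    then have "((\<lambda>y. ?N * sqrt \<bar>Z p y - Z p z\<bar>) \<longlongrightarrow> 0) (side p z)" by simp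
    then have "((\<lambda>y. ?I y - ?I z) \<longlongrightarrow> 0) (side p z)"
    proof (rule Lim_null_comparison[rotated])
      show "eventually (\<lambda>y. norm (?I y - ?I z) \<le> ?N * sqrt \<bar>Z p y - Z p z\<bar>) (side p z)"
        using eventually_side_unit[OF z]
        by eventually_elim (use primitive_Hoelder[OF F _ base_subset[OF z]] in simp)
    qed
    then have "(?I \<longlongrightarrow> ?I z) (side p z)"
      using LIM_zero_cancel by blast
    then show ?thesis
      unfolding z_def tendsto_side_periodic[OF periodic_primitive] periodic_int[OF periodic_primitive] .
  qed
  show "\<exists>l. (?I \<longlongrightarrow> l) (side (\<not> p) x)"
  proof -
    obtain k where k: "x + real_of_int k \<in> base (\<not> p)" using exists_translate_in_base by blast
    define z where "z = x + real_of_int k"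
    have z: "z \<in> base (\<not> p)" using k by (simp add: z_def)
    obtain m where m: "(Z p \<longlongrightarrow> m) (side (\<not> p) z)"
      using regular_Z[of p] unfolding regular_def by blast
    have "cauchy_filter (filtermap ?I (side (\<not> p) z))"
      unfolding cauchy_filter_metric_filtermap
    proof (intro allI impI)
      fix e :: real assume e: "e > 0"
      define d where "d = (e / (?N + 1))\<^sup>2 / 2"
      have d: "d > 0" using e N by (simp add: d_def)
      let ?P = "\<lambda>y. y \<in> {0..1} \<and> \<bar>Z p y - m\<bar> < d"
      have "eventually (\<lambda>y. \<bar>Z p y - m\<bar> < d) (side (\<not> p) z)"
        using tendstoD[OF m d] by (simp add: dist_real_def)
      with eventually_side_unit[OF z] have "eventually ?P (side (\<not> p) z)"
        by eventually_elim auto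
      moreover have "dist (?I u) (?I v) < e" if "?P u" "?P v" for u v
      proof -
        have "\<bar>Z p u - Z p v\<bar> < (e / (?N + 1))\<^sup>2"
          using that unfolding d_def by linarith
        then have "sqrt \<bar>Z p u - Z p v\<bar> < sqrt ((e / (?N + 1))\<^sup>2)"
          by (rule real_sqrt_less_mono)
        then have s: "sqrt \<bar>Z p u - Z p v\<bar> < e / (?N + 1)"
          using e N by simp
        have "\<bar>?I u - ?I v\<bar> \<le> ?N * sqrt \<bar>Z p u - Z p v\<bar>"
          using primitive_Hoelder[OF F] that by blast
        also have "\<dots> \<le> ?N * (e / (?N + 1))"
          using s N by (intro mult_left_mono) auto
        also have "\<dots> < e"
          using e N by (simp add: pos_divide_less_eq distrib_left mult.commute)
        finally show ?thesis by (simp add: dist_real_def)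
      qed
      ultimately show "\<exists>P. eventually P (side (\<not> p) z) \<and> (\<forall>u v. P u \<and> P v \<longrightarrow> dist (?I u) (?I v) < e)"
        by (intro exI[of _ ?P]) blast
    qed
    then have "\<exists>c. filtermap ?I (side (\<not> p) z) \<le> nhds c"
      by (rule cauchy_filter_complete_converges[OF _ complete_UNIV]) (simp_all add: filtermap_bot_iff)
    then have "\<exists>l. (?I \<longlongrightarrow> l) (side (\<not> p) z)"
      by (simp add: filterlim_def)
    then show ?thesis
      unfolding z_def tendsto_side_periodic[OF periodic_primitive] .
  qed
qed

lemma abs_primitive_le:
  assumes F: "F \<in> L0 (\<not> p)"
  shows "\<bar>primitive p F x\<bar> \<le> sqrt (mass (\<not> p)) * nrm (\<not> p) F"
proof -
  have "\<bar>primitive p F x\<bar> \<le> (\<integral>y. \<bar>F y * indicator (seg p (frac x)) y\<bar> \<partial>\<mu> (\<not> p))"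
    unfolding primitive_def by (rule integral_abs_bound)
  also have "\<dots> \<le> (\<integral>y. \<bar>F y\<bar> \<partial>\<mu> (\<not> p))"
  proof (rule integral_mono)
    show "integrable (\<mu> (\<not> p)) (\<lambda>y. \<bar>F y * indicator (seg p (frac x)) y\<bar>)"
      by (intro integrable_abs \<mu>.L2_indicator_integrable L0D(1)[OF F] seg_borel)
    show "integrable (\<mu> (\<not> p)) (\<lambda>y. \<bar>F y\<bar>)"
      by (intro integrable_abs \<mu>.L2_integrable L0D(1)[OF F])
  qed (auto simp: indicator_def)
  also have "\<dots> \<le> sqrt (mass (\<not> p)) * nrm (\<not> p) F"
    unfolding mass_def by (rule \<mu>.integral_abs_le_norm[OF L0D(1)[OF F]])
  finally show ?thesis .
qed

lemma primitive_L2: "F \<in> L0 (\<not> p) \<Longrightarrow> primitive p F \<in> L2 (\<mu> p)"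
  by (rule regular_L2[OF periodic_primitive regular_primitive])

lemma J_mem_C:
  assumes F: "F \<in> L0 (\<not> p)"
  shows "J p F \<in> C p"
proof -
  define c where "c = (\<integral>x. primitive p F x \<partial>\<mu> p) / mass p"
  have J: "J p F = (\<lambda>x. primitive p F x + (- c))"
    by (simp add: fun_eq_iff J_def c_def)
  have "(\<integral>x. primitive p F x + (- c) \<partial>\<mu> p) = (\<integral>x. primitive p F x \<partial>\<mu> p) + mass p * (- c)"
    using \<mu>.L2_integrable[OF primitive_L2[OF F]] by (simp add: mass_def)
  then have "(\<integral>x. J p F x \<partial>\<mu> p) = 0"
    using mass_pos[of p] unfolding J by (simp add: c_def)
  moreover have "regular p (J p F)"
    unfolding J by (intro regular_add regular_const regular_primitive F)
  moreover have "periodic (J p F)"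
    using periodic_primitive[of p F] by (simp add: J periodic_def)
  ultimately show ?thesis by (simp add: C_def)
qed

lemma J_mem_L0: "F \<in> L0 (\<not> p) \<Longrightarrow> J p F \<in> L0 p"
  by (rule C_subset_L0[OF J_mem_C])

lemma J_add:
  assumes F: "F \<in> L0 (\<not> p)" and G: "G \<in> L0 (\<not> p)"
  shows "J p (\<lambda>x. F x + G x) = (\<lambda>x. J p F x + J p G x)"
proof -
  have "primitive p (\<lambda>x. F x + G x) = (\<lambda>x. primitive p F x + primitive p G x)"
    unfolding primitive_def distrib_right
    by (intro ext Bochner_Integration.integral_add \<mu>.L2_indicator_integrable L0D(1) F G seg_borel)
  then show ?thesis
    using \<mu>.L2_integrable[OF primitive_L2[OF F]] \<mu>.L2_integrable[OF primitive_L2[OF G]]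
    by (simp add: J_def fun_eq_iff add_divide_distrib)
qed

lemma J_scale: "J p (\<lambda>x. c * F x) = (\<lambda>x. c * J p F x)"
proof -
  have "primitive p (\<lambda>x. c * F x) = (\<lambda>x. c * primitive p F x)"
    by (simp add: primitive_def fun_eq_iff mult.assoc)
  then show ?thesis
    by (simp add: J_def fun_eq_iff right_diff_distrib)
qed

definition J_bound :: "bool \<Rightarrow> real" where
  "J_bound p = 2 * sqrt (mass (\<not> p))"

lemma J_bound_nonneg: "J_bound p \<ge> 0"
  using mass_pos[of "\<not> p"] by (simp add: J_bound_def)

text \<open>This bound holds at every point, not only in the mean; it is the reason why the inclusions
  between the Sobolev spaces are Hilbert--Schmidt.\<close>

lemma abs_J_le:
  assumes F: "F \<in> L0 (\<not> p)"
  shows "\<bar>J p F x\<bar> \<le> J_bound p * nrm (\<not> p) F"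
proof -
  let ?B = "sqrt (mass (\<not> p)) * nrm (\<not> p) F"
  have "\<bar>\<integral>x. primitive p F x \<partial>\<mu> p\<bar> \<le> (\<integral>x. \<bar>primitive p F x\<bar> \<partial>\<mu> p)"
    by (rule integral_abs_bound)
  also have "\<dots> \<le> (\<integral>x. ?B \<partial>\<mu> p)"
    using abs_primitive_le[OF F] \<mu>.L2_integrable[OF primitive_L2[OF F]] by (intro integral_mono) auto
  finally have "\<bar>(\<integral>x. primitive p F x \<partial>\<mu> p) / mass p\<bar> \<le> ?B"
    using mass_pos[of p] by (simp add: abs_divide pos_divide_le_eq mass_def ac_simps)
  then show ?thesis
    using abs_primitive_le[OF F, of x] unfolding J_def J_bound_def by linarith
qed


section \<open>Partial integration and the fundamental theorem\<close>

text \<open>Integration by parts is Fubini's theorem on the square: the regions \<open>y \<in> seg p x\<close> and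
  \<open>x \<in> seg (\<not> p) y\<close> are complementary, and the integral of \<open>F y * G x\<close> over the square is 0.
  No boundary or jump terms appear because exactly one of the two segments is closed.\<close>

lemma primitive_parts:
  assumes F: "F \<in> L0 (\<not> p)" and G: "G \<in> L0 p"
  shows "(\<integral>x. primitive p F x * G x \<partial>\<mu> p) = - (\<integral>y. F y * primitive (\<not> p) G y \<partial>\<mu> (\<not> p))"
proof -
  interpret pr: pair_sigma_finite "\<mu> p" "\<mu> (\<not> p)" ..
  define h where "h x y = G x * indicator (seg (\<not> p) y) x * F y" for x y
  have [measurable]: "G \<in> borel_measurable (\<mu> p)" "F \<in> borel_measurable (\<mu> (\<not> p))"
    "(\<lambda>x. x) \<in> borel_measurable (\<mu> p)" "(\<lambda>x. x) \<in> borel_measurable (\<mu> (\<not> p))"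
    using \<mu>.L2D(1)[OF L0D(1)[OF F]] \<mu>.L2D(1)[OF L0D(1)[OF G]]
    by (auto intro!: \<mu>.measurable_circle)
  have Fi: "integrable (\<mu> (\<not> p)) F" and Gi: "integrable (\<mu> p) G"
    using \<mu>.L2_integrable L0D(1) F G by auto
  have prod: "integrable (\<mu> p \<Otimes>\<^sub>M \<mu> (\<not> p)) (\<lambda>(x, y). G x * F y)"
  proof (rule pr.Fubini_integrable)
    show "(\<lambda>(x, y). G x * F y) \<in> borel_measurable (\<mu> p \<Otimes>\<^sub>M \<mu> (\<not> p))"
      by measurable
    show "integrable (\<mu> p) (\<lambda>x. \<integral>y. norm (case (x, y) of (x, y) \<Rightarrow> G x * F y) \<partial>\<mu> (\<not> p))"
      using Gi by (simp add: abs_mult)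
    show "AE x in \<mu> p. integrable (\<mu> (\<not> p)) (\<lambda>y. case (x, y) of (x, y) \<Rightarrow> G x * F y)"
      using Fi by simp
  qed
  have h_int: "integrable (\<mu> p \<Otimes>\<^sub>M \<mu> (\<not> p)) (case_prod h)"
  proof (rule Bochner_Integration.integrable_bound[OF prod])
    let ?M = "\<mu> p \<Otimes>\<^sub>M \<mu> (\<not> p)"
    have "(\<lambda>z. if fst z \<le> snd z then 1 else 0 :: real) \<in> borel_measurable ?M"
      and "(\<lambda>z. if fst z < snd z then 1 else 0 :: real) \<in> borel_measurable ?M"
      by measurable
    then have ind: "(\<lambda>z. if (if p then fst z \<le> snd z else fst z < snd z) then 1 else 0 :: real) \<in> borel_measurable ?M"
      by (cases p) simp_all
    have eq: "case_prod h = (\<lambda>z. G (fst z) *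
        (if (if p then fst z \<le> snd z else fst z < snd z) then 1 else 0) * F (snd z))"
      by (auto simp: fun_eq_iff h_def seg_def indicator_def)
    show "case_prod h \<in> borel_measurable ?M"
      unfolding eq by (intro borel_measurable_times ind) measurable
    show "AE z in \<mu> p \<Otimes>\<^sub>M \<mu> (\<not> p). norm (case_prod h z) \<le> norm (case z of (x, y) \<Rightarrow> G x * F y)"
      by (auto simp: h_def indicator_def)
  qed
  have inner_x: "(\<integral>x. h x y \<partial>\<mu> p) = F y * primitive (\<not> p) G y" if "y \<in> space (\<mu> (\<not> p))" for y
    using that by (simp add: h_def primitive_def \<mu>.space_circle mult.commute)
  have inner_y: "(\<integral>y. h x y \<partial>\<mu> (\<not> p)) = - (primitive p F x * G x)" if "x \<in> space (\<mu> p)" for x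
  proof -
    have "(\<integral>y. h x y \<partial>\<mu> (\<not> p)) = (\<integral>y. G x * (F y - F y * indicator (seg p x) y) \<partial>\<mu> (\<not> p))"
      by (rule Bochner_Integration.integral_cong) (auto simp: h_def indicator_def seg_not)
    also have "\<dots> = G x * ((\<integral>y. F y \<partial>\<mu> (\<not> p)) - (\<integral>y. F y * indicator (seg p x) y \<partial>\<mu> (\<not> p)))"
      using Fi \<mu>.L2_indicator_integrable[OF L0D(1)[OF F] seg_borel, of p x] by simp
    also have "\<dots> = - (primitive p F x * G x)"
      using that L0D(2)[OF F] by (simp add: primitive_def \<mu>.space_circle)
    finally show ?thesis .
  qed
  have "(\<integral>y. F y * primitive (\<not> p) G y \<partial>\<mu> (\<not> p)) = (\<integral>y. (\<integral>x. h x y \<partial>\<mu> p) \<partial>\<mu> (\<not> p))"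
    by (rule Bochner_Integration.integral_cong) (simp_all add: inner_x)
  also have "\<dots> = (\<integral>x. (\<integral>y. h x y \<partial>\<mu> (\<not> p)) \<partial>\<mu> p)"
    by (rule pr.Fubini_integral[OF h_int])
  also have "\<dots> = (\<integral>x. - (primitive p F x * G x) \<partial>\<mu> p)"
    by (rule Bochner_Integration.integral_cong) (simp_all add: inner_y)
  finally show ?thesis by simp
qed

lemma integral_J_mult:
  assumes F: "F \<in> L0 (\<not> p)" and G: "G \<in> L0 p"
  shows "l2 (\<mu> p) (J p F) G = (\<integral>x. primitive p F x * G x \<partial>\<mu> p)"
proof -
  define c where "c = (\<integral>x. primitive p F x \<partial>\<mu> p) / mass p"
  have "l2 (\<mu> p) (J p F) G = (\<integral>x. primitive p F x * G x - c * G x \<partial>\<mu> p)"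
    by (simp add: J_def c_def left_diff_distrib)
  also have "\<dots> = (\<integral>x. primitive p F x * G x \<partial>\<mu> p) - c * (\<integral>x. G x \<partial>\<mu> p)"
    using \<mu>.L2_integrable_mult[OF primitive_L2[OF F] L0D(1)[OF G]] \<mu>.L2_integrable[OF L0D(1)[OF G]]
    by simp
  finally show ?thesis using L0D(2)[OF G] by simp
qed

lemma J_parts:
  assumes F: "F \<in> L0 (\<not> p)" and G: "G \<in> L0 p"
  shows "l2 (\<mu> p) (J p F) G = - l2 (\<mu> (\<not> p)) F (J (\<not> p) G)"
proof -
  have "l2 (\<mu> (\<not> p)) (J (\<not> p) G) F = (\<integral>y. primitive (\<not> p) G y * F y \<partial>\<mu> (\<not> p))"
    by (rule integral_J_mult) (use F G in simp_all)
  then show ?thesis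
    using integral_J_mult[OF F G] primitive_parts[OF F G] by (simp add: mult.commute)
qed

text \<open>Every one-sided neighbourhood has positive measure, because \<open>Z\<close> is strictly increasing.\<close>

lemma frequently_side_if_AE:
  assumes ae: "AE y in \<mu> p. P y" and x: "x \<in> base p"
  shows "\<exists>\<^sub>F y in side p x. P y"
proof (rule ccontr)
  assume "\<not> (\<exists>\<^sub>F y in side p x. P y)"
  then have "eventually (\<lambda>y. \<not> P y) (side p x)"
    by (simp add: not_frequently)
  with eventually_side_unit[OF x]
  have "eventually (\<lambda>y. y \<in> {0..1} \<and> \<not> P y) (side p x)"
    by eventually_elim auto
  then obtain d where d: "d > 0"
    "\<And>y. 0 < (if p then x - y else y - x) \<Longrightarrow> \<bar>y - x\<bar> < d \<Longrightarrow> y \<in> {0..1} \<and> \<not> P y"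
    unfolding eventually_side_iff by blast
  define a b where "a = (if p then x - 2 * d / 3 else x + d / 3)"
    and "b = (if p then x - d / 3 else x + 2 * d / 3)"
  have ab: "a < b" using d(1) by (simp add: a_def b_def)
  have in_ab: "y \<in> {0..1} \<and> \<not> P y" if "a \<le> y" "y \<le> b" for y
    using that d(1) by (intro d(2)) (auto simp: a_def b_def split: if_splits)
  let ?A = "{0..<1} \<inter> (seg (\<not> p) b - seg (\<not> p) a)"
  have sub: "?A \<subseteq> {a..b}" by (auto simp: seg_def split: if_splits)
  have "AE y in \<mu> p. y \<notin> ?A"
    using ae by eventually_elim (use in_ab sub in fastforce)
  moreover have "?A \<in> sets (\<mu> p)"
    by (intro circle_sets sets.Diff seg_borel)
  ultimately have "?A \<in> null_sets (\<mu> p)"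
    by (simp add: AE_iff_null_sets)
  then have "measure (\<mu> p) ?A = 0"
    by (simp add: null_sets_def Sigma_Algebra.measure_def)
  moreover have "measure (\<mu> p) ?A = Z (\<not> p) b - Z (\<not> p) a"
    using measure_seg_diff[of a b "\<not> p"] in_ab[of a] in_ab[of b] ab by simp
  ultimately show False
    using Z_less[OF ab, of "\<not> p"] by simp
qed

text \<open>A primitive that is constant almost everywhere is constant everywhere by one-sided continuity,
  so \<open>F\<close> has integral zero over all initial segments.\<close>

lemma J_const_imp_AE_zero:
  assumes F: "F \<in> L0 (\<not> p)" and ae: "AE x in \<mu> p. J p F x = c"
  shows "AE x in \<mu> (\<not> p). F x = 0"
proof -
  define d where "d = c + (\<integral>x. primitive p F x \<partial>\<mu> p) / mass p"
  have ae': "AE x in \<mu> p. primitive p F x = d"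
    using ae by eventually_elim (simp add: J_def d_def algebra_simps)
  have base: "primitive p F x = d" if x: "x \<in> base p" for x
  proof (rule ccontr)
    assume "primitive p F x \<noteq> d"
    moreover have "(primitive p F \<longlongrightarrow> primitive p F x) (side p x)"
      using regular_primitive[OF F] by (simp add: regular_def)
    ultimately have "eventually (\<lambda>y. primitive p F y \<noteq> d) (side p x)"
      using tendsto_imp_eventually_ne by blast
    then show False
      using frequently_side_if_AE[OF ae' x] by (simp add: frequently_def)
  qed
  have all: "primitive p F x = d" for x
  proof -
    obtain k where "x + real_of_int k \<in> base p" using exists_translate_in_base by blast
    then show ?thesis using base periodic_int[OF periodic_primitive, of p F x k] by simp
  qed
  have full: "(\<integral>y. F y * indicator (seg p x) y \<partial>\<mu> (\<not> p)) = 0" if "x \<ge> 1" for x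
  proof -
    have "(\<integral>y. F y * indicator (seg p x) y \<partial>\<mu> (\<not> p)) = (\<integral>y. F y \<partial>\<mu> (\<not> p))"
      using that by (intro Bochner_Integration.integral_cong) (auto simp: \<mu>.space_circle seg_def)
    then show ?thesis using L0D(2)[OF F] by simp
  qed
  have "d = 0"
    using primitive_eq[OF F, of 1] all[of 1] full[of 1] by simp
  have zero: "(\<integral>y. F y * indicator (seg p x) y \<partial>\<mu> (\<not> p)) = 0" for x
  proof (cases "x < 0 \<or> 1 \<le> x")
    case True
    have "(\<integral>y. F y * indicator (seg p x) y \<partial>\<mu> (\<not> p)) = (\<integral>y. 0 \<partial>\<mu> (\<not> p))" if "x < 0"
      using that by (intro Bochner_Integration.integral_cong) (auto simp: \<mu>.space_circle seg_def)
    then show ?thesis using True full by auto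
  next
    case False
    then show ?thesis
      using primitive_eq[OF F, of x] all[of x] \<open>d = 0\<close> by simp
  qed
  show ?thesis
    by (rule \<mu>.AE_zero_if_seg_integrals_zero[OF \<mu>.L2_integrable[OF L0D(1)[OF F]] L0D(2)[OF F] zero])
qed

lemma function_subspace_L0: "function_subspace (L0 p)"
  unfolding function_subspace_def
proof (intro conjI ballI allI)
  show "(\<lambda>x. 0) \<in> L0 p"
    by (simp add: L0_def \<mu>.L2_const)
  show "(\<lambda>x. f x + g x) \<in> L0 p" if "f \<in> L0 p" "g \<in> L0 p" for f g
    using L0D[OF that(1)] L0D[OF that(2)] by (simp add: L0_def \<mu>.L2.add_mem \<mu>.L2_integrable)
  show "(\<lambda>x. c * f x) \<in> L0 p" if "f \<in> L0 p" for c f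
    using L0D[OF that] by (simp add: L0_def \<mu>.L2.scale_mem)
qed

lemma semi_inner_product_L0: "semi_inner_product (L0 p) (l2 (\<mu> p))"
  using \<mu>.semi_inner_product_L2[of p] L0D(1)[of _ p] unfolding semi_inner_product_def by blast

sublocale L0: semi_inner_space "L0 p" "l2 (\<mu> p)" for p
  by unfold_locales (rule function_subspace_L0, rule semi_inner_product_L0)

lemma hilbert_space_L0: "hilbert_space (L0 p) (l2 (\<mu> p))"
proof -
  let ?d = "form_dist (l2 (\<mu> p))"
  have "\<exists>f\<in>L0 p. (\<lambda>i. ?d (s i) f) \<longlonglongrightarrow> 0"
    if s: "range s \<subseteq> L0 p" and cau: "\<forall>\<epsilon>>0. \<exists>N. \<forall>i\<ge>N. \<forall>j\<ge>N. ?d (s i) (s j) < \<epsilon>" for s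
  proof -
    have sL: "s i \<in> L2 (\<mu> p)" "(\<integral>x. s i x \<partial>\<mu> p) = 0" for i
      using s L0D[of "s i" p] by auto
    then have "range s \<subseteq> L2 (\<mu> p)" by blast
    then obtain f where f: "f \<in> L2 (\<mu> p)" and lim: "(\<lambda>i. ?d (s i) f) \<longlonglongrightarrow> 0"
      using \<mu>.hilbert_space_L2[of p] cau unfolding hilbert_space_def by blast
    have "\<bar>\<integral>x. f x \<partial>\<mu> p\<bar> \<le> sqrt (measure (\<mu> p) (space (\<mu> p))) * ?d (s i) f" for i
    proof -
      have "\<bar>\<integral>x. s i x - f x \<partial>\<mu> p\<bar> \<le> sqrt (measure (\<mu> p) (space (\<mu> p))) * ?d (s i) f"
        unfolding form_dist_def by (intro \<mu>.abs_integral_le_norm \<mu>.L2.diff_mem sL f)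
      then show ?thesis
        using sL f by (simp add: \<mu>.L2_integrable)
    qed
    moreover have "(\<lambda>i. sqrt (measure (\<mu> p) (space (\<mu> p))) * ?d (s i) f) \<longlonglongrightarrow>
        sqrt (measure (\<mu> p) (space (\<mu> p))) * 0"
      by (intro tendsto_mult_left lim)
    ultimately have "\<bar>\<integral>x. f x \<partial>\<mu> p\<bar> \<le> sqrt (measure (\<mu> p) (space (\<mu> p))) * 0"
      by (intro LIMSEQ_le_const) auto
    then have "f \<in> L0 p" using f by (simp add: L0_def)
    then show ?thesis using lim by blast
  qed
  then show ?thesis
    unfolding hilbert_space_def using function_subspace_L0 semi_inner_product_L0 by blast
qed

lemma J_diff:
  assumes F: "F \<in> L0 (\<not> p)" and G: "G \<in> L0 (\<not> p)"
  shows "J p (\<lambda>x. F x - G x) = (\<lambda>x. J p F x - J p G x)"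
  using J_add[OF F L0.scale_mem[OF G, of "- 1"]] J_scale[of p "- 1" G] by simp

lemma J_cong_AE:
  assumes F: "F \<in> L0 (\<not> p)" and G: "G \<in> L0 (\<not> p)" and ae: "AE x in \<mu> (\<not> p). F x = G x"
  shows "J p F = J p G"
proof
  fix x
  have D: "(\<lambda>x. F x - G x) \<in> L0 (\<not> p)" by (rule L0.diff_mem[OF F G])
  have "AE x in \<mu> (\<not> p). F x - G x = 0"
    using ae by eventually_elim simp
  then have "nrm (\<not> p) (\<lambda>x. F x - G x) = 0"
    using \<mu>.form_norm_eq_0_iff[OF L0D(1)[OF D]] by simp
  then show "J p F x = J p G x"
    using abs_J_le[OF D, of x] unfolding J_diff[OF F G] by simp
qed

text \<open>One bound for the operator norms of both \<open>J False\<close> and \<open>J True\<close>; it is at least 1 so that its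
  powers increase.\<close>

definition J_norm :: real where
  "J_norm = 1 + sqrt (mass False) * J_bound False + sqrt (mass True) * J_bound True"

lemma J_norm_ge_1: "J_norm \<ge> 1"
  using mass_pos J_bound_nonneg by (simp add: J_norm_def less_imp_le)

lemma nrm_J_le:
  assumes F: "F \<in> L0 (\<not> p)"
  shows "nrm p (J p F) \<le> J_norm * nrm (\<not> p) F"
proof -
  have "nrm p (J p F) \<le> sqrt (mass p) * (J_bound p * nrm (\<not> p) F)"
    unfolding mass_def
    by (rule \<mu>.form_norm_le_bound[OF \<mu>.L2D(1)[OF L0D(1)[OF J_mem_L0[OF F]]] abs_J_le[OF F]])
  also have "\<dots> = (sqrt (mass p) * J_bound p) * nrm (\<not> p) F" by simp
  also have "\<dots> \<le> J_norm * nrm (\<not> p) F"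
  proof (rule mult_right_mono)
    have "0 \<le> sqrt (mass q) * J_bound q" for q
      using mass_pos[of q] J_bound_nonneg[of q] by simp
    from this[of False] this[of True] show "sqrt (mass p) * J_bound p \<le> J_norm"
      unfolding J_norm_def by (cases p) simp_all
  qed (rule L0.form_norm_nonneg[OF F])
  finally show ?thesis .
qed

abbreviation D :: "bool \<Rightarrow> (real \<Rightarrow> real) \<Rightarrow> (real \<Rightarrow> real) \<Rightarrow> bool" where
  "D p \<equiv> one_sided_deriv p (Z p)"

text \<open>The difference quotient of a primitive
  at \<open>z\<close> averages \<open>F\<close> over a segment ending at \<open>z\<close>, and \<open>F\<close> is continuous at \<open>z\<close> from the side of
  this segment; if \<open>Z p\<close> jumps at \<open>z\<close>, the average concentrates at \<open>z\<close> itself, which belongs to the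
  segment.\<close>

lemma D_J:
  assumes F: "F \<in> C (\<not> p)"
  shows "D p (J p F) F"
  unfolding one_sided_deriv_def
proof
  fix x
  let ?I = "primitive p F"
  have F0: "F \<in> L0 (\<not> p)" by (rule C_subset_L0[OF F])
  obtain k where k: "x + real_of_int k \<in> base (\<not> p)" using exists_translate_in_base by blast
  define z where "z = x + real_of_int k"
  have z: "z \<in> base (\<not> p)" using k by (simp add: z_def)
  have z01: "0 \<le> z" "z \<le> 1" using base_subset[OF z] by auto
  have "((\<lambda>y. (?I y - ?I z) / (Z p y - Z p z)) \<longlongrightarrow> F z) (side (\<not> p) z)"
  proof (rule tendstoI)
    fix e :: real assume e: "e > 0"
    have "(F \<longlongrightarrow> F z) (side (\<not> p) z)"
      using F by (simp add: C_def regular_def)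
    from tendstoD[OF this, of "e / 2"] e
    have "eventually (\<lambda>y. \<bar>F y - F z\<bar> < e / 2) (side (\<not> p) z)"
      by (simp add: dist_real_def)
    then obtain d where d: "d > 0"
      "\<And>y. 0 < (if \<not> p then z - y else y - z) \<Longrightarrow> \<bar>y - z\<bar> < d \<Longrightarrow> \<bar>F y - F z\<bar> < e / 2"
      unfolding eventually_side_iff by blast
    have "eventually (\<lambda>y. \<bar>y - z\<bar> < d) (side (\<not> p) z)"
      unfolding eventually_side_iff using d(1) by blast
    with eventually_side_unit[OF z]
    show "eventually (\<lambda>y. dist ((?I y - ?I z) / (Z p y - Z p z)) (F z) < e) (side (\<not> p) z)"
    proof eventually_elim
      case (elim y)
      define a b where "a = min y z" and "b = max y z"
      have ab: "0 \<le> a" "a \<le> b" "b \<le> 1" "a < b"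
        using elim z01 by (auto simp: a_def b_def split: if_splits)
      have near: "\<bar>F w - F z\<bar> \<le> e / 2" if w: "w \<in> seg p b - seg p a" for w
      proof (cases "w = z")
        case False
        have "0 < (if \<not> p then z - w else w - z)" "\<bar>w - z\<bar> < d"
          using w elim False by (auto simp: seg_def a_def b_def split: if_splits)
        from d(2)[OF this] show ?thesis by simp
      qed (use e in simp)
      have "\<bar>?I b - ?I a - F z * (Z p b - Z p a)\<bar> \<le> e / 2 * (Z p b - Z p a)"
        by (rule primitive_increment[OF F0 ab(1-3) near])
      moreover have pos: "Z p b - Z p a > 0" using Z_less[OF ab(4), of p] by simp
      moreover have "(?I y - ?I z) / (Z p y - Z p z) = (?I b - ?I a) / (Z p b - Z p a)"
      proof (cases "y \<le> z")
        case True
        have neg: "(- u) / (- v) = u / v" for u v :: real by simp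
        have "(?I y - ?I z) / (Z p y - Z p z) = (- (?I z - ?I y)) / (- (Z p z - Z p y))" by simp
        also have "\<dots> = (?I z - ?I y) / (Z p z - Z p y)" by (rule neg)
        finally show ?thesis using True by (simp add: a_def b_def)
      qed (simp add: a_def b_def)
      moreover have "(?I b - ?I a) / (Z p b - Z p a) - F z =
          (?I b - ?I a - F z * (Z p b - Z p a)) / (Z p b - Z p a)"
        using pos by (simp add: diff_divide_distrib)
      ultimately have "dist ((?I y - ?I z) / (Z p y - Z p z)) (F z) \<le> e / 2"
        by (simp add: dist_real_def abs_divide pos_divide_le_eq)
      then show ?case using e by simp
    qed
  qed
  then have "((\<lambda>h. (?I (z + h) - ?I z) / (Z p (z + h) - Z p z)) \<longlongrightarrow> F z) (side (\<not> p) 0)"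
    unfolding filterlim_def side_eq_shift[of "\<not> p" z] filtermap_filtermap .
  moreover have "?I (z + h) = ?I (x + h)" "Z p (z + h) - Z p z = Z p (x + h) - Z p x" for h
  proof -
    have eq: "z + h = (x + h) + of_int k" by (simp add: z_def)
    show "?I (z + h) = ?I (x + h)"
      unfolding eq by (rule periodic_int[OF periodic_primitive])
    show "Z p (z + h) - Z p z = Z p (x + h) - Z p x"
      unfolding eq unfolding z_def Z_int by simp
  qed
  moreover have "?I z = ?I x" "F z = F x"
    unfolding z_def using periodic_int[OF periodic_primitive] periodic_int[of F x k] F
    by (auto simp: C_def)
  ultimately show "((\<lambda>h. (J p F (x + h) - J p F x) / (Z p (x + h) - Z p x)) \<longlongrightarrow> F x) (side (\<not> p) 0)"
    by (simp add: J_def)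
qed

text \<open>By the mean value theorem, \<open>f - J p F\<close> is constant, and both terms have mean zero.\<close>

lemma D_imp_eq_J:
  assumes f: "f \<in> C p" and F: "F \<in> C (\<not> p)" and d: "D p f F"
  shows "f = J p F"
proof -
  define g where "g x = f x + - 1 * J p F x" for x
  have JC: "J p F \<in> C p" by (rule J_mem_C[OF C_subset_L0[OF F]])
  have gC: "g \<in> C p"
    unfolding g_def[abs_def] by (intro C_add C_scale f JC)
  have "D p g (\<lambda>x. F x + - 1 * F x)"
    unfolding g_def[abs_def] by (intro one_sided_deriv_add one_sided_deriv_scale d D_J F)
  then have D0: "D p g (\<lambda>x. 0)" by simp
  have const: "g x = g 0" for x
    by (rule one_sided_deriv_zero_imp_const[OF D0 _ regular_Z strict_mono_Z])
       (use gC in \<open>simp add: C_def\<close>)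
  have "(\<integral>x. g x \<partial>\<mu> p) = (\<integral>x. g 0 \<partial>\<mu> p)"
    by (rule Bochner_Integration.integral_cong) (rule refl, rule const)
  then have "g 0 * mass p = 0"
    using gC by (simp add: C_def mass_def mult.commute)
  then have "g 0 = 0" using mass_pos[of p] by simp
  show ?thesis
  proof
    fix x
    show "f x = J p F x" using const[of x] \<open>g 0 = 0\<close> by (simp add: g_def)
  qed
qed


section \<open>Smooth functions and their density\<close>

text \<open>The level reached from \<open>p\<close> after \<open>n\<close> derivatives. Starting from \<open>False\<close>, the level of
  the \<open>n\<close>-th derivative is \<open>odd n\<close>.\<close>

definition lev :: "bool \<Rightarrow> nat \<Rightarrow> bool" where
  "lev p n = (p \<noteq> odd n)"

lemma lev_simps [simp]: "lev p 0 = p" "lev p (Suc n) = (\<not> lev p n)" "lev (\<not> p) n = (\<not> lev p n)"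
  "lev False n = odd n"
  by (auto simp: lev_def)

lemma lev_add: "lev (lev p m) n = lev p (m + n)"
  by (auto simp: lev_def)

text \<open>The smooth functions of mean zero, described through primitives instead of derivatives;
  \<open>\<phi> n\<close> is the \<open>n\<close>-th derivative. The equivalence with the definition through one-sided
  derivatives is \<open>smooth_functions_eq_smooth\<close>.\<close>

definition S0 :: "bool \<Rightarrow> (real \<Rightarrow> real) set" where
  "S0 p = {f. \<exists>\<phi>. \<phi> 0 = f \<and> (\<forall>n. \<phi> n \<in> C (lev p n) \<and> \<phi> n = J (lev p n) (\<phi> (Suc n)))}"

definition smooth :: "bool \<Rightarrow> (real \<Rightarrow> real) set" where
  "smooth p = {f. \<exists>c. \<exists>f\<^sub>0\<in>S0 p. f = (\<lambda>x. c + f\<^sub>0 x)}"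

lemma S0_subset_C:
  assumes "f \<in> S0 p"
  shows "f \<in> C p"
proof -
  obtain \<phi> where "\<phi> 0 = f" and \<phi>: "\<And>n. \<phi> n \<in> C (lev p n)"
    using assms unfolding S0_def by blast
  then show ?thesis using \<phi>[of 0] by simp
qed

lemma S0_subset_L0: "f \<in> S0 p \<Longrightarrow> f \<in> L0 p"
  by (rule C_subset_L0[OF S0_subset_C])

lemma S0_cases:
  assumes "f \<in> S0 p"
  obtains F where "F \<in> S0 (\<not> p)" "f = J p F"
proof -
  obtain \<phi> where \<phi>: "\<phi> 0 = f" "\<And>n. \<phi> n \<in> C (lev p n)" "\<And>n. \<phi> n = J (lev p n) (\<phi> (Suc n))"
    using assms unfolding S0_def by blast
  have "\<phi> 1 \<in> S0 (\<not> p)"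
    unfolding S0_def
  proof (intro CollectI exI[of _ "\<lambda>n. \<phi> (Suc n)"] conjI allI)
    fix n
    show "\<phi> (Suc n) \<in> C (lev (\<not> p) n)" using \<phi>(2)[of "Suc n"] by simp
    show "\<phi> (Suc n) = J (lev (\<not> p) n) (\<phi> (Suc (Suc n)))" using \<phi>(3)[of "Suc n"] by simp
  qed simp
  moreover have "f = J p (\<phi> 1)" using \<phi>(1) \<phi>(3)[of 0] by simp
  ultimately show ?thesis by (rule that)
qed

lemma S0_J:
  assumes "F \<in> S0 (\<not> p)"
  shows "J p F \<in> S0 p"
proof -
  obtain \<phi> where \<phi>: "\<phi> 0 = F" "\<And>n. \<phi> n \<in> C (lev (\<not> p) n)"
    "\<And>n. \<phi> n = J (lev (\<not> p) n) (\<phi> (Suc n))"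
    using assms unfolding S0_def by blast
  define \<psi> where "\<psi> = case_nat (J p F) \<phi>"
  have "\<psi> n \<in> C (lev p n) \<and> \<psi> n = J (lev p n) (\<psi> (Suc n))" for n
  proof (cases n)
    case 0
    then show ?thesis
      using J_mem_C[OF S0_subset_L0[OF assms]] \<phi>(1) by (simp add: \<psi>_def)
  next
    case (Suc m)
    then show ?thesis
      using \<phi>(2)[of m] \<phi>(3)[of m] by (simp add: \<psi>_def)
  qed
  moreover have "\<psi> 0 = J p F" by (simp add: \<psi>_def)
  ultimately show ?thesis unfolding S0_def by blast
qed

lemma S0_deriv:
  assumes f: "f \<in> S0 p" and d: "D p f F"
  shows "F \<in> S0 (\<not> p)" "f = J p F"
proof -
  obtain F' where F': "F' \<in> S0 (\<not> p)" "f = J p F'" using S0_cases[OF f] .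
  have "D p f F'" unfolding F'(2) by (rule D_J[OF S0_subset_C[OF F'(1)]])
  then have "F = F'" using d one_sided_deriv_unique by blast
  then show "F \<in> S0 (\<not> p)" "f = J p F" using F' by simp_all
qed

lemma function_subspace_S0: "function_subspace (S0 p)"
  unfolding function_subspace_def
proof (intro conjI ballI allI)
  have J0: "J q (\<lambda>x. 0) = (\<lambda>x. 0)" for q
    using J_scale[of q 0 "\<lambda>x. 0"] by simp
  show "(\<lambda>x. 0) \<in> S0 p"
    unfolding S0_def by (intro CollectI exI[of _ "\<lambda>n x. 0"]) (simp add: J0 C_zero)
  show "(\<lambda>x. f x + g x) \<in> S0 p" if "f \<in> S0 p" "g \<in> S0 p" for f g
  proof -
    obtain \<phi> where \<phi>: "\<phi> 0 = f" "\<And>n. \<phi> n \<in> C (lev p n)" "\<And>n. \<phi> n = J (lev p n) (\<phi> (Suc n))"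
      using \<open>f \<in> S0 p\<close> unfolding S0_def by blast
    obtain \<psi> where \<psi>: "\<psi> 0 = g" "\<And>n. \<psi> n \<in> C (lev p n)" "\<And>n. \<psi> n = J (lev p n) (\<psi> (Suc n))"
      using \<open>g \<in> S0 p\<close> unfolding S0_def by blast
    have eq: "(\<lambda>x. \<phi> n x + \<psi> n x) = J (lev p n) (\<lambda>x. \<phi> (Suc n) x + \<psi> (Suc n) x)" for n
    proof -
      have "\<phi> (Suc n) \<in> L0 (\<not> lev p n)" "\<psi> (Suc n) \<in> L0 (\<not> lev p n)"
        using C_subset_L0[OF \<phi>(2)[of "Suc n"]] C_subset_L0[OF \<psi>(2)[of "Suc n"]] by simp_all
      from J_add[OF this] show ?thesis
        unfolding \<phi>(3)[of n, symmetric] \<psi>(3)[of n, symmetric] by simp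
    qed
    show ?thesis
      unfolding S0_def
    proof (intro CollectI exI[of _ "\<lambda>n x. \<phi> n x + \<psi> n x"] conjI allI)
      show "(\<lambda>x. \<phi> 0 x + \<psi> 0 x) = (\<lambda>x. f x + g x)" by (simp add: \<phi>(1) \<psi>(1))
    qed (rule C_add[OF \<phi>(2) \<psi>(2)], rule eq)
  qed
  show "(\<lambda>x. c * f x) \<in> S0 p" if "f \<in> S0 p" for c f
  proof -
    obtain \<phi> where \<phi>: "\<phi> 0 = f" "\<And>n. \<phi> n \<in> C (lev p n)" "\<And>n. \<phi> n = J (lev p n) (\<phi> (Suc n))"
      using \<open>f \<in> S0 p\<close> unfolding S0_def by blast
    have eq: "(\<lambda>x. c * \<phi> n x) = J (lev p n) (\<lambda>x. c * \<phi> (Suc n) x)" for n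
      unfolding J_scale \<phi>(3)[of n, symmetric] ..
    show ?thesis
      unfolding S0_def
    proof (intro CollectI exI[of _ "\<lambda>n x. c * \<phi> n x"] conjI allI)
      show "(\<lambda>x. c * \<phi> 0 x) = (\<lambda>x. c * f x)" by (simp add: \<phi>(1))
    qed (rule C_scale[OF \<phi>(2)], rule eq)
  qed
qed

lemma function_subspace_smooth: "function_subspace (smooth p)"
proof -
  have S0: "(\<lambda>x. 0) \<in> S0 p" "\<And>f g. f \<in> S0 p \<Longrightarrow> g \<in> S0 p \<Longrightarrow> (\<lambda>x. f x + g x) \<in> S0 p"
    "\<And>c f. f \<in> S0 p \<Longrightarrow> (\<lambda>x. c * f x) \<in> S0 p"
    using function_subspace_S0[of p] by (auto simp: function_subspace_def)
  show ?thesis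
    unfolding function_subspace_def
  proof (intro conjI ballI allI)
    show "(\<lambda>x. 0) \<in> smooth p"
      unfolding smooth_def using S0(1) by (intro CollectI exI[of _ 0] bexI[of _ "\<lambda>x. 0"]) auto
    show "(\<lambda>x. f x + g x) \<in> smooth p" if fg: "f \<in> smooth p" "g \<in> smooth p" for f g
    proof -
      obtain c f\<^sub>0 d g\<^sub>0 where "f\<^sub>0 \<in> S0 p" "f = (\<lambda>x. c + f\<^sub>0 x)" "g\<^sub>0 \<in> S0 p" "g = (\<lambda>x. d + g\<^sub>0 x)"
        using fg unfolding smooth_def by blast
      then show ?thesis
        unfolding smooth_def using S0(2)[of f\<^sub>0 g\<^sub>0]
        by (intro CollectI exI[of _ "c + d"] bexI[of _ "\<lambda>x. f\<^sub>0 x + g\<^sub>0 x"]) (auto simp: fun_eq_iff)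
    qed
    show "(\<lambda>x. a * f x) \<in> smooth p" if f: "f \<in> smooth p" for a f
    proof -
      obtain c f\<^sub>0 where "f\<^sub>0 \<in> S0 p" "f = (\<lambda>x. c + f\<^sub>0 x)"
        using f unfolding smooth_def by blast
      then show ?thesis
        unfolding smooth_def using S0(3)[of f\<^sub>0 a]
        by (intro CollectI exI[of _ "a * c"] bexI[of _ "\<lambda>x. a * f\<^sub>0 x"]) (auto simp: distrib_left)
    qed
  qed
qed

lemma smooth_L2: "f \<in> smooth p \<Longrightarrow> f \<in> L2 (\<mu> p)"
  unfolding smooth_def using \<mu>.L2.add_mem[OF \<mu>.L2_const L0D(1)[OF S0_subset_L0]] by auto

text \<open>One-sided derivatives are unique, so the derivatives of different orders form a single
  sequence, and by the fundamental theorem each of them is the primitive of the next.\<close>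

lemma smooth_functions_eq_smooth:
  "smooth_functions (C p) (C (\<not> p)) (D p) (D (\<not> p)) = smooth p"
proof -
  let ?alt = "alt_deriv (D p) (D (\<not> p))"
  have C_lev: "(if odd n then C (\<not> p) else C p) = C (lev p n)" for n
    by (cases "odd n") (auto simp: lev_def)
  have alt_Suc: "?alt (Suc n) f F \<longleftrightarrow> (\<exists>G. ?alt n f G \<and> D (lev p n) G F)" for n f F
    by (cases "odd n") (auto simp: lev_def)
  have uniq: "?alt n f F \<Longrightarrow> ?alt n f G \<Longrightarrow> F = G" for n f F G
    by (rule alt_deriv_unique[of "D p" "D (\<not> p)"]) (auto dest: one_sided_deriv_unique)
  have "(f \<in> C p \<and> (\<forall>n\<ge>1. \<exists>F. ?alt n f F \<and> F \<in> C (lev p n))) \<longleftrightarrow> f \<in> S0 p" for f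
  proof
    assume f: "f \<in> C p \<and> (\<forall>n\<ge>1. \<exists>F. ?alt n f F \<and> F \<in> C (lev p n))"
    have "\<exists>F. ?alt n f F \<and> F \<in> C (lev p n)" for n
    proof (cases "n = 0")
      case False
      then show ?thesis using f by (simp del: alt_deriv.simps)
    qed (use f in simp)
    then obtain \<phi> where \<phi>: "\<And>n. ?alt n f (\<phi> n)" "\<And>n. \<phi> n \<in> C (lev p n)" by metis
    have "\<phi> n = J (lev p n) (\<phi> (Suc n))" for n
    proof -
      obtain G where G: "?alt n f G" "D (lev p n) G (\<phi> (Suc n))"
        using \<phi>(1)[of "Suc n"] unfolding alt_Suc by blast
      have "G = \<phi> n" using uniq[OF G(1) \<phi>(1)] .
      then show ?thesis
        using D_imp_eq_J[OF \<phi>(2)[of n], of "\<phi> (Suc n)"] G(2) \<phi>(2)[of "Suc n"] by simp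
    qed
    moreover have "\<phi> 0 = f" using \<phi>(1)[of 0] by simp
    ultimately show "f \<in> S0 p" unfolding S0_def using \<phi>(2) by blast
  next
    assume fS: "f \<in> S0 p"
    then obtain \<phi> where \<phi>: "\<phi> 0 = f" "\<And>n. \<phi> n \<in> C (lev p n)"
      "\<And>n. \<phi> n = J (lev p n) (\<phi> (Suc n))"
      unfolding S0_def by blast
    have "?alt n f (\<phi> n)" for n
    proof (induction n)
      case (Suc n)
      have "D (lev p n) (J (lev p n) (\<phi> (Suc n))) (\<phi> (Suc n))"
        using \<phi>(2)[of "Suc n"] by (intro D_J) simp
      then show ?case
        unfolding alt_Suc using Suc \<phi>(3)[of n] by auto
    qed (simp add: \<phi>(1))
    then show "f \<in> C p \<and> (\<forall>n\<ge>1. \<exists>F. ?alt n f F \<and> F \<in> C (lev p n))"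
      using \<phi>(2) S0_subset_C[OF fS] by blast
  qed
  then show ?thesis
    unfolding smooth_functions_def smooth_def C_lev by blast
qed

lemma Cinf_eq_smooth: "Cinf_WV W V = smooth False" "Cinf_VW W V = smooth True"
proof -
  have C: "C0 V = C False" "C1 W = C True"
    by (simp_all add: C0_def C1_def C_def \<mu>_def cadlag_eq_regular caglad_eq_regular)
  have D: "strong_DW W = D False" "strong_DV V = D True"
    by (simp_all add: strong_DW_eq strong_DV_eq Z_def)
  show "Cinf_WV W V = smooth False" "Cinf_VW W V = smooth True"
    using smooth_functions_eq_smooth[of False] smooth_functions_eq_smooth[of True]
    by (simp_all add: Cinf_WV_def Cinf_VW_def C D)
qed

text \<open>The orthogonal complement of the range of \<open>J p\<close> is, by partial integration, the kernel of the
  injective operator \<open>J (\<not> p)\<close>.\<close>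

lemma J_range_dense:
  assumes f: "f \<in> L0 p" and e: "e > 0"
  shows "\<exists>F\<in>L0 (\<not> p). form_dist (l2 (\<mu> p)) f (J p F) < e"
proof (rule ccontr)
  assume "\<not> ?thesis"
  then have far: "e \<le> form_dist (l2 (\<mu> p)) f g" if "g \<in> J p ` L0 (\<not> p)" for g
    using that by force
  have sub: "function_subspace (J p ` L0 (\<not> p))"
    unfolding function_subspace_def
  proof (intro conjI ballI allI)
    have "(\<lambda>x. 0) = J p (\<lambda>x. 0)"
      using J_scale[of p 0 "\<lambda>x. 0"] by simp
    then show "(\<lambda>x. 0) \<in> J p ` L0 (\<not> p)"
      using L0.zero_mem[of "\<not> p"] by (rule image_eqI)
    show "(\<lambda>x. g x + h x) \<in> J p ` L0 (\<not> p)" if gh: "g \<in> J p ` L0 (\<not> p)" "h \<in> J p ` L0 (\<not> p)" for g h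
    proof -
      obtain G H where GH: "G \<in> L0 (\<not> p)" "g = J p G" "H \<in> L0 (\<not> p)" "h = J p H" using gh by blast
      show ?thesis
        using J_add[OF GH(1,3)] L0.add_mem[OF GH(1,3)] unfolding GH(2,4) by (intro image_eqI) (rule sym)
    qed
    show "(\<lambda>x. c * g x) \<in> J p ` L0 (\<not> p)" if g: "g \<in> J p ` L0 (\<not> p)" for c g
    proof -
      obtain G where G: "G \<in> L0 (\<not> p)" "g = J p G" using g by blast
      show ?thesis
        using J_scale[of p c G] L0.scale_mem[OF G(1), of c] unfolding G(2) by (intro image_eqI) (rule sym)
    qed
  qed
  have "J p ` L0 (\<not> p) \<subseteq> L0 p" using J_mem_L0 by blast
  then obtain u where u: "u \<in> L0 p" "l2 (\<mu> p) u u = 1" "\<And>F. F \<in> L0 (\<not> p) \<Longrightarrow> l2 (\<mu> p) u (J p F) = 0"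
    using exists_unit_orthogonal[OF hilbert_space_L0 sub _ f e far] by blast
  define v where "v = J (\<not> p) u"
  have v: "v \<in> L0 (\<not> p)"
    unfolding v_def by (rule J_mem_L0) (simp add: u(1))
  have "l2 (\<mu> (\<not> p)) v v = - l2 (\<mu> p) (J p v) u"
    using J_parts[OF v u(1)] by (simp add: v_def)
  also have "\<dots> = 0"
    using u(3)[OF v] L0.ip_commute[OF u(1) J_mem_L0[OF v]] by simp
  finally have "AE x in \<mu> (\<not> p). v x = 0"
    using \<mu>.form_norm_eq_0_iff[OF L0D(1)[OF v]] by (simp add: form_norm_def)
  then have "AE x in \<mu> (\<not> \<not> p). u x = 0"
    using u(1) unfolding v_def by (intro J_const_imp_AE_zero) simp_all
  then have "AE x in \<mu> p. u x = 0"
    by (simp only: not_not)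
  then have "nrm p u = 0"
    using \<mu>.form_norm_eq_0_iff[OF L0D(1)[OF u(1)]] by simp
  then show False using u(2) by (simp add: form_norm_def)
qed

text \<open>Iterated integration: \<open>JL q m F\<close> has level \<open>q\<close> if \<open>F\<close> has level \<open>lev q m\<close>.\<close>

primrec JL :: "bool \<Rightarrow> nat \<Rightarrow> (real \<Rightarrow> real) \<Rightarrow> real \<Rightarrow> real" where
  "JL q 0 F = F"
| "JL q (Suc m) F = J q (JL (\<not> q) m F)"

lemma JL_mem_L0: "F \<in> L0 (lev q m) \<Longrightarrow> JL q m F \<in> L0 q"
proof (induction m arbitrary: q)
  case (Suc m)
  have "JL (\<not> q) m F \<in> L0 (\<not> q)" by (rule Suc.IH) (use Suc.prems in simp)
  then show ?case by (simp add: J_mem_L0)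
qed simp

lemma JL_diff:
  "F \<in> L0 (lev q m) \<Longrightarrow> G \<in> L0 (lev q m) \<Longrightarrow> JL q m (\<lambda>x. F x - G x) = (\<lambda>x. JL q m F x - JL q m G x)"
proof (induction m arbitrary: q)
  case (Suc m)
  have FG: "F \<in> L0 (lev (\<not> q) m)" "G \<in> L0 (lev (\<not> q) m)" using Suc.prems by simp_all
  show ?case
    using J_diff[OF JL_mem_L0[OF FG(1)] JL_mem_L0[OF FG(2)]] Suc.IH[OF FG] by simp
qed simp

lemma nrm_JL_le: "F \<in> L0 (lev q m) \<Longrightarrow> nrm q (JL q m F) \<le> J_norm ^ m * nrm (lev q m) F"
proof (induction m arbitrary: q)
  case (Suc m)
  have F: "F \<in> L0 (lev (\<not> q) m)" using Suc.prems by simp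
  have "nrm q (JL q (Suc m) F) \<le> J_norm * nrm (\<not> q) (JL (\<not> q) m F)"
    using nrm_J_le[OF JL_mem_L0[OF F]] by simp
  also have "\<dots> \<le> J_norm * (J_norm ^ m * nrm (lev (\<not> q) m) F)"
    using Suc.IH[OF F] J_norm_ge_1 by (intro mult_left_mono) auto
  finally show ?case by simp
qed simp

lemma JL_Suc_right: "JL q (Suc m) F = JL q m (J (lev q m) F)"
proof (induction m arbitrary: q)
  case (Suc m)
  show ?case using Suc.IH[of "\<not> q"] by simp
qed simp

lemma JL_add: "JL q (m + n) F = JL q m (JL (lev q m) n F)"
  by (induction m arbitrary: q) auto

lemma S0_JL: "F \<in> S0 (lev q m) \<Longrightarrow> JL q m F \<in> S0 q"
  by (induction m arbitrary: q) (auto intro: S0_J)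

lemma S0_unroll: "f \<in> S0 q \<Longrightarrow> \<exists>F\<in>S0 (lev q m). f = JL q m F"
proof (induction m arbitrary: f q)
  case (Suc m)
  obtain F where F: "F \<in> S0 (\<not> q)" "f = J q F" using S0_cases[OF Suc.prems] .
  obtain G where "G \<in> S0 (lev (\<not> q) m)" "F = JL (\<not> q) m G" using Suc.IH[OF F(1)] by blast
  then show ?case using F(2) by auto
qed auto

text \<open>Density of the ranges at every level passes to the functions that are infinitely often in the
  range, by the Mittag-Leffler argument: \<open>a\<close> is built by successive approximation, each
  error being so small that it is still summable after any number of integrations, so that the
  sequences \<open>JL _ j (a (k + j))\<close> converge as \<open>j\<close> grows, compatibly in \<open>k\<close>.\<close>

lemma S0_dense:
  assumes f: "f \<in> L0 p" and e: "e > 0"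
  shows "\<exists>g\<in>S0 p. form_dist (l2 (\<mu> p)) f g < e"
proof -
  let ?d = "\<lambda>q. form_dist (l2 (\<mu> q))"
  have B0: "J_norm > 0" using J_norm_ge_1 by simp
  \<comment> \<open>an error at level \<open>n\<close> grows by at most \<open>J_norm ^ n\<close> on its way down to level 0\<close>
  define \<delta> where "\<delta> n = e / 4 / (2 * J_norm) ^ n" for n :: nat
  have \<delta>: "\<delta> n > 0" for n using e B0 by (simp add: \<delta>_def)
  have "\<exists>a. \<forall>n. (a n \<in> L0 (lev p n) \<and> (n = 0 \<longrightarrow> a n = f)) \<and>
      ?d (lev p n) (a n) (J (lev p n) (a (Suc n))) < \<delta> n"
  proof (rule dependent_nat_choice)
    show "\<exists>x. x \<in> L0 (lev p 0) \<and> (0 = (0::nat) \<longrightarrow> x = f)" using f by simp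
    show "\<exists>y. (y \<in> L0 (lev p (Suc n)) \<and> (Suc n = 0 \<longrightarrow> y = f)) \<and> ?d (lev p n) x (J (lev p n) y) < \<delta> n"
      if "x \<in> L0 (lev p n) \<and> (n = 0 \<longrightarrow> x = f)" for x n
      using J_range_dense[of x "lev p n" "\<delta> n"] \<delta>[of n] that by auto
  qed
  then obtain a where a: "\<And>n. a n \<in> L0 (lev p n)" "a 0 = f"
    "\<And>n. ?d (lev p n) (a n) (J (lev p n) (a (Suc n))) < \<delta> n"
    by blast
  define b where "b k j = JL (lev p k) j (a (k + j))" for k j
  have a': "a (k + j) \<in> L0 (lev (lev p k) j)" for k j
    using a(1)[of "k + j"] by (simp add: lev_add)
  have bL: "b k j \<in> L0 (lev p k)" for k j
    unfolding b_def by (rule JL_mem_L0[OF a'])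
  have b_Suc: "b k (Suc j) = J (lev p k) (b (Suc k) j)" for k j
    by (simp add: b_def)
  have gap: "?d (lev p k) (b k j) (b k (Suc j)) \<le> e / 4 * (1/2) ^ j" for k j
  proof -
    let ?q = "lev (lev p k) j"
    have q: "?q = lev p (k + j)" by (rule lev_add)
    define c where "c = J ?q (a (Suc (k + j)))"
    have "a (Suc (k + j)) \<in> L0 (\<not> ?q)" unfolding q using a(1)[of "Suc (k + j)"] by simp
    then have c: "c \<in> L0 ?q" unfolding c_def by (rule J_mem_L0)
    have bS: "b k (Suc j) = JL (lev p k) j c"
      unfolding b_def c_def JL_Suc_right by simp
    have "?d (lev p k) (b k j) (b k (Suc j)) = nrm (lev p k) (JL (lev p k) j (\<lambda>x. a (k + j) x - c x))"
      unfolding form_dist_def bS unfolding b_def JL_diff[OF a' c] ..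
    also have "\<dots> \<le> J_norm ^ j * nrm ?q (\<lambda>x. a (k + j) x - c x)"
      by (rule nrm_JL_le[OF L0.diff_mem[OF a' c]])
    also have "\<dots> \<le> J_norm ^ j * \<delta> (k + j)"
    proof (rule mult_left_mono)
      show "nrm ?q (\<lambda>x. a (k + j) x - c x) \<le> \<delta> (k + j)"
        using a(3)[of "k + j"] unfolding q[symmetric] c_def form_dist_def by simp
    qed (use B0 in simp)
    also have "\<dots> = (e / 4 * (1/2) ^ j) * (inverse (J_norm ^ k) * (1/2) ^ k)"
      using B0 by (simp add: \<delta>_def power_add power_mult_distrib power_one_over field_simps)
    also have "\<dots> \<le> (e / 4 * (1/2) ^ j) * (1 * 1)"
      using e J_norm_ge_1 by (intro mult_left_mono mult_mono) (auto simp: power_le_one inverse_le_1_iff)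
    finally show ?thesis by simp
  qed
  have ex: "\<forall>k. \<exists>g. g \<in> L0 (lev p k) \<and> (\<lambda>j. ?d (lev p k) (b k j) g) \<longlonglongrightarrow> 0 \<and>
      ?d (lev p k) (b k 0) g \<le> 2 * (e / 4)"
    by (rule allI, rule hilbert_space_geometric_limit[OF hilbert_space_L0 bL gap]) blast
  obtain g where gL: "\<And>k. g k \<in> L0 (lev p k)"
    and lim: "\<And>k. (\<lambda>j. ?d (lev p k) (b k j) (g k)) \<longlonglongrightarrow> 0"
    and close: "\<And>k. ?d (lev p k) (b k 0) (g k) \<le> 2 * (e / 4)"
    using choice[OF ex] by blast
  \<comment> \<open>the limits \<open>g k\<close> are primitives of each other only almost everywhere; \<open>\<phi> k\<close> is the regular
    representative of \<open>g k\<close>\<close>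
  define \<phi> where "\<phi> k = J (lev p k) (g (Suc k))" for k
  have gS: "g (Suc k) \<in> L0 (\<not> lev p k)" for k using gL[of "Suc k"] by simp
  have \<phi>C: "\<phi> k \<in> C (lev p k)" for k
    unfolding \<phi>_def by (rule J_mem_C[OF gS])
  have ae: "AE x in \<mu> (lev p k). g k x = \<phi> k x" for k
  proof -
    have "?d (lev p k) (g k) (\<phi> k) \<le>
        ?d (lev p k) (b k (Suc j)) (g k) + J_norm * ?d (lev p (Suc k)) (b (Suc k) j) (g (Suc k))" for j
    proof -
      have bS: "b (Suc k) j \<in> L0 (\<not> lev p k)" using bL[of "Suc k" j] by simp
      have "?d (lev p k) (b k (Suc j)) (\<phi> k) \<le> J_norm * ?d (lev p (Suc k)) (b (Suc k) j) (g (Suc k))"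
        using nrm_J_le[OF L0.diff_mem[OF bS gS]] J_diff[OF bS gS]
        unfolding form_dist_def b_Suc \<phi>_def by simp
      then show ?thesis
        using L0.form_dist_triangle[OF gL bL C_subset_L0[OF \<phi>C], of k "Suc j"]
          L0.form_dist_commute[OF gL bL, of k "Suc j"] by simp
    qed
    moreover have "(\<lambda>j. ?d (lev p k) (b k (Suc j)) (g k) +
        J_norm * ?d (lev p (Suc k)) (b (Suc k) j) (g (Suc k))) \<longlonglongrightarrow> 0 + J_norm * 0"
      by (intro tendsto_add tendsto_mult_left lim LIMSEQ_Suc)
    ultimately have "?d (lev p k) (g k) (\<phi> k) \<le> 0 + J_norm * 0"
      by (intro LIMSEQ_le_const) auto
    then have "nrm (lev p k) (\<lambda>x. g k x - \<phi> k x) = 0"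
      using L0.form_dist_nonneg[OF gL C_subset_L0[OF \<phi>C], of k] by (simp add: form_dist_def)
    then have "AE x in \<mu> (lev p k). g k x - \<phi> k x = 0"
      using \<mu>.form_norm_eq_0_iff[OF L0D(1)[OF L0.diff_mem[OF gL C_subset_L0[OF \<phi>C]]]] by blast
    then show ?thesis by eventually_elim simp
  qed
  have "\<phi> k = J (lev p k) (\<phi> (Suc k))" for k
    unfolding \<phi>_def[of k]
    by (rule J_cong_AE[OF gS C_subset_L0[OF \<phi>C[of "Suc k", unfolded lev_simps]]
          ae[of "Suc k", unfolded lev_simps]])
  then have "\<phi> 0 \<in> S0 p"
    unfolding S0_def using \<phi>C by blast
  moreover have "?d p f (\<phi> 0) < e"
  proof -
    have "AE x in \<mu> p. f x - \<phi> 0 x = f x - g 0 x"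
      using ae[of 0, unfolded lev_simps] by eventually_elim simp
    then have "?d p f (\<phi> 0) = ?d p f (g 0)"
      unfolding form_dist_def using f gL[of 0] C_subset_L0[OF \<phi>C[of 0]]
      by (intro \<mu>.form_norm_cong_AE L0D(1) L0.diff_mem) simp_all
    also have "\<dots> \<le> e / 2"
      using close[of 0] a(2) by (simp add: b_def)
    finally show ?thesis using e by simp
  qed
  ultimately show ?thesis by blast
qed


section \<open>Weak derivatives\<close>

definition weak :: "bool \<Rightarrow> (real \<Rightarrow> real) \<Rightarrow> (real \<Rightarrow> real) \<Rightarrow> bool" where
  "weak p f F \<longleftrightarrow> f \<in> L2 (\<mu> p) \<and> F \<in> L2 (\<mu> (\<not> p)) \<and>
    (\<forall>g\<in>smooth (\<not> p). \<forall>G. D (\<not> p) g G \<longrightarrow>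
      (\<integral>x. f x * G x \<partial>\<mu> p) = - (\<integral>x. F x * g x \<partial>\<mu> (\<not> p)))"

lemma weak_eqs: "weak_DW W V = weak False" "weak_DV W V = weak True"
  by (auto simp: fun_eq_iff weak_DW_def weak_DV_def weak_def Cinf_eq_smooth \<mu>_def
      strong_DW_eq strong_DV_eq Z_def)

lemma const_AE_imp_zero:
  assumes "f \<in> L0 p" "g \<in> L0 p" "AE x in \<mu> p. f x = c + g x"
  shows "c = 0"
proof -
  have "(\<integral>x. f x \<partial>\<mu> p) = (\<integral>x. c + g x \<partial>\<mu> p)"
    by (rule \<mu>.integral_cong_AE_L2) (use assms L0D \<mu>.L2.add_mem \<mu>.L2_const in blast)+
  also have "\<dots> = c * mass p"
    using L0D[OF assms(2)] by (simp add: \<mu>.L2_integrable mass_def mult.commute)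
  finally show ?thesis using L0D[OF assms(1)] mass_pos[of p] by simp
qed

lemma AE_zero_if_orthogonal_S0:
  assumes u: "u \<in> L0 p" and orth: "\<And>G. G \<in> S0 p \<Longrightarrow> l2 (\<mu> p) u G = 0"
  shows "AE x in \<mu> p. u x = 0"
proof -
  have "l2 (\<mu> p) u u \<le> 0 + e" if e: "e > 0" for e
  proof -
    have n: "nrm p u \<ge> 0" by (rule L0.form_norm_nonneg[OF u])
    then have e': "e / (nrm p u + 1) > 0" using e by simp
    obtain G where G: "G \<in> S0 p" "form_dist (l2 (\<mu> p)) u G < e / (nrm p u + 1)"
      using S0_dense[OF u e'] by blast
    have GL: "G \<in> L0 p" by (rule S0_subset_L0[OF G(1)])
    have "l2 (\<mu> p) u u = l2 (\<mu> p) u (\<lambda>x. u x - G x)"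
      using L0.ip_diff_right[OF u u GL] orth[OF G(1)] by simp
    also have "\<dots> \<le> nrm p u * form_dist (l2 (\<mu> p)) u G"
      using L0.Cauchy_Schwarz[OF u L0.diff_mem[OF u GL]] by (simp add: form_dist_def)
    also have "\<dots> \<le> nrm p u * (e / (nrm p u + 1))"
      using n G(2) by (intro mult_left_mono) auto
    also have "\<dots> \<le> e"
      using n e by (simp add: pos_divide_le_eq distrib_left mult.commute)
    finally show ?thesis by simp
  qed
  then have "l2 (\<mu> p) u u \<le> 0" by (rule field_le_epsilon)
  then have "nrm p u = 0"
    using L0.ip_nonneg[OF u] by (simp add: form_norm_def)
  then show ?thesis
    using \<mu>.form_norm_eq_0_iff[OF L0D(1)[OF u]] by simp
qed

text \<open>Testing against the primitives of smooth functions of mean zero shows that \<open>f - J p F\<close> is, up to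
  its mean, orthogonal to all of the latter, hence null by density; testing against constants shows
  that \<open>F\<close> has mean zero. The converse is integration by parts.\<close>

lemma weak_iff:
  "weak p f F \<longleftrightarrow> f \<in> L2 (\<mu> p) \<and> F \<in> L0 (\<not> p) \<and> (\<exists>c. AE x in \<mu> p. f x = c + J p F x)"
proof
  assume w: "weak p f F"
  then have f: "f \<in> L2 (\<mu> p)" and F: "F \<in> L2 (\<mu> (\<not> p))"
    and parts: "\<And>g G. g \<in> smooth (\<not> p) \<Longrightarrow> D (\<not> p) g G \<Longrightarrow>
      (\<integral>x. f x * G x \<partial>\<mu> p) = - (\<integral>x. F x * g x \<partial>\<mu> (\<not> p))"
    unfolding weak_def by blast+
  have S0z: "(\<lambda>x. 0) \<in> S0 (\<not> p)"
    using function_subspace_S0[of "\<not> p"] by (simp add: function_subspace_def)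
  have "(\<lambda>x. 1 + 0) \<in> smooth (\<not> p)"
    unfolding smooth_def by (intro CollectI exI[of _ 1] bexI[OF _ S0z]) simp
  then have "(\<integral>x. F x \<partial>\<mu> (\<not> p)) = 0"
    using parts[of "\<lambda>x. 1" "\<lambda>x. 0"] one_sided_deriv_const[of "\<not> p" "Z (\<not> p)" 1] by simp
  then have F0: "F \<in> L0 (\<not> p)" using F by (simp add: L0_def)
  define c where "c = (\<integral>x. f x \<partial>\<mu> p) / mass p"
  define f0 where "f0 x = f x - c" for x
  have f0L: "f0 \<in> L0 p"
    unfolding L0_def
  proof (intro CollectI conjI)
    show "f0 \<in> L2 (\<mu> p)"
      unfolding f0_def[abs_def] by (rule \<mu>.L2.diff_mem[OF f \<mu>.L2_const])
    show "(\<integral>x. f0 x \<partial>\<mu> p) = 0"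
      using mass_pos[of p] \<mu>.L2_integrable[OF f]
      by (simp add: f0_def c_def mass_def)
  qed
  have JL: "J p F \<in> L0 p" by (rule J_mem_L0[OF F0])
  have orth: "l2 (\<mu> p) (\<lambda>x. f0 x - J p F x) G = 0" if G: "G \<in> S0 p" for G
  proof -
    have GL: "G \<in> L0 p" by (rule S0_subset_L0[OF G])
    have g: "J (\<not> p) G \<in> S0 (\<not> p)" by (rule S0_J) (simp add: G)
    have "J (\<not> p) G \<in> smooth (\<not> p)"
      unfolding smooth_def by (intro CollectI exI[of _ 0] bexI[OF _ g]) simp
    moreover have "D (\<not> p) (J (\<not> p) G) G" by (rule D_J) (simp add: S0_subset_C G)
    ultimately have "l2 (\<mu> p) f G = - l2 (\<mu> (\<not> p)) F (J (\<not> p) G)" by (rule parts)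
    also have "\<dots> = l2 (\<mu> p) (J p F) G" using J_parts[OF F0 GL] by simp
    finally have fG: "l2 (\<mu> p) f G = l2 (\<mu> p) (J p F) G" .
    have "l2 (\<mu> p) f0 G = l2 (\<mu> p) f G - l2 (\<mu> p) (\<lambda>x. c) G"
      unfolding f0_def by (rule \<mu>.L2.ip_diff_left[OF f \<mu>.L2_const L0D(1)[OF GL]])
    also have "l2 (\<mu> p) (\<lambda>x. c) G = 0" using L0D(2)[OF GL] by simp
    finally show ?thesis
      using L0.ip_diff_left[OF f0L JL GL] fG by simp
  qed
  have "AE x in \<mu> p. f0 x - J p F x = 0"
    by (rule AE_zero_if_orthogonal_S0[OF L0.diff_mem[OF f0L JL]]) (rule orth)
  then have "AE x in \<mu> p. f x = c + J p F x"
    by eventually_elim (simp add: f0_def)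
  then show "f \<in> L2 (\<mu> p) \<and> F \<in> L0 (\<not> p) \<and> (\<exists>c. AE x in \<mu> p. f x = c + J p F x)"
    using f F0 by blast
next
  assume a: "f \<in> L2 (\<mu> p) \<and> F \<in> L0 (\<not> p) \<and> (\<exists>c. AE x in \<mu> p. f x = c + J p F x)"
  then obtain c where f: "f \<in> L2 (\<mu> p)" and F: "F \<in> L0 (\<not> p)"
    and c: "AE x in \<mu> p. f x = c + J p F x" by blast
  have JL: "J p F \<in> L0 p" by (rule J_mem_L0[OF F])
  have "(\<integral>x. f x * G x \<partial>\<mu> p) = - (\<integral>x. F x * g x \<partial>\<mu> (\<not> p))"
    if g: "g \<in> smooth (\<not> p)" and d: "D (\<not> p) g G" for g G
  proof -
    obtain b g0 where g0: "g0 \<in> S0 (\<not> p)" "g = (\<lambda>x. b + g0 x)"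
      using g unfolding smooth_def by blast
    have d0: "D (\<not> p) g0 G" using d unfolding g0(2) one_sided_deriv_add_const .
    have G: "G \<in> S0 p" and gJ: "g0 = J (\<not> p) G" using S0_deriv[OF g0(1) d0] by simp_all
    have GL: "G \<in> L0 p" by (rule S0_subset_L0[OF G])
    have "l2 (\<mu> p) f G = l2 (\<mu> p) (\<lambda>x. c + J p F x) G"
      using f L0D(1)[OF GL] \<mu>.L2.add_mem[OF \<mu>.L2_const L0D(1)[OF JL]] c
      by (intro \<mu>.l2_cong_AE) simp_all
    also have "\<dots> = l2 (\<mu> p) (\<lambda>x. c) G + l2 (\<mu> p) (J p F) G"
      by (rule \<mu>.L2.ip_add_left[OF \<mu>.L2_const L0D(1)[OF JL] L0D(1)[OF GL]])
    also have "l2 (\<mu> p) (\<lambda>x. c) G = 0" using L0D(2)[OF GL] by simp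
    also have "l2 (\<mu> p) (J p F) G = - l2 (\<mu> (\<not> p)) F g0"
      using J_parts[OF F GL] gJ by simp
    finally have "l2 (\<mu> p) f G = - l2 (\<mu> (\<not> p)) F g0" by simp
    moreover have "l2 (\<mu> (\<not> p)) F g = l2 (\<mu> (\<not> p)) F (\<lambda>x. b) + l2 (\<mu> (\<not> p)) F g0"
      unfolding g0(2) by (rule \<mu>.L2.ip_add_right[OF L0D(1)[OF F] \<mu>.L2_const L0D(1)[OF S0_subset_L0[OF g0(1)]]])
    moreover have "l2 (\<mu> (\<not> p)) F (\<lambda>x. b) = 0" using L0D(2)[OF F] by simp
    ultimately show ?thesis by simp
  qed
  then show "weak p f F"
    unfolding weak_def using f L0D(1)[OF F] by blast
qed

lemma weak_mem: "weak p f F \<Longrightarrow> f \<in> L2 (\<mu> p)" "weak p f F \<Longrightarrow> F \<in> L0 (\<not> p)"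
  by (simp_all add: weak_iff)

lemma weak_unique:
  assumes w: "weak p f F" "weak p g G" and fg: "AE x in \<mu> p. f x = g x"
  shows "AE x in \<mu> (\<not> p). F x = G x"
proof -
  have F: "F \<in> L0 (\<not> p)" and G: "G \<in> L0 (\<not> p)" using w weak_mem by auto
  obtain c d where "AE x in \<mu> p. f x = c + J p F x" "AE x in \<mu> p. g x = d + J p G x"
    using w unfolding weak_iff by blast
  with fg have "AE x in \<mu> p. J p (\<lambda>x. F x - G x) x = d - c"
    unfolding J_diff[OF F G] by eventually_elim simp
  from J_const_imp_AE_zero[OF L0.diff_mem[OF F G] this]
  show ?thesis by eventually_elim simp
qed

lemma weak_cong_left:
  assumes "weak p f F" "g \<in> L2 (\<mu> p)" "AE x in \<mu> p. f x = g x"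
  shows "weak p g F"
proof -
  obtain c where "AE x in \<mu> p. f x = c + J p F x" using assms(1) unfolding weak_iff by blast
  with assms(3) have "AE x in \<mu> p. g x = c + J p F x" by eventually_elim simp
  then show ?thesis using assms(1,2) unfolding weak_iff by blast
qed

lemma weak_add:
  assumes "weak p f F" "weak p g G"
  shows "weak p (\<lambda>x. f x + g x) (\<lambda>x. F x + G x)"
proof -
  have F: "F \<in> L0 (\<not> p)" and G: "G \<in> L0 (\<not> p)" and f: "f \<in> L2 (\<mu> p)" and g: "g \<in> L2 (\<mu> p)"
    using assms weak_mem by auto
  obtain c d where "AE x in \<mu> p. f x = c + J p F x" "AE x in \<mu> p. g x = d + J p G x"
    using assms unfolding weak_iff by blast
  then have "AE x in \<mu> p. f x + g x = (c + d) + J p (\<lambda>x. F x + G x) x"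
    unfolding J_add[OF F G] by eventually_elim simp
  then show ?thesis
    unfolding weak_iff using L0.add_mem[OF F G] \<mu>.L2.add_mem[OF f g] by blast
qed

lemma weak_scale:
  assumes "weak p f F"
  shows "weak p (\<lambda>x. a * f x) (\<lambda>x. a * F x)"
proof -
  obtain c where "AE x in \<mu> p. f x = c + J p F x"
    using assms unfolding weak_iff by blast
  then have "AE x in \<mu> p. a * f x = (a * c) + J p (\<lambda>x. a * F x) x"
    unfolding J_scale by eventually_elim (simp add: distrib_left)
  then show ?thesis
    unfolding weak_iff
    using L0.scale_mem[OF weak_mem(2)[OF assms]] \<mu>.L2.scale_mem[OF weak_mem(1)[OF assms]] by blast
qed

lemma l2_tendsto:
  assumes a: "\<And>n. a n \<in> L2 (\<mu> p)" "f \<in> L2 (\<mu> p)" "g \<in> L2 (\<mu> p)"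
    and lim: "(\<lambda>n. form_dist (l2 (\<mu> p)) (a n) f) \<longlonglongrightarrow> 0"
  shows "(\<lambda>n. l2 (\<mu> p) (a n) g) \<longlonglongrightarrow> l2 (\<mu> p) f g"
proof (rule LIM_zero_cancel, rule Lim_null_comparison)
  show "eventually (\<lambda>n. norm (l2 (\<mu> p) (a n) g - l2 (\<mu> p) f g) \<le> form_dist (l2 (\<mu> p)) (a n) f * nrm p g) sequentially"
  proof (intro always_eventually allI)
    fix n
    show "norm (l2 (\<mu> p) (a n) g - l2 (\<mu> p) f g) \<le> form_dist (l2 (\<mu> p)) (a n) f * nrm p g"
      using \<mu>.L2.Cauchy_Schwarz[OF \<mu>.L2.diff_mem[OF a(1)[of n] a(2)] a(3)]
        \<mu>.L2.ip_diff_left[OF a(1)[of n] a(2,3)]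
      by (simp add: form_dist_def)
  qed
  show "(\<lambda>n. form_dist (l2 (\<mu> p)) (a n) f * nrm p g) \<longlonglongrightarrow> 0"
    using tendsto_mult_right[OF lim, of "nrm p g"] by simp
qed

lemma weak_closed:
  assumes w: "\<And>n. weak p (a n) (b n)" and f: "f \<in> L2 (\<mu> p)" and F: "F \<in> L2 (\<mu> (\<not> p))"
    and lim: "(\<lambda>n. form_dist (l2 (\<mu> p)) (a n) f) \<longlonglongrightarrow> 0"
      "(\<lambda>n. form_dist (l2 (\<mu> (\<not> p))) (b n) F) \<longlonglongrightarrow> 0"
  shows "weak p f F"
  unfolding weak_def
proof (intro conjI ballI allI impI f F)
  fix g G assume g: "g \<in> smooth (\<not> p)" and d: "D (\<not> p) g G"
  have "G \<in> S0 p"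
  proof -
    obtain c g0 where g0: "g0 \<in> S0 (\<not> p)" "g = (\<lambda>x. c + g0 x)"
      using g unfolding smooth_def by blast
    have "D (\<not> p) g0 G" using d unfolding g0(2) one_sided_deriv_add_const .
    from S0_deriv(1)[OF g0(1) this] show ?thesis by simp
  qed
  then have GL: "G \<in> L2 (\<mu> p)" by (rule L0D(1)[OF S0_subset_L0])
  have "(\<lambda>n. l2 (\<mu> p) (a n) G) \<longlonglongrightarrow> l2 (\<mu> p) f G"
    by (rule l2_tendsto[OF weak_mem(1)[OF w] f GL lim(1)])
  moreover have "(\<lambda>n. - l2 (\<mu> (\<not> p)) (b n) g) \<longlonglongrightarrow> - l2 (\<mu> (\<not> p)) F g"
    by (intro tendsto_minus l2_tendsto[OF L0D(1)[OF weak_mem(2)[OF w]] F smooth_L2[OF g] lim(2)])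
  moreover have "l2 (\<mu> p) (a n) G = - l2 (\<mu> (\<not> p)) (b n) g" for n
    using w[of n] g d unfolding weak_def by blast
  ultimately show "l2 (\<mu> p) f G = - l2 (\<mu> (\<not> p)) F g"
    using LIMSEQ_unique by force
qed

section \<open>Sobolev spaces\<close>

abbreviation wd :: "nat \<Rightarrow> (real \<Rightarrow> real) \<Rightarrow> (real \<Rightarrow> real) \<Rightarrow> bool" where
  "wd \<equiv> alt_deriv (weak_DW W V) (weak_DV W V)"

abbreviation d :: "nat \<Rightarrow> (real \<Rightarrow> real) \<Rightarrow> real \<Rightarrow> real" where
  "d \<equiv> weak_deriv W V"

lemma wd_Suc: "wd (Suc n) f F \<longleftrightarrow> (\<exists>G. wd n f G \<and> weak (odd n) G F)"
  unfolding weak_eqs by (cases "odd n") auto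

lemma wd_mem:
  assumes "wd n f F" "f \<in> L2 (\<mu> False)"
  shows "F \<in> L2 (\<mu> (odd n))" "n > 0 \<Longrightarrow> F \<in> L0 (odd n)"
proof -
  have L: "F \<in> L0 (odd n)" if n: "n > 0"
  proof -
    obtain m where m: "n = Suc m" using n gr0_conv_Suc by blast
    obtain G where G: "weak (odd m) G F" using assms(1) unfolding m wd_Suc by blast
    show ?thesis using weak_mem(2)[OF G] unfolding m by simp
  qed
  then show "n > 0 \<Longrightarrow> F \<in> L0 (odd n)" .
  show "F \<in> L2 (\<mu> (odd n))"
    using L L0D(1) assms by (cases "n = 0") auto
qed

lemma wd_unique:
  "wd n f F \<Longrightarrow> wd n g G \<Longrightarrow> AE x in \<mu> False. f x = g x \<Longrightarrow> AE x in \<mu> (odd n). F x = G x"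
proof (induction n arbitrary: F G)
  case (Suc n)
  obtain F' G' where "wd n f F'" "weak (odd n) F' F" "wd n g G'" "weak (odd n) G' G"
    using Suc.prems(1,2) unfolding wd_Suc by blast
  with Suc.IH[of F' G'] Suc.prems(3) have "AE x in \<mu> (\<not> odd n). F x = G x"
    by (intro weak_unique[of "odd n" F' F G' G]) auto
  moreover have "odd (Suc n) = (\<not> odd n)" by simp
  ultimately show ?case by (simp only:)
next
  case 0
  moreover have "odd (0 :: nat) = False" by simp
  ultimately show ?case by (simp only: alt_deriv.simps)
qed

lemma wd_add: "wd n f F \<Longrightarrow> wd n g G \<Longrightarrow> wd n (\<lambda>x. f x + g x) (\<lambda>x. F x + G x)"
proof (induction n arbitrary: F G)
  case (Suc n)
  obtain F' G' where "wd n f F'" "weak (odd n) F' F" "wd n g G'" "weak (odd n) G' G"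
    using Suc.prems(1,2) unfolding wd_Suc by blast
  then show ?case
    unfolding wd_Suc using Suc.IH weak_add by blast
qed simp

lemma wd_scale: "wd n f F \<Longrightarrow> wd n (\<lambda>x. a * f x) (\<lambda>x. a * F x)"
proof (induction n arbitrary: F)
  case (Suc n)
  obtain F' where "wd n f F'" "weak (odd n) F' F"
    using Suc.prems unfolding wd_Suc by blast
  then show ?case
    unfolding wd_Suc using Suc.IH weak_scale by blast
qed simp

text \<open>The constants arising at the intermediate steps vanish since the derivatives of positive order
  have mean zero; only the one in front of the \<open>n + 1\<close>-fold primitive remains.\<close>

lemma wd_iff:
  "wd (Suc n) f F \<longleftrightarrow> f \<in> L2 (\<mu> False) \<and> F \<in> L0 (odd (Suc n)) \<and>
    (\<exists>c. AE x in \<mu> False. f x = c + JL False (Suc n) F x)"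
proof (induction n arbitrary: F)
  case 0
  show ?case unfolding wd_Suc by (simp add: weak_iff)
next
  case (Suc n)
  show ?case
  proof
    assume "wd (Suc (Suc n)) f F"
    then obtain G where G: "wd (Suc n) f G" "weak (odd (Suc n)) G F"
      unfolding wd_Suc[of "Suc n"] by blast
    have F: "F \<in> L0 (\<not> odd (Suc n))" by (rule weak_mem(2)[OF G(2)])
    obtain c where c: "AE x in \<mu> (odd (Suc n)). G x = c + J (odd (Suc n)) F x"
      using G(2) unfolding weak_iff by blast
    have GL: "G \<in> L0 (odd (Suc n))" using G(1) Suc.IH by blast
    have "c = 0" by (rule const_AE_imp_zero[OF GL J_mem_L0[OF F] c])
    with c have ae: "AE x in \<mu> (odd (Suc n)). G x = J (odd (Suc n)) F x" by simp
    have lev: "odd (Suc n) = (\<not> lev False n)" by simp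
    have "J (lev False n) G = J (lev False n) (J (odd (Suc n)) F)"
      using GL J_mem_L0[OF F] ae unfolding lev by (rule J_cong_AE)
    then have "JL False (Suc n) G = JL False (Suc (Suc n)) F"
      unfolding JL_Suc_right[of False "Suc n"] JL_Suc_right[of False n] by simp
    then show "f \<in> L2 (\<mu> False) \<and> F \<in> L0 (odd (Suc (Suc n))) \<and>
        (\<exists>c. AE x in \<mu> False. f x = c + JL False (Suc (Suc n)) F x)"
      using G(1) F unfolding Suc.IH by simp
  next
    assume a: "f \<in> L2 (\<mu> False) \<and> F \<in> L0 (odd (Suc (Suc n))) \<and>
        (\<exists>c. AE x in \<mu> False. f x = c + JL False (Suc (Suc n)) F x)"
    then have F: "F \<in> L0 (\<not> odd (Suc n))" by simp
    define G where "G = J (odd (Suc n)) F"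
    have GL: "G \<in> L0 (odd (Suc n))" unfolding G_def by (rule J_mem_L0[OF F])
    have "JL False (Suc (Suc n)) F = JL False (Suc n) G"
      unfolding G_def by (subst JL_Suc_right) simp
    then have "wd (Suc n) f G" unfolding Suc.IH using a GL by simp
    moreover have "weak (odd (Suc n)) G F"
      unfolding weak_iff
    proof (intro conjI exI[of _ 0] L0D(1)[OF GL] F)
      show "AE x in \<mu> (odd (Suc n)). G x = 0 + J (odd (Suc n)) F x" by (simp add: G_def)
    qed
    ultimately show "wd (Suc (Suc n)) f F" unfolding wd_Suc[of "Suc n"] by blast
  qed
qed


abbreviation sob :: "nat \<Rightarrow> (real \<Rightarrow> real) set" where
  "sob \<equiv> sobolev_space W V"

abbreviation ips :: "nat \<Rightarrow> real form" where
  "ips \<equiv> sobolev_inner W V"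

lemma dV_eq_\<mu>: "dV V = \<mu> False"
  by (simp add: \<mu>_def)

lemma \<kappa>_eq_\<mu>: "\<kappa> W V n = \<mu> (odd n)"
  by (simp add: \<kappa>_def \<mu>_def)

text \<open>Undoing \<open>i\<close> of the \<open>k\<close> integrations leaves the \<open>(k - i)\<close>-fold primitive. This gives the
  description of \<open>sob k\<close> in \<open>sob_iff\<close>, including the case \<open>k = 0\<close>.\<close>

lemma wd_of_JL:
  assumes f: "f \<in> L2 (\<mu> False)" and F: "F \<in> L0 (odd k)"
    and ae: "AE x in \<mu> False. f x = c + JL False k F x"
    and i: "0 < i" "i \<le> k"
  shows "wd i f (JL (odd i) (k - i) F)"
proof -
  obtain m where m: "i = Suc m" using i(1) gr0_conv_Suc by blast
  have lev: "lev (odd i) (k - i) = odd k"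
    using lev_add[of False i "k - i"] i(2) by simp
  have "JL False k F = JL False i (JL (odd i) (k - i) F)"
    using JL_add[of False i "k - i" F] i(2) by simp
  moreover have "JL (odd i) (k - i) F \<in> L0 (odd i)"
    by (rule JL_mem_L0) (use F lev in simp)
  ultimately show ?thesis
    using f ae unfolding m wd_iff by auto
qed

lemma sob_iff:
  "f \<in> sob k \<longleftrightarrow> f \<in> L2 (\<mu> False) \<and> (\<exists>F\<in>L0 (odd k). \<exists>c. AE x in \<mu> False. f x = c + JL False k F x)"
proof (cases k)
  case 0
  have "\<exists>F\<in>L0 (odd k). \<exists>c. AE x in \<mu> False. f x = c + JL False k F x" if f: "f \<in> L2 (\<mu> False)"
  proof (intro bexI exI)
    define c where "c = (\<integral>x. f x \<partial>\<mu> False) / mass False"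
    show "AE x in \<mu> False. f x = c + JL False k (\<lambda>x. f x - c) x"
      by (simp add: 0)
    have "(\<integral>x. f x - c \<partial>\<mu> False) = 0"
      using mass_pos[of False] \<mu>.L2_integrable[OF f] by (simp add: c_def mass_def)
    then show "(\<lambda>x. f x - c) \<in> L0 (odd k)"
      using \<mu>.L2.diff_mem[OF f \<mu>.L2_const] by (simp add: L0_def 0)
  qed
  then show ?thesis
    by (auto simp: sobolev_space_def dV_eq_\<mu> 0)
next
  case (Suc m)
  show ?thesis
  proof
    assume f: "f \<in> sob k"
    then have "\<forall>n\<in>{1..k}. \<exists>F. wd n f F"
      unfolding sobolev_space_def by blast
    moreover have "k \<in> {1..k}" using Suc by simp
    ultimately obtain F where "wd k f F" by blast
    then show "f \<in> L2 (\<mu> False) \<and> (\<exists>F\<in>L0 (odd k). \<exists>c. AE x in \<mu> False. f x = c + JL False k F x)"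
      unfolding Suc wd_iff by blast
  next
    assume "f \<in> L2 (\<mu> False) \<and> (\<exists>F\<in>L0 (odd k). \<exists>c. AE x in \<mu> False. f x = c + JL False k F x)"
    then obtain F c where "f \<in> L2 (\<mu> False)" "F \<in> L0 (odd k)"
      "AE x in \<mu> False. f x = c + JL False k F x" by blast
    note wd = wd_of_JL[OF this]
    show "f \<in> sob k"
      unfolding sobolev_space_def dV_eq_\<mu>
    proof (intro CollectI conjI ballI exI)
      show "wd n f (JL (odd n) (k - n) F)" if "n \<in> {1..k}" for n
        using that by (intro wd) simp_all
    qed (rule \<open>f \<in> L2 (\<mu> False)\<close>)
  qed
qed

lemma sob_L2: "f \<in> sob k \<Longrightarrow> f \<in> L2 (\<mu> False)"
  by (simp add: sob_iff)

lemma sob_mono: "k \<le> m \<Longrightarrow> sob m \<subseteq> sob k"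
  unfolding sobolev_space_def by auto

lemma wd_d:
  assumes "f \<in> sob k" "i \<le> k"
  shows "wd i f (d i f)"
proof -
  have "\<exists>F. wd i f F"
    using assms unfolding sobolev_space_def by (cases "i = 0") auto
  then show ?thesis unfolding weak_deriv_def by (rule someI_ex)
qed

lemma d_0 [simp]: "d 0 f = f"
  unfolding weak_deriv_def by (rule some_equality) simp_all

lemma d_L2: "f \<in> sob k \<Longrightarrow> i \<le> k \<Longrightarrow> d i f \<in> L2 (\<mu> (odd i))"
  by (rule wd_mem(1)[OF wd_d sob_L2])

lemma d_L0: "f \<in> sob k \<Longrightarrow> Suc i \<le> k \<Longrightarrow> d (Suc i) f \<in> L0 (\<not> odd i)"
  using wd_mem(2)[OF wd_d sob_L2, of f k "Suc i"] by simp

lemma AE_d_eq: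
  assumes f: "f \<in> sob k" and i: "i \<le> k" and F: "wd i g F" and ae: "AE x in \<mu> False. f x = g x"
  shows "AE x in \<mu> (odd i). d i f x = F x"
  by (rule wd_unique[OF wd_d[OF f i] F ae])

lemma weak_d:
  assumes f: "f \<in> sob k" and i: "Suc i \<le> k"
  shows "weak (odd i) (d i f) (d (Suc i) f)"
proof -
  obtain G where G: "wd i f G" "weak (odd i) G (d (Suc i) f)"
    using wd_d[OF f i] unfolding wd_Suc by blast
  have "AE x in \<mu> (odd i). G x = d i f x"
    using i by (intro wd_unique[OF G(1) wd_d[OF f]]) auto
  then show ?thesis
    using i by (intro weak_cong_left[OF G(2)] d_L2[OF f]) auto
qed

lemma function_subspace_sob: "function_subspace (sob k)"
proof -
  have mem: "f \<in> sob k" if "f \<in> L2 (\<mu> False)" "\<And>i. i \<le> k \<Longrightarrow> \<exists>F. wd i f F" for f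
    using that unfolding sobolev_space_def dV_eq_\<mu> by auto
  show ?thesis
    unfolding function_subspace_def
  proof (intro conjI ballI allI)
    have "wd i (\<lambda>x. 0) (\<lambda>x. 0)" for i
    proof (induction i)
      case (Suc i)
      have "J q (\<lambda>x. 0) = (\<lambda>x. 0)" for q using J_scale[of q 0 "\<lambda>x. 0"] by simp
      then have "weak (odd i) (\<lambda>x. 0) (\<lambda>x. 0)"
        unfolding weak_iff by (intro conjI \<mu>.L2_const L0.zero_mem exI[of _ 0]) simp
      then show ?case unfolding wd_Suc using Suc by blast
    qed simp
    then show "(\<lambda>x. 0) \<in> sob k" by (intro mem \<mu>.L2_const) blast
    show "(\<lambda>x. f x + g x) \<in> sob k" if "f \<in> sob k" "g \<in> sob k" for f g
      using wd_add[OF wd_d[OF that(1)] wd_d[OF that(2)]] sob_L2[OF that(1)] sob_L2[OF that(2)]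
      by (intro mem \<mu>.L2.add_mem) blast+
    show "(\<lambda>x. c * f x) \<in> sob k" if "f \<in> sob k" for c f
      using wd_scale[OF wd_d[OF that]] sob_L2[OF that] by (intro mem \<mu>.L2.scale_mem) blast+
  qed
qed

lemma sob_add: "f \<in> sob k \<Longrightarrow> g \<in> sob k \<Longrightarrow> (\<lambda>x. f x + g x) \<in> sob k"
  and sob_scale: "f \<in> sob k \<Longrightarrow> (\<lambda>x. c * f x) \<in> sob k"
  using function_subspace_sob[of k] by (auto simp: function_subspace_def)

lemma sob_diff: "f \<in> sob k \<Longrightarrow> g \<in> sob k \<Longrightarrow> (\<lambda>x. f x - g x) \<in> sob k"
  using sob_add[of f k "\<lambda>x. - 1 * g x"] sob_scale[of g k "- 1"] by simp

lemma AE_d_add: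
  assumes "f \<in> sob k" "g \<in> sob k" "i \<le> k"
  shows "AE x in \<mu> (odd i). d i (\<lambda>x. f x + g x) x = d i f x + d i g x"
  by (rule AE_d_eq[OF sob_add[OF assms(1,2)] assms(3) wd_add[OF wd_d[OF assms(1,3)] wd_d[OF assms(2,3)]]])
     simp

lemma AE_d_scale:
  assumes "f \<in> sob k" "i \<le> k"
  shows "AE x in \<mu> (odd i). d i (\<lambda>x. c * f x) x = c * d i f x"
  by (rule AE_d_eq[OF sob_scale[OF assms(1)] assms(2) wd_scale[OF wd_d[OF assms]]]) simp

lemma AE_d_diff:
  assumes "f \<in> sob k" "g \<in> sob k" "i \<le> k"
  shows "AE x in \<mu> (odd i). d i (\<lambda>x. f x - g x) x = d i f x - d i g x"
proof -
  have "wd i (\<lambda>x. f x + - 1 * g x) (\<lambda>x. d i f x + - 1 * d i g x)"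
    by (rule wd_add[OF wd_d[OF assms(1,3)] wd_scale[OF wd_d[OF assms(2,3)]]])
  then have "wd i (\<lambda>x. f x - g x) (\<lambda>x. d i f x - d i g x)" by simp
  from AE_d_eq[OF sob_diff[OF assms(1,2)] assms(3) this] show ?thesis by simp
qed

lemma ips_eq: "ips k f g = (\<Sum>i\<le>k. l2 (\<mu> (odd i)) (d i f) (d i g))"
proof -
  have "{..k} = insert 0 {1..k}" by auto
  then have "(\<Sum>i\<le>k. l2 (\<mu> (odd i)) (d i f) (d i g)) =
      l2 (\<mu> (odd 0)) (d 0 f) (d 0 g) + (\<Sum>i=1..k. l2 (\<mu> (odd i)) (d i f) (d i g))"
    by simp
  then show ?thesis
    by (simp add: sobolev_inner_def dV_eq_\<mu> \<kappa>_eq_\<mu>)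
qed

lemma semi_inner_product_sob: "semi_inner_product (sob k) (ips k)"
  unfolding semi_inner_product_def
proof (intro conjI ballI allI)
  fix f assume f: "f \<in> sob k"
  show "0 \<le> ips k f f"
    unfolding ips_eq by (intro sum_nonneg \<mu>.L2.ip_nonneg d_L2[OF f]) simp
  fix g assume g: "g \<in> sob k"
  show "ips k f g = ips k g f"
    unfolding ips_eq by (intro sum.cong \<mu>.L2.ip_commute d_L2[OF f] d_L2[OF g]) simp_all
  show "ips k (\<lambda>x. c * f x) g = c * ips k f g" for c
    unfolding ips_eq sum_distrib_left
  proof (rule sum.cong)
    fix i assume "i \<in> {..k}"
    then have i: "i \<le> k" by simp
    have "l2 (\<mu> (odd i)) (d i (\<lambda>x. c * f x)) (d i g) = l2 (\<mu> (odd i)) (\<lambda>x. c * d i f x) (d i g)"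
      by (rule \<mu>.l2_cong_AE[OF d_L2[OF sob_scale[OF f] i] \<mu>.L2.scale_mem[OF d_L2[OF f i]]
            d_L2[OF g i] d_L2[OF g i] AE_d_scale[OF f i]]) simp
    also have "\<dots> = c * l2 (\<mu> (odd i)) (d i f) (d i g)"
      by (rule \<mu>.L2.ip_scale_left[OF d_L2[OF f i] d_L2[OF g i]])
    finally show "l2 (\<mu> (odd i)) (d i (\<lambda>x. c * f x)) (d i g) = c * l2 (\<mu> (odd i)) (d i f) (d i g)" .
  qed simp
  fix h assume h: "h \<in> sob k"
  show "ips k (\<lambda>x. f x + g x) h = ips k f h + ips k g h"
    unfolding ips_eq sum.distrib[symmetric]
  proof (rule sum.cong)
    fix i assume "i \<in> {..k}"
    then have i: "i \<le> k" by simp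
    have "l2 (\<mu> (odd i)) (d i (\<lambda>x. f x + g x)) (d i h) = l2 (\<mu> (odd i)) (\<lambda>x. d i f x + d i g x) (d i h)"
      by (rule \<mu>.l2_cong_AE[OF d_L2[OF sob_add[OF f g] i] \<mu>.L2.add_mem[OF d_L2[OF f i] d_L2[OF g i]]
            d_L2[OF h i] d_L2[OF h i] AE_d_add[OF f g i]]) simp
    also have "\<dots> = l2 (\<mu> (odd i)) (d i f) (d i h) + l2 (\<mu> (odd i)) (d i g) (d i h)"
      by (rule \<mu>.L2.ip_add_left[OF d_L2[OF f i] d_L2[OF g i] d_L2[OF h i]])
    finally show "l2 (\<mu> (odd i)) (d i (\<lambda>x. f x + g x)) (d i h) =
        l2 (\<mu> (odd i)) (d i f) (d i h) + l2 (\<mu> (odd i)) (d i g) (d i h)" .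
  qed simp
qed

sublocale sob: semi_inner_space "sob k" "ips k" for k
  by unfold_locales (rule function_subspace_sob, rule semi_inner_product_sob)

lemma form_norm_ips: "form_norm (ips k) f = sqrt (\<Sum>i\<le>k. l2 (\<mu> (odd i)) (d i f) (d i f))"
  by (simp add: form_norm_def ips_eq)

lemma nrm_d_le:
  assumes f: "f \<in> sob k" and i: "i \<le> k"
  shows "nrm (odd i) (d i f) \<le> form_norm (ips k) f"
  unfolding form_norm_ips unfolding form_norm_def
proof (rule real_sqrt_le_mono)
  show "l2 (\<mu> (odd i)) (d i f) (d i f) \<le> (\<Sum>i\<le>k. l2 (\<mu> (odd i)) (d i f) (d i f))"
    by (rule member_le_sum[where f = "\<lambda>i. l2 (\<mu> (odd i)) (d i f) (d i f)"])
       (use i in \<open>auto intro!: \<mu>.L2.ip_nonneg d_L2[OF f]\<close>)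
qed

lemma form_norm_ips_le_sum:
  assumes f: "f \<in> sob k"
  shows "form_norm (ips k) f \<le> (\<Sum>i\<le>k. nrm (odd i) (d i f))"
proof -
  have nn: "0 \<le> nrm (odd i) (d i f)" if "i \<le> k" for i
    by (rule \<mu>.L2.form_norm_nonneg[OF d_L2[OF f that]])
  have "(\<Sum>i\<le>k. l2 (\<mu> (odd i)) (d i f) (d i f)) = (\<Sum>i\<le>k. (nrm (odd i) (d i f))\<^sup>2)"
    by (rule sum.cong) (use \<mu>.L2.form_norm_sq[OF d_L2[OF f]] in simp_all)
  also have "\<dots> \<le> (\<Sum>i\<le>k. nrm (odd i) (d i f))\<^sup>2"
  proof -
    have sq: "(\<Sum>i\<in>A. (a i)\<^sup>2) \<le> (\<Sum>i\<in>A. a i)\<^sup>2" if "finite A" "\<And>i. i \<in> A \<Longrightarrow> 0 \<le> a i" for A :: "nat set" and a :: "nat \<Rightarrow> real"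
      using that
    proof (induction A rule: finite_induct)
      case (insert x A)
      have "0 \<le> a x * (\<Sum>i\<in>A. a i)"
        using insert.prems by (intro mult_nonneg_nonneg sum_nonneg) auto
      then show ?case using insert by (simp add: power2_sum)
    qed simp
    show ?thesis by (rule sq) (use nn in auto)
  qed
  finally have "sqrt (\<Sum>i\<le>k. l2 (\<mu> (odd i)) (d i f) (d i f)) \<le> sqrt ((\<Sum>i\<le>k. nrm (odd i) (d i f))\<^sup>2)"
    by (rule real_sqrt_le_mono)
  moreover have "0 \<le> (\<Sum>i\<le>k. nrm (odd i) (d i f))"
    by (rule sum_nonneg) (use nn in simp)
  ultimately show ?thesis
    unfolding form_norm_ips by simp
qed

lemma form_norm_ips_mono:
  assumes f: "f \<in> sob m" and k: "k \<le> m"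
  shows "form_norm (ips k) f \<le> form_norm (ips m) f"
  unfolding form_norm_ips
  by (rule real_sqrt_le_mono, rule sum_mono2)
     (use k in \<open>auto intro!: \<mu>.L2.ip_nonneg d_L2[OF f]\<close>)

lemma nrm_d_diff:
  assumes "f \<in> sob k" "g \<in> sob k" "i \<le> k"
  shows "nrm (odd i) (d i (\<lambda>x. f x - g x)) = form_dist (l2 (\<mu> (odd i))) (d i f) (d i g)"
  unfolding form_dist_def
  by (rule \<mu>.form_norm_cong_AE[OF d_L2[OF sob_diff[OF assms(1,2)] assms(3)]
        \<mu>.L2.diff_mem[OF d_L2[OF assms(1,3)] d_L2[OF assms(2,3)]] AE_d_diff[OF assms]])

text \<open>The derivatives of a Cauchy sequence converge separately, and the weak derivative is closed.\<close>

lemma hilbert_space_sob: "hilbert_space (sob k) (ips k)"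
proof -
  have "\<exists>f\<in>sob k. (\<lambda>n. form_dist (ips k) (s n) f) \<longlonglongrightarrow> 0"
    if ran: "range s \<subseteq> sob k"
      and cau: "\<forall>\<epsilon>>0. \<exists>N. \<forall>i\<ge>N. \<forall>j\<ge>N. form_dist (ips k) (s i) (s j) < \<epsilon>" for s
  proof -
    have s: "s n \<in> sob k" for n using ran by blast
    have "\<exists>G. i \<le> k \<longrightarrow> G \<in> L2 (\<mu> (odd i)) \<and> (\<lambda>n. form_dist (l2 (\<mu> (odd i))) (d i (s n)) G) \<longlonglongrightarrow> 0" for i
    proof (cases "i \<le> k")
      case True
      have le: "form_dist (l2 (\<mu> (odd i))) (d i (s m)) (d i (s n)) \<le> form_dist (ips k) (s m) (s n)" for m n
        using nrm_d_le[OF sob_diff[OF s s] True, of m n] nrm_d_diff[OF s s True, of m n]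
        by (simp add: form_dist_def)
      have "\<forall>\<epsilon>>0. \<exists>N. \<forall>m\<ge>N. \<forall>n\<ge>N. form_dist (l2 (\<mu> (odd i))) (d i (s m)) (d i (s n)) < \<epsilon>"
        using cau le by (meson le_less_trans)
      moreover have "range (\<lambda>n. d i (s n)) \<subseteq> L2 (\<mu> (odd i))"
        using d_L2[OF s True] by blast
      ultimately have "\<exists>G\<in>L2 (\<mu> (odd i)). (\<lambda>n. form_dist (l2 (\<mu> (odd i))) (d i (s n)) G) \<longlonglongrightarrow> 0"
        using \<mu>.hilbert_space_L2[of "odd i"] unfolding hilbert_space_def by blast
      then show ?thesis by blast
    qed simp
    then have "\<forall>i. \<exists>G. i \<le> k \<longrightarrow> G \<in> L2 (\<mu> (odd i)) \<and> (\<lambda>n. form_dist (l2 (\<mu> (odd i))) (d i (s n)) G) \<longlonglongrightarrow> 0"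
      by blast
    from choice[OF this] obtain G where G: "\<And>i. i \<le> k \<Longrightarrow> G i \<in> L2 (\<mu> (odd i))"
      and lim: "\<And>i. i \<le> k \<Longrightarrow> (\<lambda>n. form_dist (l2 (\<mu> (odd i))) (d i (s n)) (G i)) \<longlonglongrightarrow> 0"
      by blast
    have odd: "odd (Suc i) = (\<not> odd i)" for i :: nat by simp
    have wd: "i \<le> k \<Longrightarrow> wd i (G 0) (G i)" for i
    proof (induction i)
      case (Suc i)
      have "weak (odd i) (G i) (G (Suc i))"
        by (rule weak_closed[OF weak_d[OF s Suc.prems] G G[of "Suc i", unfolded odd] lim
              lim[of "Suc i", unfolded odd]])
           (use Suc.prems in simp_all)
      then show ?case unfolding wd_Suc using Suc by auto
    qed simp
    have f: "G 0 \<in> sob k"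
      unfolding sobolev_space_def dV_eq_\<mu>
    proof (intro CollectI conjI ballI)
      show "G 0 \<in> L2 (\<mu> False)" using G[of 0] by simp
      show "\<exists>F. wd n (G 0) F" if "n \<in> {1..k}" for n
        using wd[of n] that by (intro exI[of _ "G n"]) simp
    qed
    have le: "form_dist (ips k) (s n) (G 0) \<le> (\<Sum>i\<le>k. form_dist (l2 (\<mu> (odd i))) (d i (s n)) (G i))" for n
    proof -
      have "form_dist (ips k) (s n) (G 0) \<le> (\<Sum>i\<le>k. nrm (odd i) (d i (\<lambda>x. s n x - G 0 x)))"
        unfolding form_dist_def by (rule form_norm_ips_le_sum[OF sob_diff[OF s f]])
      also have "\<dots> = (\<Sum>i\<le>k. form_dist (l2 (\<mu> (odd i))) (d i (s n)) (G i))"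
      proof (rule sum.cong)
        fix i assume "i \<in> {..k}"
        then have i: "i \<le> k" by simp
        have ae: "AE x in \<mu> (odd i). d i (G 0) x = G i x"
          by (rule AE_d_eq[OF f i wd[OF i]]) simp
        have "form_dist (l2 (\<mu> (odd i))) (d i (s n)) (d i (G 0)) =
            form_dist (l2 (\<mu> (odd i))) (d i (s n)) (G i)"
          unfolding form_dist_def
        proof (rule \<mu>.form_norm_cong_AE)
          show "AE x in \<mu> (odd i). d i (s n) x - d i (G 0) x = d i (s n) x - G i x"
            using ae by eventually_elim simp
        qed (intro \<mu>.L2.diff_mem d_L2[OF s i] d_L2[OF f i] G[OF i])+
        then show "nrm (odd i) (d i (\<lambda>x. s n x - G 0 x)) =
            form_dist (l2 (\<mu> (odd i))) (d i (s n)) (G i)"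
          using nrm_d_diff[OF s f i] by simp
      qed simp
      finally show ?thesis .
    qed
    have "(\<lambda>n. \<Sum>i\<le>k. form_dist (l2 (\<mu> (odd i))) (d i (s n)) (G i)) \<longlonglongrightarrow> (\<Sum>i\<le>k. 0)"
      by (rule tendsto_sum) (rule lim, simp)
    then have sum0: "(\<lambda>n. \<Sum>i\<le>k. form_dist (l2 (\<mu> (odd i))) (d i (s n)) (G i)) \<longlonglongrightarrow> 0"
      by (simp only: sum.neutral_const)
    have "(\<lambda>n. form_dist (ips k) (s n) (G 0)) \<longlonglongrightarrow> 0"
    proof (rule Lim_null_comparison[OF _ sum0], intro always_eventually allI)
      fix n
      show "norm (form_dist (ips k) (s n) (G 0)) \<le> (\<Sum>i\<le>k. form_dist (l2 (\<mu> (odd i))) (d i (s n)) (G i))"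
        unfolding real_norm_def abs_of_nonneg[OF sob.form_dist_nonneg[OF s f]] by (rule le)
    qed
    then show ?thesis using f by blast
  qed
  then show ?thesis
    unfolding hilbert_space_def using function_subspace_sob semi_inner_product_sob by blast
qed

lemma smooth_subset_sob: "smooth False \<subseteq> sob k"
proof
  fix g assume g: "g \<in> smooth False"
  then obtain c g0 where g0: "g0 \<in> S0 False" "g = (\<lambda>x. c + g0 x)"
    unfolding smooth_def by blast
  obtain F where F: "F \<in> S0 (odd k)" "g0 = JL False k F"
    using S0_unroll[OF g0(1), of k] by auto
  show "g \<in> sob k"
    unfolding sob_iff
  proof (intro conjI bexI exI)
    show "AE x in \<mu> False. g x = c + JL False k F x" using g0(2) F(2) by simp
  qed (use smooth_L2[OF g] S0_subset_L0[OF F(1)] in auto)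
qed

text \<open>The \<open>k\<close>-th derivative is approximated by a smooth function, which is then integrated back \<open>k\<close>
  times; boundedness of the integrations controls the errors in the lower derivatives.\<close>

lemma dense_smooth: "dense_in (ips k) (smooth False) (sob k)"
  unfolding dense_in_def
proof (intro conjI ballI allI impI smooth_subset_sob)
  fix f and e :: real assume f: "f \<in> sob k" and e: "e > 0"
  obtain F c where F: "F \<in> L0 (odd k)" and ae: "AE x in \<mu> False. f x = c + JL False k F x"
    using f unfolding sob_iff by blast
  define \<epsilon> where "\<epsilon> = e / (real (Suc k) * J_norm ^ k)"
  have BS: "real (Suc k) * J_norm ^ k > 0" using J_norm_ge_1 by simp
  then have \<epsilon>: "\<epsilon> > 0" using e by (simp only: \<epsilon>_def zero_less_divide_iff) simp
  obtain G where G: "G \<in> S0 (odd k)" and close: "form_dist (l2 (\<mu> (odd k))) F G < \<epsilon>"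
    using S0_dense[OF F \<epsilon>] by blast
  have GL: "G \<in> L0 (odd k)" by (rule S0_subset_L0[OF G])
  define g where "g x = c + JL False k G x" for x
  have g: "g \<in> smooth False"
    unfolding smooth_def g_def[abs_def] using S0_JL[of G False k] G by auto
  have gs: "g \<in> sob k" using g smooth_subset_sob by blast
  have eq: "AE x in \<mu> False. f x - g x = 0 + JL False k (\<lambda>x. F x - G x) x"
  proof -
    have JL: "JL False k (\<lambda>x. F x - G x) = (\<lambda>x. JL False k F x - JL False k G x)"
      by (rule JL_diff) (use F GL in simp_all)
    from ae show ?thesis unfolding JL by eventually_elim (simp add: g_def)
  qed
  have bound: "nrm (odd i) (d i (\<lambda>x. f x - g x)) \<le> J_norm ^ k * form_dist (l2 (\<mu> (odd k))) F G" if i: "i \<le> k" for i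
  proof -
    let ?m = "k - i"
    have lev: "lev (odd i) ?m = odd k"
      using lev_add[of False i ?m] i by simp
    have FG: "F \<in> L0 (lev (odd i) ?m)" "G \<in> L0 (lev (odd i) ?m)" using F GL lev by simp_all
    have d: "AE x in \<mu> (odd i). d i (\<lambda>x. f x - g x) x = JL (odd i) ?m (\<lambda>x. F x - G x) x"
    proof (cases "i = 0")
      case True
      have o: "odd (0 :: nat) = False" by simp
      show ?thesis using eq unfolding True o d_0 minus_nat.diff_0 add_0 .
    next
      case False
      from wd_of_JL[OF sob_L2[OF sob_diff[OF f gs]] L0.diff_mem[OF F GL] eq _ i] False
      have "wd i (\<lambda>x. f x - g x) (JL (odd i) ?m (\<lambda>x. F x - G x))" by simp
      from AE_d_eq[OF sob_diff[OF f gs] i this] show ?thesis by simp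
    qed
    have "nrm (odd i) (d i (\<lambda>x. f x - g x)) = nrm (odd i) (JL (odd i) ?m (\<lambda>x. F x - G x))"
      by (rule \<mu>.form_norm_cong_AE[OF d_L2[OF sob_diff[OF f gs] i]
            L0D(1)[OF JL_mem_L0[OF L0.diff_mem[OF FG]]] d])
    also have "\<dots> \<le> J_norm ^ ?m * nrm (odd k) (\<lambda>x. F x - G x)"
      using nrm_JL_le[OF L0.diff_mem[OF FG]] unfolding lev .
    also have "\<dots> \<le> J_norm ^ k * nrm (odd k) (\<lambda>x. F x - G x)"
      by (intro mult_right_mono power_increasing J_norm_ge_1 L0.form_norm_nonneg L0.diff_mem F GL) simp
    finally show ?thesis by (simp add: form_dist_def)
  qed
  have "form_dist (ips k) f g \<le> (\<Sum>i\<le>k. nrm (odd i) (d i (\<lambda>x. f x - g x)))"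
    unfolding form_dist_def by (rule form_norm_ips_le_sum[OF sob_diff[OF f gs]])
  also have "\<dots> \<le> (\<Sum>i\<le>k. J_norm ^ k * form_dist (l2 (\<mu> (odd k))) F G)"
    by (rule sum_mono) (use bound in simp)
  also have "\<dots> = (real (Suc k) * J_norm ^ k) * form_dist (l2 (\<mu> (odd k))) F G" by simp
  also have "\<dots> < e"
    using close BS unfolding \<epsilon>_def by (simp only: pos_less_divide_eq mult.commute)
  finally show "\<exists>g\<in>smooth False. form_dist (ips k) f g < e" using g by blast
qed

lemma form_norm_ips_eq_0_iff:
  assumes f: "f \<in> sob k"
  shows "form_norm (ips k) f = 0 \<longleftrightarrow> (AE x in \<mu> False. f x = 0)"
proof
  assume "form_norm (ips k) f = 0"
  then have "nrm False f \<le> 0" using nrm_d_le[OF f, of 0] by simp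
  then have "nrm False f = 0" using \<mu>.L2.form_norm_nonneg[OF sob_L2[OF f]] by simp
  then show "AE x in \<mu> False. f x = 0" using \<mu>.form_norm_eq_0_iff[OF sob_L2[OF f]] by simp
next
  assume ae: "AE x in \<mu> False. f x = 0"
  have "nrm (odd i) (d i f) = 0" if i: "i \<le> k" for i
  proof -
    have "wd i (\<lambda>x. 0 * f x) (\<lambda>x. 0 * d i f x)" by (rule wd_scale[OF wd_d[OF f i]])
    then have "AE x in \<mu> (odd i). d i f x = 0"
      using AE_d_eq[OF f i, of "\<lambda>x. 0" "\<lambda>x. 0"] ae by simp
    then show ?thesis using \<mu>.form_norm_eq_0_iff[OF d_L2[OF f i]] by simp
  qed
  then have "form_norm (ips k) f \<le> 0" using form_norm_ips_le_sum[OF f] by simp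
  then show "form_norm (ips k) f = 0" using sob.form_norm_nonneg[OF f] by simp
qed


text \<open>If all weak derivatives of \<open>f\<close> exist, the primitive of each of them is a regular representative
  of the preceding one. These representatives are primitives of each other, so the first of them,
  plus a constant, is smooth.\<close>

lemma Inter_sob_iff:
  "f \<in> (\<Inter>k. sob k) \<longleftrightarrow> f \<in> sob 0 \<and> (\<exists>g\<in>smooth False. form_dist (ips 0) f g = 0)"
proof
  assume all: "f \<in> (\<Inter>k. sob k)"
  then have f: "f \<in> sob k" for k by blast
  have dL: "d (Suc n) f \<in> L0 (\<not> odd n)" for n
    by (rule d_L0[OF f[of "Suc n"] order_refl])
  define \<phi> where "\<phi> n = J (odd n) (d (Suc n) f)" for n
  have \<phi>C: "\<phi> n \<in> C (odd n)" for n
    unfolding \<phi>_def by (rule J_mem_C[OF dL])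
  have w: "\<exists>c. AE x in \<mu> (odd n). d n f x = c + \<phi> n x" for n
    using weak_d[OF f[of "Suc n"] order_refl] unfolding weak_iff \<phi>_def by blast
  have odd: "odd (Suc n) = (\<not> odd n)" for n :: nat by simp
  have \<phi>_Suc: "\<phi> n = J (odd n) (\<phi> (Suc n))" for n
  proof -
    have \<phi>L: "\<phi> (Suc n) \<in> L0 (\<not> odd n)"
      using C_subset_L0[OF \<phi>C[of "Suc n"]] unfolding odd .
    obtain c where c: "AE x in \<mu> (\<not> odd n). d (Suc n) f x = c + \<phi> (Suc n) x"
      using w[of "Suc n"] unfolding odd by blast
    have "c = 0" by (rule const_AE_imp_zero[OF dL \<phi>L c])
    with c have "AE x in \<mu> (\<not> odd n). d (Suc n) f x = \<phi> (Suc n) x" by simp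
    from J_cong_AE[OF dL \<phi>L this] show ?thesis by (simp add: \<phi>_def[of n])
  qed
  have \<phi>S: "\<phi> 0 \<in> S0 False"
    unfolding S0_def
  proof (intro CollectI exI[of _ \<phi>] conjI allI)
    show "\<phi> n \<in> C (lev False n)" "\<phi> n = J (lev False n) (\<phi> (Suc n))" for n
      unfolding lev_simps by (rule \<phi>C, rule \<phi>_Suc)
  qed simp
  obtain c where c: "AE x in \<mu> (odd (0 :: nat)). d 0 f x = c + \<phi> 0 x" using w[of 0] by blast
  have o: "odd (0 :: nat) = False" by simp
  have g: "(\<lambda>x. c + \<phi> 0 x) \<in> smooth False"
    unfolding smooth_def using \<phi>S by blast
  have "AE x in \<mu> False. f x - (c + \<phi> 0 x) = 0"
    using c unfolding o d_0 by eventually_elim simp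
  then have "form_dist (ips 0) f (\<lambda>x. c + \<phi> 0 x) = 0"
    unfolding form_dist_def
    using form_norm_ips_eq_0_iff[OF sob_diff[OF f[of 0] subsetD[OF smooth_subset_sob g]]] by blast
  then show "f \<in> sob 0 \<and> (\<exists>g\<in>smooth False. form_dist (ips 0) f g = 0)"
    using f[of 0] g by blast
next
  assume "f \<in> sob 0 \<and> (\<exists>g\<in>smooth False. form_dist (ips 0) f g = 0)"
  then obtain g where f: "f \<in> sob 0" and g: "g \<in> smooth False" and d: "form_dist (ips 0) f g = 0"
    by blast
  have gs: "g \<in> sob k" for k using g smooth_subset_sob by blast
  have ae: "AE x in \<mu> False. f x = g x"
    using d form_norm_ips_eq_0_iff[OF sob_diff[OF f gs]] by (simp add: form_dist_def)
  have "f \<in> sob k" for k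
  proof -
    obtain F c where F: "F \<in> L0 (odd k)" and c: "AE x in \<mu> False. g x = c + JL False k F x"
      using gs[of k] unfolding sob_iff by blast
    from ae c have "AE x in \<mu> False. f x = c + JL False k F x" by eventually_elim simp
    then show ?thesis unfolding sob_iff using sob_L2[OF f] F by blast
  qed
  then show "f \<in> (\<Inter>k. sob k)" by blast
qed

lemma countably_hilbert_smooth: "countably_hilbert (smooth False) sob ips"
  unfolding countably_hilbert_def
proof (intro conjI allI ballI)
  show "function_subspace (smooth False)" by (rule function_subspace_smooth)
  show "hilbert_space (sob n) (ips n)" "dense_in (ips n) (smooth False) (sob n)" for n
    by (rule hilbert_space_sob, rule dense_smooth)
  show "sob (Suc n) \<subseteq> sob n" for n by (rule sob_mono) simp
  show "form_norm (ips n) f \<le> form_norm (ips (Suc n)) f" if "f \<in> sob (Suc n)" for n f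
    by (rule form_norm_ips_mono[OF that]) simp
  show "form_norm (ips n) f = 0 \<longleftrightarrow> form_norm (ips 0) f = 0" if "f \<in> sob n" for n f
    using form_norm_ips_eq_0_iff[OF that] form_norm_ips_eq_0_iff[OF subsetD[OF sob_mono[of 0 n] that]]
    by simp
  show "f \<in> (\<Inter>n. sob n) \<longleftrightarrow> f \<in> sob 0 \<and> (\<exists>g\<in>smooth False. form_dist (ips 0) f g = 0)" for f
    by (rule Inter_sob_iff)
qed

section \<open>The inclusions are Hilbert--Schmidt\<close>

text \<open>\<open>rep i f\<close> is the representative of the \<open>i\<close>-th weak derivative obtained by integrating the
  next one. Unlike \<open>weak_deriv\<close>, it is a linear function of \<open>f\<close> at every single point.\<close>

definition rep :: "nat \<Rightarrow> (real \<Rightarrow> real) \<Rightarrow> real \<Rightarrow> real" where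
  "rep i f x = (if i = 0 then (\<integral>x. f x \<partial>\<mu> False) / mass False else 0) + J (odd i) (d (Suc i) f) x"

lemma AE_rep:
  assumes f: "f \<in> sob k" and i: "Suc i \<le> k"
  shows "AE x in \<mu> (odd i). d i f x = rep i f x"
proof -
  obtain c where c: "AE x in \<mu> (odd i). d i f x = c + J (odd i) (d (Suc i) f) x"
    using weak_d[OF f i] unfolding weak_iff by blast
  have JL: "J (odd i) (d (Suc i) f) \<in> L0 (odd i)" by (rule J_mem_L0[OF d_L0[OF f i]])
  have "(\<integral>x. d i f x \<partial>\<mu> (odd i)) = (\<integral>x. c + J (odd i) (d (Suc i) f) x \<partial>\<mu> (odd i))"
    using i by (intro \<mu>.integral_cong_AE_L2 d_L2[OF f] \<mu>.L2.add_mem \<mu>.L2_const L0D(1)[OF JL] c) simp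
  also have "\<dots> = c * mass (odd i)"
    using L0D(2)[OF JL] \<mu>.L2_integrable[OF L0D(1)[OF JL]] by (simp add: mass_def mult.commute)
  finally have "c = (\<integral>x. d i f x \<partial>\<mu> (odd i)) / mass (odd i)"
    using mass_pos[of "odd i"] by (simp add: field_simps)
  also have "\<dots> = (if i = 0 then (\<integral>x. f x \<partial>\<mu> False) / mass False else 0)"
  proof (cases i)
    case (Suc j)
    have "d i f \<in> L0 (\<not> odd j)" unfolding Suc by (rule d_L0[OF f]) (use i Suc in simp)
    then show ?thesis using L0D(2)[of "d i f" "odd i"] Suc by simp
  qed simp
  finally show ?thesis using c unfolding rep_def by simp
qed

lemma rep_add:
  assumes f: "f \<in> sob k" and g: "g \<in> sob k" and i: "Suc i \<le> k"
  shows "rep i (\<lambda>x. f x + g x) x = rep i f x + rep i g x"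
proof -
  have odd: "odd (Suc i) = (\<not> odd i)" by simp
  have "J (odd i) (d (Suc i) (\<lambda>x. f x + g x)) = J (odd i) (\<lambda>x. d (Suc i) f x + d (Suc i) g x)"
    by (rule J_cong_AE[OF d_L0[OF sob_add[OF f g] i] L0.add_mem[OF d_L0[OF f i] d_L0[OF g i]]
          AE_d_add[OF f g i, unfolded odd]])
  also have "\<dots> = (\<lambda>x. J (odd i) (d (Suc i) f) x + J (odd i) (d (Suc i) g) x)"
    by (rule J_add[OF d_L0[OF f i] d_L0[OF g i]])
  finally have J: "J (odd i) (d (Suc i) (\<lambda>x. f x + g x)) =
      (\<lambda>x. J (odd i) (d (Suc i) f) x + J (odd i) (d (Suc i) g) x)" .
  have "(\<integral>x. f x + g x \<partial>\<mu> False) = (\<integral>x. f x \<partial>\<mu> False) + (\<integral>x. g x \<partial>\<mu> False)"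
    using \<mu>.L2_integrable[OF sob_L2[OF f]] \<mu>.L2_integrable[OF sob_L2[OF g]] by simp
  then show ?thesis
    unfolding rep_def J by (simp add: add_divide_distrib)
qed

lemma rep_scale:
  assumes f: "f \<in> sob k" and i: "Suc i \<le> k"
  shows "rep i (\<lambda>x. c * f x) x = c * rep i f x"
proof -
  have odd: "odd (Suc i) = (\<not> odd i)" by simp
  have "J (odd i) (d (Suc i) (\<lambda>x. c * f x)) = J (odd i) (\<lambda>x. c * d (Suc i) f x)"
    by (rule J_cong_AE[OF d_L0[OF sob_scale[OF f] i] L0.scale_mem[OF d_L0[OF f i]]
          AE_d_scale[OF f i, unfolded odd]])
  also have "\<dots> = (\<lambda>x. c * J (odd i) (d (Suc i) f) x)" by (rule J_scale)
  finally show ?thesis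
    by (simp add: rep_def distrib_left)
qed

definition rep_bound :: real where
  "rep_bound = sqrt (mass False) / mass False + J_bound False + J_bound True"

lemma abs_rep_le:
  assumes f: "f \<in> sob k" and i: "Suc i \<le> k"
  shows "\<bar>rep i f x\<bar> \<le> rep_bound * form_norm (ips k) f"
proof -
  let ?N = "form_norm (ips k) f"
  have N: "?N \<ge> 0" by (rule sob.form_norm_nonneg[OF f])
  have m: "mass False > 0" by (rule mass_pos)
  have "\<bar>\<integral>x. f x \<partial>\<mu> False\<bar> \<le> sqrt (mass False) * nrm False f"
    unfolding mass_def by (rule \<mu>.abs_integral_le_norm[OF sob_L2[OF f]])
  also have "\<dots> \<le> sqrt (mass False) * ?N"
    using nrm_d_le[OF f, of 0] m by (intro mult_left_mono) simp_all
  finally have mean: "\<bar>(\<integral>x. f x \<partial>\<mu> False) / mass False\<bar> \<le> sqrt (mass False) / mass False * ?N"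
    using m by (simp add: abs_divide divide_right_mono)
  have "\<bar>J (odd i) (d (Suc i) f) x\<bar> \<le> J_bound (odd i) * nrm (\<not> odd i) (d (Suc i) f)"
    by (rule abs_J_le[OF d_L0[OF f i]])
  also have "\<dots> \<le> J_bound (odd i) * ?N"
    using nrm_d_le[OF f i] J_bound_nonneg by (intro mult_left_mono) simp_all
  also have "\<dots> \<le> (J_bound False + J_bound True) * ?N"
    using J_bound_nonneg[of False] J_bound_nonneg[of True] N
    by (intro mult_right_mono) (cases "odd i", simp_all)
  finally have J: "\<bar>J (odd i) (d (Suc i) f) x\<bar> \<le> (J_bound False + J_bound True) * ?N" .
  have "\<bar>rep i f x\<bar> \<le> sqrt (mass False) / mass False * ?N + (J_bound False + J_bound True) * ?N"
  proof (cases "i = 0")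
    case True
    then have r: "rep i f x = (\<integral>x. f x \<partial>\<mu> False) / mass False + J (odd i) (d (Suc i) f) x"
      by (simp add: rep_def)
    show ?thesis
      unfolding r by (rule order_trans[OF abs_triangle_ineq add_mono[OF mean J]])
  next
    case False
    have "0 \<le> sqrt (mass False) / mass False * ?N" using m N by simp
    then show ?thesis using False J unfolding rep_def by simp
  qed
  then show ?thesis by (simp add: rep_bound_def distrib_right add.assoc)
qed

text \<open>For each point \<open>x\<close>, evaluation of \<open>rep i\<close> at \<open>x\<close> is a bounded functional to which Bessel's
  inequality applies; the resulting bound is integrated over \<open>x\<close>.\<close>

lemma sum_nrm_d_sq_le:
  assumes A: "finite A" "A \<subseteq> sob k" "\<And>e e'. e \<in> A \<Longrightarrow> e' \<in> A \<Longrightarrow> ips k e e' = (if e = e' then 1 else 0)"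
    and i: "Suc i \<le> k"
  shows "(\<Sum>e\<in>A. (nrm (odd i) (d i e))\<^sup>2) \<le> rep_bound\<^sup>2 * mass (odd i)"
proof -
  have i': "i \<le> k" using i by simp
  have e: "e \<in> sob k" if "e \<in> A" for e using that A(2) by blast
  have repL: "rep i e \<in> L2 (\<mu> (odd i))" if "e \<in> A" for e
  proof -
    have "rep i e = (\<lambda>x. (if i = 0 then (\<integral>x. e x \<partial>\<mu> False) / mass False else 0) + J (odd i) (d (Suc i) e) x)"
      by (simp add: fun_eq_iff rep_def)
    then show ?thesis
      using \<mu>.L2.add_mem[OF \<mu>.L2_const L0D(1)[OF J_mem_L0[OF d_L0[OF e[OF that] i]]]] by simp
  qed
  have int: "integrable (\<mu> (odd i)) (\<lambda>x. (rep i e x)\<^sup>2)" if "e \<in> A" for e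
    by (rule \<mu>.L2D(3)[OF repL[OF that]])
  have "(\<Sum>e\<in>A. (nrm (odd i) (d i e))\<^sup>2) = (\<Sum>e\<in>A. \<integral>x. (rep i e x)\<^sup>2 \<partial>\<mu> (odd i))"
  proof (rule sum.cong)
    fix f assume f: "f \<in> A"
    have "nrm (odd i) (d i f) = nrm (odd i) (rep i f)"
      by (rule \<mu>.form_norm_cong_AE[OF d_L2[OF e[OF f] i'] repL[OF f] AE_rep[OF e[OF f] i]])
    then have "(nrm (odd i) (d i f))\<^sup>2 = l2 (\<mu> (odd i)) (rep i f) (rep i f)"
      using \<mu>.L2.form_norm_sq[OF repL[OF f]] by simp
    then show "(nrm (odd i) (d i f))\<^sup>2 = (\<integral>x. (rep i f x)\<^sup>2 \<partial>\<mu> (odd i))"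
      by (simp add: power2_eq_square)
  qed simp
  also have "\<dots> = (\<integral>x. (\<Sum>e\<in>A. (rep i e x)\<^sup>2) \<partial>\<mu> (odd i))"
    by (rule Bochner_Integration.integral_sum[symmetric]) (rule int)
  also have "\<dots> \<le> (\<integral>x. rep_bound\<^sup>2 \<partial>\<mu> (odd i))"
  proof (rule integral_mono)
    show "integrable (\<mu> (odd i)) (\<lambda>x. \<Sum>e\<in>A. (rep i e x)\<^sup>2)"
      by (rule Bochner_Integration.integrable_sum) (rule int)
    show "(\<Sum>e\<in>A. (rep i e x)\<^sup>2) \<le> rep_bound\<^sup>2" for x
      by (rule sob.sum_functional_sq_le[OF A(1,2), where r = "\<lambda>f. rep i f x"])
         (rule A(3) rep_add[OF _ _ i] rep_scale[OF _ i] abs_rep_le[OF _ i]; assumption)+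
  qed simp
  also have "\<dots> = rep_bound\<^sup>2 * mass (odd i)" by (simp add: mass_def mult.commute)
  finally show ?thesis .
qed

lemma hilbert_schmidt_inclusion: "hilbert_schmidt (sob (Suc n)) (ips (Suc n)) (sob n) (ips n) (\<lambda>f. f)"
proof -
  obtain E where E: "orthonormal_basis (sob (Suc n)) (ips (Suc n)) E"
    using exists_orthonormal_basis[OF hilbert_space_sob] by blast
  have mono: "sob (Suc n) \<subseteq> sob n" by (rule sob_mono) simp
  have "(\<lambda>e. (form_norm (ips n) e)\<^sup>2) summable_on E"
  proof (rule nonneg_bdd_above_summable_on)
    show "bdd_above (sum (\<lambda>e. (form_norm (ips n) e)\<^sup>2) ` {F. F \<subseteq> E \<and> finite F})"
    proof (rule bdd_aboveI2)
      fix A assume "A \<in> {F. F \<subseteq> E \<and> finite F}"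
      then have A: "finite A" "A \<subseteq> sob (Suc n)"
        "\<And>e e'. e \<in> A \<Longrightarrow> e' \<in> A \<Longrightarrow> ips (Suc n) e e' = (if e = e' then 1 else 0)"
        using E unfolding orthonormal_basis_def by blast+
      have "(\<Sum>e\<in>A. (form_norm (ips n) e)\<^sup>2) = (\<Sum>e\<in>A. \<Sum>i\<le>n. (nrm (odd i) (d i e))\<^sup>2)"
      proof (rule sum.cong)
        fix e assume "e \<in> A"
        then have e: "e \<in> sob n" using A(2) mono by blast
        have "(form_norm (ips n) e)\<^sup>2 = (\<Sum>i\<le>n. l2 (\<mu> (odd i)) (d i e) (d i e))"
          unfolding sob.form_norm_sq[OF e] by (rule ips_eq)
        also have "\<dots> = (\<Sum>i\<le>n. (nrm (odd i) (d i e))\<^sup>2)"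
          by (rule sum.cong) (use \<mu>.L2.form_norm_sq[OF d_L2[OF e]] in simp_all)
        finally show "(form_norm (ips n) e)\<^sup>2 = (\<Sum>i\<le>n. (nrm (odd i) (d i e))\<^sup>2)" .
      qed simp
      also have "\<dots> = (\<Sum>i\<le>n. \<Sum>e\<in>A. (nrm (odd i) (d i e))\<^sup>2)" by (rule sum.swap)
      also have "\<dots> \<le> (\<Sum>i\<le>n. rep_bound\<^sup>2 * mass (odd i))"
        by (rule sum_mono, rule sum_nrm_d_sq_le[OF A]) simp_all
      finally show "(\<Sum>e\<in>A. (form_norm (ips n) e)\<^sup>2) \<le> (\<Sum>i\<le>n. rep_bound\<^sup>2 * mass (odd i))" .
    qed
  qed simp
  moreover have "form_norm (ips n) f \<le> 1 * form_norm (ips (Suc n)) f" if "f \<in> sob (Suc n)" for f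
    using form_norm_ips_mono[OF that, of n] by simp
  ultimately show ?thesis
    unfolding hilbert_schmidt_def using mono E by blast
qed

lemma nuclear_smooth: "nuclear_space (smooth False) sob ips"
  unfolding nuclear_space_def using countably_hilbert_smooth hilbert_schmidt_inclusion lessI by blast

end

theorem theorem27:
  fixes W V :: "real \<Rightarrow> real"
  assumes "strict_mono W" and "cadlag W" and "periodic_increments W"
    and "isCont W 0" and "W 0 = 0"
    and "strict_mono V" and "caglad V" and "periodic_increments V"
    and "isCont V 0" and "V 0 = 0"
  shows "nuclear_space (Cinf_WV W V) (sobolev_space W V) (sobolev_inner W V)"
proof -
  interpret increasing_pair W V
    by unfold_locales (fact assms)+
  show ?thesis
    using nuclear_smooth unfolding Cinf_eq_smooth .
qed

end
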